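(* (1) (Sliding mode control.) Assume that (i)–(iv) of the context hold, that the disturbance $d$ is measurable and uniformly bounded, i.e. $|d(t)|\le K_d$ for some $K_d>0$ and all $t\ge 0$, and that the constant $K>0$ is chosen such that $\frac{K}{|B^*\varphi|}>K_d$. Then for any initial condition $z_0\in H$ the closed-loop system $$\frac{\mathrm d}{\mathrm dt} z \in A_L z+B\Big(d-\frac{1}{B^*\varphi}\big(\lambda\sigma(t)+K\,\mathrm{sign}(\sigma(t))\big)\Big),\qquad z(0)=z_0,\qquad \sigma(t)=\langle\varphi,z(t)\rangle_H, \quad (\mathrm{SM})$$ admits a mild solution. (2) (Super-twisting control.) Let $\mathbb{K}=\mathbb{R}$. Assume that (i)–(iv) of the context hold, that $d$ is globally Lipschitz over $\mathbb{R}_+$ and there is a known constant $C>0$ with $|\dot d(t)|\le C$ for a.e. $t\in\mathbb{R}_+$, and that the positive constants $\alpha,\beta$ satisfy $\beta>|B^*\varphi|\,C$ and $\alpha>\sqrt{\beta+|B^*\varphi|\,C}$. Then for any initial condition $z_0\in H$ and $w_0\in\mathbb{R}$ the closed-loop system $$\begin{cases}\frac{\mathrm d}{\mathrm dt} z = A_L z+B\Big(\frac{1}{B^*\varphi}\big(-\lambda\sigma(t)-\alpha|\sigma(t)|^{1/2}\mathrm{sign}(\sigma(t))+w(t)\big)\Big),\\ \dot w(t)\in B^*\varphi\,\dot d(t)-\beta\,\mathrm{sign}(\sigma(t)),\\ z(0)=z_0,\ w(0)=w_0,\qquad \sigma(t)=\langle\varphi,z(t)\rangle_H,\end{cases}\quad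 (\mathrm{ST})$$ admits a mild solution.
   Context: Setting. $\mathbb{K}$ is $\mathbb{R}$ or $\mathbb{C}$; $(H,\langle\cdot,\cdot\rangle_H)$ is a Hilbert space over $\mathbb{K}$ with norm $\|\cdot\|_H$. $A:D(A)\subseteq H\to H$ is a linear operator with $D(A)$ dense in $H$ and adjoint $A^*$; $D(A^* )'$ is the dual of $D(A^* )$; $B\in\mathcal{L}(\mathbb{K},D(A^* )')$ has adjoint $B^*\in\mathcal{L}(D(A^* ),\mathbb{K})$. The open-loop system is $\frac{\mathrm d}{\mathrm dt}z=Az+B(u+d)$, $z(0)=z_0$, with state $z(t)\in H$, control $u(t)\in\mathbb{K}$ and unknown disturbance $d(t)\in\mathbb{K}$. Assumptions. (i) $A$ generates a strongly continuous semigroup $(\mathbb{T}(t))_{t\ge0}$ on $H$. (ii) $B$ is admissible (as a control operator) for $(\mathbb{T}(t))_{t\ge0}$. (iii) Let $T>0$. The pair $(A,B)$ is approximately controllable in $H$ in time $T$, i.e. $\forall\psi\in D(A^* )$, $\forall t\in[0,T]$, $B^*\mathbb{T}^*(T-t)\psi=0\Longrightarrow\psi=0$. (iv) There exists an operator $L:D(L)\to\mathbb{K}$ such that the operator $A_L=A+BL$, with $D(A_L)=\{z\in D(L): (A+BL)z\in H\}$, is the infinitesimal generator of a strongly continuous semigroup $(\mathbb{S}(t))_{t\ge0}$ on $H$, and the origin of $\frac{\mathrm d}{\mathrm dt}z=(A+BL)z$, $z(0)=z_0$, is globally asymptotically stable. Eigenfunction. $\varphi\in D(A_L^* )$ is an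 eigenfunction (so $\varphi\ne0$) of the adjoint operator $A_L^*$ of $A_L$ and $\lambda$ is the associated eigenvalue, $A_L^*\varphi=\lambda\varphi$. Here $D(A_L^* )=\{\psi\in H:\exists c>0,\ \forall\phi\in D(A_L),\ |\langle\psi,A_L\phi\rangle_H|\le c\|\phi\|_H\}\subset D(A^* )$ (the inclusion is as asserted by the paper). By (iii) with $t=T$, the scalar $B^*\varphi$ is nonzero. Set-valued sign. $\mathrm{sign}(s)=\frac{s}{|s|}$ if $s\ne0$, and $\mathrm{sign}(0)=[-1,1]$. Mild solution of (SM): a map $z:[0,\infty)\to H$ with $z\in C([0,\infty);H)\cap\mathcal{H}^1_{loc}([0,\infty);D(A^* )')$ (the latter meaning that $z$ and its derivative are locally square integrable with values in $D(A^* )'$) such that, for all $t\ge0$, $z(t)=\mathbb{S}(t)z_0+\int_0^t\mathbb{S}(t-s)Bh(s)\,ds$, where $h:[0,\infty)\to\mathbb{K}$ is in $L^2_{loc}([0,\infty);\mathbb{K})$ and satisfies, for a.e. $t\ge0$, $h(t)\in-\frac{1}{B^*\varphi}\big(\lambda\sigma(t)+K\,\mathrm{sign}(\sigma(t))\big)+d(t)$ with $\sigma(t)=\langle\varphi,z(t)\rangle_H$. Mild solution of (ST): maps $z:[0,\infty)\to H$ and $w:[0,\infty)\to\mathbb{R}$ with $z\in C([0,\infty);H)\cap\mathcal{H}^1_{loc}([0,\infty);D(A^* )')$ and $w$ absolutely continuous, $w(0)=w_0$, such that, for all $t\ge0$, $z(t)=\mathbb{S}(t)z_0+\int_0^t\mathbb{S}(t-s)B\omega(s)\,ds$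 and, for a.e. $t\ge0$, $\dot w(t)\in B^*\varphi\,\dot d(t)-\beta\,\mathrm{sign}(\sigma(t))$, where $\omega(t)=\frac{1}{B^*\varphi}\big(-\lambda\sigma(t)-\alpha|\sigma(t)|^{1/2}\mathrm{sign}(\sigma(t))+w(t)\big)$ and $\sigma(t)=\langle\varphi,z(t)\rangle_H$.
   Formalization: For 𝕂 = ℂ the set-valued sign at 0 is taken to be the closed unit disc instead of [-1,1], since with [-1,1] the claim in (1) fails (e.g. H = ℂ, A = 0, B = 1, L = -1, z_0 = 0, constant imaginary d); for 𝕂 = ℝ it is [-1,1]. *)

theory Defs
  imports "HOL-Analysis.Analysis" "Jordan_Normal_Form.Conjugate"
begin

section \<open>Hilbert spaces over the real or complex field\<close>

text \<open>
  A real normed field is isomorphic to the field of real or of complex numbers, and the last axiom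
  forces \<^const>\<open>conjugate\<close> to be the usual conjugation (the identity in the real case).
\<close>

class real_or_complex = conjugatable_field + real_normed_field + euclidean_space +
  assumes mult_conjugate: "x * conjugate x = (norm x)\<^sup>2 *\<^sub>R 1"

instance real :: real_or_complex
  by standard (simp add: power2_eq_square)

instance complex :: real_or_complex
  by standard (simp add: complex_norm_square[symmetric] scaleR_conv_of_real)

text \<open>
  Completeness and the topology come from the underlying real Banach space. The inner product
  is conjugate linear in its first and linear in its second argument.
\<close>

locale hilbert_space = vector_space scl
  for scl :: "'k::real_or_complex \<Rightarrow> 'h::banach \<Rightarrow> 'h" (infixr \<open>*\<^sub>K\<close> 75) +
  fixes ip :: "'h \<Rightarrow> 'h \<Rightarrow> 'k"
  assumes scl_of_real: "of_real r *\<^sub>K x = r *\<^sub>R x"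
    and ip_add: "ip x (y + z) = ip x y + ip x z"
    and ip_scl: "ip x (c *\<^sub>K y) = c * ip x y"
    and ip_conjugate: "ip y x = conjugate (ip x y)"
    and ip_norm: "ip x x = of_real ((norm x)\<^sup>2)"


section \<open>Unbounded operators and their adjoints\<close>

text \<open>An unbounded operator is given by its domain and a function used on the domain only.\<close>

definition linear_operator ::
    "('k::field \<Rightarrow> 'v::ab_group_add \<Rightarrow> 'v) \<Rightarrow> ('k \<Rightarrow> 'w::ab_group_add \<Rightarrow> 'w)
      \<Rightarrow> 'v set \<Rightarrow> ('v \<Rightarrow> 'w) \<Rightarrow> bool" where
  "linear_operator s s' D A \<longleftrightarrow> module.subspace s D
    \<and> (\<forall>x\<in>D. \<forall>y\<in>D. A (x + y) = A x + A y) \<and> (\<forall>c. \<forall>x\<in>D. A (s c x) = s' c (A x))"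

definition adj_dom ::
    "('h \<Rightarrow> 'h \<Rightarrow> 'k::real_normed_field) \<Rightarrow> 'h set \<Rightarrow> ('h \<Rightarrow> 'h) \<Rightarrow> 'h::real_normed_vector set" where
  "adj_dom ip D A = {\<psi>. \<exists>c>0. \<forall>x\<in>D. norm (ip \<psi> (A x)) \<le> c * norm x}"

definition adj :: "('h \<Rightarrow> 'h \<Rightarrow> 'k) \<Rightarrow> 'h set \<Rightarrow> ('h \<Rightarrow> 'h) \<Rightarrow> 'h \<Rightarrow> 'h" where
  "adj ip D A \<psi> = (THE y. \<forall>x\<in>D. ip y x = ip \<psi> (A x))"

definition graph_norm :: "('h \<Rightarrow> 'h) \<Rightarrow> 'h::real_normed_vector \<Rightarrow> real" where
  "graph_norm A x = sqrt ((norm x)\<^sup>2 + (norm (A x))\<^sup>2)"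


section \<open>The dual of the domain of the adjoint\<close>

text \<open>
  As usual with a pivot space, \<open>D(A\<^sup>*)'\<close> consists of the bounded conjugate-linear functionals on
  \<open>D(A\<^sup>*)\<close> with its graph norm, so that the embedding of \<open>H\<close>, sending \<open>x\<close> to
  \<open>\<psi> \<mapsto> \<langle>\<psi>, x\<rangle>\<close>, is linear. Functionals are functions on all of \<open>H\<close> whose values outside the
  domain \<open>V\<close> are irrelevant. Below \<open>V\<close> is the domain and \<open>N\<close> its norm.
\<close>

definition antidual ::
    "('k \<Rightarrow> 'h \<Rightarrow> 'h) \<Rightarrow> 'h set \<Rightarrow> ('h \<Rightarrow> real) \<Rightarrow> ('h::ab_group_add \<Rightarrow> 'k::real_or_complex) set" where
  "antidual scl V N = {f. (\<forall>\<psi>\<in>V. \<forall>\<eta>\<in>V. f (\<psi> + \<eta>) = f \<psi> + f \<eta>)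
      \<and> (\<forall>c. \<forall>\<psi>\<in>V. f (scl c \<psi>) = conjugate c * f \<psi>)
      \<and> (\<exists>C. \<forall>\<psi>\<in>V. norm (f \<psi>) \<le> C * N \<psi>)}"

definition dual_norm :: "'h set \<Rightarrow> ('h \<Rightarrow> real) \<Rightarrow> ('h \<Rightarrow> 'k::real_normed_vector) \<Rightarrow> real" where
  "dual_norm V N f = (SUP \<psi>\<in>{\<psi>\<in>V. N \<psi> \<le> 1}. norm (f \<psi>))"

definition L2_loc :: "(real \<Rightarrow> 'k::real_or_complex) \<Rightarrow> bool" where
  "L2_loc u \<longleftrightarrow> set_borel_measurable lebesgue {0..} u
    \<and> (\<forall>t\<ge>0. set_integrable lebesgue {0..t} (\<lambda>s. (norm (u s))\<^sup>2))"

text \<open>Bochner measurability and local square integrability of maps from the half line to the dual.\<close>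

definition antidual_measurable ::
    "('k \<Rightarrow> 'h \<Rightarrow> 'h) \<Rightarrow> 'h set \<Rightarrow> ('h \<Rightarrow> real)
      \<Rightarrow> (real \<Rightarrow> 'h::ab_group_add \<Rightarrow> 'k::real_or_complex) \<Rightarrow> bool" where
  "antidual_measurable scl V N g \<longleftrightarrow>
    (\<exists>G. (\<forall>n. simple_function lebesgue (G n)) \<and> (\<forall>n t. G n t \<in> antidual scl V N)
      \<and> (AE t in lebesgue. t \<ge> 0 \<longrightarrow>
            (\<lambda>n. dual_norm V N (\<lambda>\<psi>. g t \<psi> - G n t \<psi>)) \<longlonglongrightarrow> 0))"

definition antidual_L2_loc ::
    "('k \<Rightarrow> 'h \<Rightarrow> 'h) \<Rightarrow> 'h set \<Rightarrow> ('h \<Rightarrow> real)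
      \<Rightarrow> (real \<Rightarrow> 'h::ab_group_add \<Rightarrow> 'k::real_or_complex) \<Rightarrow> bool" where
  "antidual_L2_loc scl V N g \<longleftrightarrow> (\<forall>t\<ge>0. g t \<in> antidual scl V N) \<and> antidual_measurable scl V N g
    \<and> (\<forall>t\<ge>0. set_integrable lebesgue {0..t} (\<lambda>s. (dual_norm V N (g s))\<^sup>2))"

text \<open>
  A continuous function \<open>f\<close> is in \<open>H\<^sup>1\<^sub>l\<^sub>o\<^sub>c\<close> if \<open>f t = f 0 + \<integral>\<^sub>0\<^sup>t g\<close> with \<open>f\<close> and \<open>g\<close> locally square
  integrable. Since \<open>g\<close> is locally Bochner integrable and the elements of \<open>V\<close> separate the dual,
  this identity may be tested on each \<open>\<psi>\<close> in \<open>V\<close>.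
\<close>

definition antidual_H1_loc ::
    "('k \<Rightarrow> 'h \<Rightarrow> 'h) \<Rightarrow> 'h set \<Rightarrow> ('h \<Rightarrow> real)
      \<Rightarrow> (real \<Rightarrow> 'h::ab_group_add \<Rightarrow> 'k::real_or_complex) \<Rightarrow> bool" where
  "antidual_H1_loc scl V N f \<longleftrightarrow> antidual_L2_loc scl V N f
    \<and> (\<exists>g. antidual_L2_loc scl V N g
        \<and> (\<forall>t\<ge>0. \<forall>\<psi>\<in>V. f t \<psi> = f 0 \<psi> + (LINT s:{0..t}|lebesgue. g s \<psi>)))"

definition control_operator ::
    "('k \<Rightarrow> 'h \<Rightarrow> 'h) \<Rightarrow> 'h set \<Rightarrow> ('h \<Rightarrow> real)
      \<Rightarrow> ('k \<Rightarrow> 'h::ab_group_add \<Rightarrow> 'k::real_or_complex) \<Rightarrow> bool" where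
  "control_operator scl V N B \<longleftrightarrow> (\<forall>u. B u \<in> antidual scl V N)
    \<and> (\<forall>u v. \<forall>\<psi>\<in>V. B (u + v) \<psi> = B u \<psi> + B v \<psi>)
    \<and> (\<forall>c u. \<forall>\<psi>\<in>V. B (c * u) \<psi> = c * B u \<psi>)
    \<and> (\<exists>C. \<forall>u. dual_norm V N (B u) \<le> C * norm u)"

text \<open>The adjoint of \<open>B\<close>, characterised by \<open>\<langle>B\<^sup>*\<psi>, u\<rangle> = \<langle>\<psi>, B u\<rangle>\<close>.\<close>

definition control_adj :: "('k \<Rightarrow> 'h \<Rightarrow> 'k::real_or_complex) \<Rightarrow> 'h \<Rightarrow> 'k" where
  "control_adj B \<psi> = (THE b. \<forall>u. conjugate b * u = B u \<psi>)"


section \<open>Semigroups\<close>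

definition C0_semigroup ::
    "('k \<Rightarrow> 'h \<Rightarrow> 'h) \<Rightarrow> (real \<Rightarrow> 'h \<Rightarrow> 'h::real_normed_vector) \<Rightarrow> bool" where
  "C0_semigroup scl S \<longleftrightarrow>
    (\<forall>t\<ge>0. bounded_linear (S t) \<and> (\<forall>c x. S t (scl c x) = scl c (S t x)))
    \<and> S 0 = id \<and> (\<forall>s\<ge>0. \<forall>t\<ge>0. S (s + t) = S s \<circ> S t)
    \<and> (\<forall>x. ((\<lambda>t. S t x) \<longlongrightarrow> x) (at_right 0))"

definition generates ::
    "('k \<Rightarrow> 'h \<Rightarrow> 'h) \<Rightarrow> 'h set \<Rightarrow> ('h \<Rightarrow> 'h) \<Rightarrow> (real \<Rightarrow> 'h \<Rightarrow> 'h::real_normed_vector) \<Rightarrow> bool" where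
  "generates scl D A S \<longleftrightarrow> C0_semigroup scl S
    \<and> D = {x. \<exists>y. ((\<lambda>t. (S t x - x) /\<^sub>R t) \<longlongrightarrow> y) (at_right 0)}
    \<and> (\<forall>x\<in>D. ((\<lambda>t. (S t x - x) /\<^sub>R t) \<longlongrightarrow> A x) (at_right 0))"

text \<open>
  The functional \<open>\<integral>\<^sub>0\<^sup>t S(t - s) B u(s) ds\<close> evaluated at \<open>\<psi>\<close>. If \<open>A\<close> generates \<open>S\<close>, then \<open>S\<close> extends
  to \<open>D(A\<^sup>*)'\<close> by \<open>(S(r) f) \<psi> = f (S(r)\<^sup>* \<psi>)\<close>.
\<close>

definition input_map ::
    "('h \<Rightarrow> 'h \<Rightarrow> 'k) \<Rightarrow> (real \<Rightarrow> 'h \<Rightarrow> 'h) \<Rightarrow> ('k \<Rightarrow> 'h \<Rightarrow> 'k) \<Rightarrow> (real \<Rightarrow> 'k)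
      \<Rightarrow> real \<Rightarrow> 'h \<Rightarrow> 'k::real_or_complex" where
  "input_map ip S B u t \<psi> = (LINT s:{0..t}|lebesgue. B (u s) (adj ip UNIV (S (t - s)) \<psi>))"

text \<open>Admissibility: for some positive time, the input map takes its values in \<open>H\<close>.\<close>

definition admissible ::
    "('h \<Rightarrow> 'h \<Rightarrow> 'k) \<Rightarrow> 'h set \<Rightarrow> (real \<Rightarrow> 'h \<Rightarrow> 'h) \<Rightarrow> ('k \<Rightarrow> 'h \<Rightarrow> 'k::real_or_complex) \<Rightarrow> bool" where
  "admissible ip V S B \<longleftrightarrow>
    (\<exists>t>0. \<forall>u. L2_loc u \<longrightarrow> (\<exists>x. \<forall>\<psi>\<in>V. ip \<psi> x = input_map ip S B u t \<psi>))"

text \<open>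
  The quantifier over \<open>t\<close> belongs to the premise: only an observation vanishing on the whole
  interval forces \<open>\<psi>\<close> to vanish.
\<close>

definition approx_controllable ::
    "('h::zero \<Rightarrow> 'h \<Rightarrow> 'k::real_or_complex) \<Rightarrow> 'h set \<Rightarrow> (real \<Rightarrow> 'h \<Rightarrow> 'h)
      \<Rightarrow> ('k \<Rightarrow> 'h \<Rightarrow> 'k) \<Rightarrow> real \<Rightarrow> bool" where
  "approx_controllable ip V S B \<tau> \<longleftrightarrow>
    (\<forall>\<psi>\<in>V. (\<forall>t\<in>{0..\<tau>}. control_adj B (adj ip UNIV (S (\<tau> - t)) \<psi>) = 0) \<longrightarrow> \<psi> = 0)"

definition globally_asymptotically_stable :: "(real \<Rightarrow> 'h \<Rightarrow> 'h::real_normed_vector) \<Rightarrow> bool" where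
  "globally_asymptotically_stable S \<longleftrightarrow>
    (\<forall>\<epsilon>>0. \<exists>\<delta>>0. \<forall>x. norm x < \<delta> \<longrightarrow> (\<forall>t\<ge>0. norm (S t x) < \<epsilon>))
    \<and> (\<forall>x. ((\<lambda>t. S t x) \<longlongrightarrow> 0) at_top)"


section \<open>The feedback operator\<close>

text \<open>
  \<open>A\<close> extends to a map from \<open>H\<close> to \<open>D(A\<^sup>*)'\<close> sending \<open>z\<close> to \<open>\<psi> \<mapsto> \<langle>A\<^sup>*\<psi>, z\<rangle>\<close>. The sum \<open>A + B L\<close> is
  formed in \<open>D(A\<^sup>*)'\<close> and restricted to those \<open>z\<close> for which it lies in \<open>H\<close>.
\<close>

definition feedback_value ::
    "('h \<Rightarrow> 'h \<Rightarrow> 'k) \<Rightarrow> 'h set \<Rightarrow> ('h \<Rightarrow> 'h) \<Rightarrow> ('k \<Rightarrow> 'h \<Rightarrow> 'k) \<Rightarrow> ('h \<Rightarrow> 'k)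
      \<Rightarrow> 'h::real_normed_vector \<Rightarrow> 'h \<Rightarrow> 'k::real_or_complex" where
  "feedback_value ip D A B L z \<psi> = ip (adj ip D A \<psi>) z + B (L z) \<psi>"

definition feedback_dom ::
    "('h \<Rightarrow> 'h \<Rightarrow> 'k) \<Rightarrow> 'h set \<Rightarrow> ('h \<Rightarrow> 'h) \<Rightarrow> ('k \<Rightarrow> 'h \<Rightarrow> 'k) \<Rightarrow> 'h set \<Rightarrow> ('h \<Rightarrow> 'k::real_or_complex)
      \<Rightarrow> 'h::real_normed_vector set" where
  "feedback_dom ip D A B DL L =
    {z\<in>DL. \<exists>y. \<forall>\<psi>\<in>adj_dom ip D A. ip \<psi> y = feedback_value ip D A B L z \<psi>}"

definition feedback_op ::
    "('h \<Rightarrow> 'h \<Rightarrow> 'k) \<Rightarrow> 'h set \<Rightarrow> ('h \<Rightarrow> 'h) \<Rightarrow> ('k \<Rightarrow> 'h \<Rightarrow> 'k) \<Rightarrow> ('h \<Rightarrow> 'k::real_or_complex)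
      \<Rightarrow> 'h \<Rightarrow> 'h::real_normed_vector" where
  "feedback_op ip D A B L z =
    (THE y. \<forall>\<psi>\<in>adj_dom ip D A. ip \<psi> y = feedback_value ip D A B L z \<psi>)"

text \<open>
  The inclusion \<open>D(A\<^sub>L\<^sup>*) \<subseteq> D(A\<^sup>*)\<close> is a standing assumption; without it neither \<open>B\<^sup>*\<phi>\<close> nor the
  action of the closed-loop semigroup on the range of \<open>B\<close> makes sense.
\<close>

locale feedback_system = hilbert_space scl ip
  for scl :: "'k::real_or_complex \<Rightarrow> 'h::banach \<Rightarrow> 'h" and ip :: "'h \<Rightarrow> 'h \<Rightarrow> 'k" +
  fixes D :: "'h set" and A :: "'h \<Rightarrow> 'h"
    and B :: "'k \<Rightarrow> 'h \<Rightarrow> 'k"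
    and T :: "real \<Rightarrow> 'h \<Rightarrow> 'h"
    and \<tau> :: real
    and DL :: "'h set" and L :: "'h \<Rightarrow> 'k"
    and S :: "real \<Rightarrow> 'h \<Rightarrow> 'h"
    and \<phi> :: 'h and \<mu> :: 'k
  assumes A_linear: "linear_operator scl scl D A"
    and A_dense: "closure D = UNIV"
    and B_control: "control_operator scl (adj_dom ip D A) (graph_norm (adj ip D A)) B"
    and A_generates: "generates scl D A T"
    and B_admissible: "admissible ip (adj_dom ip D A) T B"
    and time_pos: "\<tau> > 0"
    and controllable: "approx_controllable ip (adj_dom ip D A) T B \<tau>"
    and L_linear: "linear_operator scl (*) DL L"
    and AL_generates: "generates scl (feedback_dom ip D A B DL L) (feedback_op ip D A B L) S"
    and AL_stable: "globally_asymptotically_stable S"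
    and AL_adj_dom: "adj_dom ip (feedback_dom ip D A B DL L) (feedback_op ip D A B L)
          \<subseteq> adj_dom ip D A"
    and eigen_dom: "\<phi> \<in> adj_dom ip (feedback_dom ip D A B DL L) (feedback_op ip D A B L)"
    and eigen_nonzero: "\<phi> \<noteq> 0"
    and eigen: "adj ip (feedback_dom ip D A B DL L) (feedback_op ip D A B L) \<phi> = scl \<mu> \<phi>"


section \<open>Mild solutions\<close>

text \<open>
  At \<open>0\<close> the set-valued sign is the closed unit ball of the scalar field, that is \<open>[-1, 1]\<close> for
  the real numbers and the closed unit disc for the complex numbers.
\<close>

definition set_sign :: "'k::real_normed_vector \<Rightarrow> 'k set" where
  "set_sign s = (if s = 0 then cball 0 1 else {s /\<^sub>R norm s})"

text \<open>
  The variation of constants formula with semigroup \<open>S\<close> and input \<open>v\<close> is an identity in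
  \<open>D(A\<^sub>L\<^sup>*)'\<close>, the space on which \<open>S\<close> acts, hence tested on \<open>D(A\<^sub>L\<^sup>*)\<close>.
\<close>

definition mild_trajectory ::
    "('k::real_or_complex \<Rightarrow> 'h \<Rightarrow> 'h) \<Rightarrow> ('h \<Rightarrow> 'h \<Rightarrow> 'k) \<Rightarrow> 'h set \<Rightarrow> ('h \<Rightarrow> 'h)
      \<Rightarrow> ('k \<Rightarrow> 'h \<Rightarrow> 'k) \<Rightarrow> 'h set \<Rightarrow> ('h \<Rightarrow> 'k) \<Rightarrow> (real \<Rightarrow> 'h \<Rightarrow> 'h) \<Rightarrow> 'h \<Rightarrow> (real \<Rightarrow> 'k)
      \<Rightarrow> (real \<Rightarrow> 'h::real_normed_vector) \<Rightarrow> bool" where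
  "mild_trajectory scl ip D A B DL L S z0 v z \<longleftrightarrow>
    continuous_on {0..} z
    \<and> antidual_H1_loc scl (adj_dom ip D A) (graph_norm (adj ip D A)) (\<lambda>t \<psi>. ip \<psi> (z t))
    \<and> (\<forall>t\<ge>0. \<forall>\<psi>\<in>adj_dom ip (feedback_dom ip D A B DL L) (feedback_op ip D A B L).
          ip \<psi> (z t) = ip \<psi> (S t z0) + input_map ip S B v t \<psi>)"

definition SM_mild_solution ::
    "('k \<Rightarrow> 'h \<Rightarrow> 'h) \<Rightarrow> ('h \<Rightarrow> 'h \<Rightarrow> 'k) \<Rightarrow> 'h set \<Rightarrow> ('h \<Rightarrow> 'h) \<Rightarrow> ('k \<Rightarrow> 'h \<Rightarrow> 'k)
      \<Rightarrow> 'h set \<Rightarrow> ('h \<Rightarrow> 'k) \<Rightarrow> (real \<Rightarrow> 'h \<Rightarrow> 'h) \<Rightarrow> 'h \<Rightarrow> 'k::real_or_complex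
      \<Rightarrow> real \<Rightarrow> (real \<Rightarrow> 'k) \<Rightarrow> 'h \<Rightarrow> (real \<Rightarrow> 'h::real_normed_vector) \<Rightarrow> bool" where
  "SM_mild_solution scl ip D A B DL L S \<phi> \<mu> K d z0 z \<longleftrightarrow>
    (\<exists>h. L2_loc h \<and> mild_trajectory scl ip D A B DL L S z0 h z
      \<and> (AE t in lebesgue. t \<ge> 0 \<longrightarrow>
          (let \<sigma> = ip \<phi> (z t) in
            h t \<in> {- (1 / control_adj B \<phi>) * (\<mu> * \<sigma> + of_real K * s) + d t | s. s \<in> set_sign \<sigma>})))"

definition abs_continuous_on :: "real set \<Rightarrow> (real \<Rightarrow> real) \<Rightarrow> bool" where
  "abs_continuous_on X f \<longleftrightarrow>
    (\<forall>\<epsilon>>0. \<exists>\<delta>>0. \<forall>n (a :: nat \<Rightarrow> real) b.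
        (\<forall>i<n. a i \<le> b i \<and> {a i..b i} \<subseteq> X) \<and> disjoint_family_on (\<lambda>i. {a i<..<b i}) {..<n}
          \<and> (\<Sum>i<n. b i - a i) < \<delta>
        \<longrightarrow> (\<Sum>i<n. \<bar>f (b i) - f (a i)\<bar>) < \<epsilon>)"

text \<open>
  The term \<open>|\<sigma>|\<^sup>1\<^sup>/\<^sup>2 sign(\<sigma>)\<close> is single-valued because its factor \<open>|\<sigma>|\<^sup>1\<^sup>/\<^sup>2\<close> vanishes at \<open>0\<close>.
\<close>

definition ST_mild_solution ::
    "(real \<Rightarrow> 'h \<Rightarrow> 'h) \<Rightarrow> ('h \<Rightarrow> 'h \<Rightarrow> real) \<Rightarrow> 'h set \<Rightarrow> ('h \<Rightarrow> 'h) \<Rightarrow> (real \<Rightarrow> 'h \<Rightarrow> real)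
      \<Rightarrow> 'h set \<Rightarrow> ('h \<Rightarrow> real) \<Rightarrow> (real \<Rightarrow> 'h \<Rightarrow> 'h) \<Rightarrow> 'h \<Rightarrow> real \<Rightarrow> real \<Rightarrow> real
      \<Rightarrow> (real \<Rightarrow> real) \<Rightarrow> 'h \<Rightarrow> real \<Rightarrow> (real \<Rightarrow> 'h::real_normed_vector) \<Rightarrow> (real \<Rightarrow> real) \<Rightarrow> bool" where
  "ST_mild_solution scl ip D A B DL L S \<phi> \<mu> \<alpha> \<beta> d z0 w0 z w \<longleftrightarrow>
    mild_trajectory scl ip D A B DL L S z0
      (\<lambda>t. let \<sigma> = ip \<phi> (z t) in
        1 / control_adj B \<phi> * (- \<mu> * \<sigma> - \<alpha> * (sqrt \<bar>\<sigma>\<bar> * sgn \<sigma>) + w t)) z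
    \<and> abs_continuous_on {0..} w \<and> w 0 = w0
    \<and> (AE t in lebesgue. t \<ge> 0 \<longrightarrow> w differentiable (at t)
        \<and> deriv w t \<in> {control_adj B \<phi> * deriv d t - \<beta> * s | s. s \<in> set_sign (ip \<phi> (z t))})"

end

theory Submission
  imports Defs "HOL-Complex_Analysis.Great_Picard"
begin

text \<open>
  Write \<open>b = B\<^sup>*\<phi>\<close> and \<open>\<sigma> = \<langle>\<phi>, z\<rangle>\<close>. Testing a trajectory with input \<open>h\<close> on the eigenvector gives
  \<open>\<sigma>' = cnj \<mu> \<sigma> + cnj b h\<close>, a scalar equation that contains \<open>z\<close> only through \<open>\<sigma>\<close>, and both control
  laws express \<open>h\<close> by \<open>\<sigma>\<close> (and \<open>w\<close>). The loop therefore decouples. Solve the scalar inclusion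
  (\<open>sliding_mode_scalar\<close>, \<open>super_twisting_scalar\<close>), read off the input \<open>h\<close>, and let the linear
  system run with it (\<open>closed_loop_trajectory\<close>). The output \<open>\<langle>\<phi>, z\<rangle>\<close> of that run is again \<open>\<sigma>\<close>,
  because both satisfy the same linear scalar equation (\<open>closed_loop_with_output\<close>).

  The scalar inclusions. With the sign evaluated at a delayed state the equations are solved step
  by step, and a subsequence converges as the delay tends to zero (\<open>relay_equation_solvable\<close>). In
  the limit the integrated sign is a Lipschitz function whose derivative is known to be the sign
  of the state only on intervals without zeros. At the zeros a selection is made by hand. The
  sliding mode solution is stopped at the first zero of \<open>\<sigma>\<close>; as \<open>K > |b| K\<^sub>d\<close>, some element of the
  set-valued sign cancels the disturbance from then on. The super-twisting solution is stopped at
  the first common zero of \<open>\<sigma>\<close> and \<open>w\<close>, where \<open>\<beta> > |b| C\<close> serves the same purpose; at an earlier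
  zero \<open>\<sigma>' = w \<noteq> 0\<close>, so these zeros are isolated and form a null set.

  The linear system. If \<open>b\<close> were zero, \<open>\<phi>\<close> would be an eigenvector of \<open>A\<^sup>*\<close> whose observation
  vanishes for all times, which controllability excludes (\<open>B_eigenvector_nonzero\<close>). Comparing
  \<open>A\<^sub>L\<^sup>*\<phi>\<close> with \<open>A\<^sup>*\<phi>\<close> then shows that \<open>L x = \<langle>l, x\<rangle>\<close> on \<open>D(A\<^sub>L)\<close> for some vector \<open>l\<close>, hence that
  \<open>D(A\<^sub>L\<^sup>*) = D(A\<^sup>*)\<close> and \<open>A\<^sub>L\<^sup>*\<psi> = A\<^sup>*\<psi> + (B\<^sup>*\<psi>) l\<close> (\<open>feedback_adjoint\<close>). By uniform boundedness,
  admissibility of \<open>B\<close> amounts to an estimate of the \<open>L\<^sup>2\<close> norm of \<open>B\<^sup>* T(r)\<^sup>* \<psi>\<close> on a time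
  interval by the norm of \<open>\<psi>\<close> (\<open>admissible_T\<close>). The bounded feedback \<open>L\<close> does not destroy this
  estimate (\<open>admissible_observation_feedback\<close>), so it also holds for the closed-loop semigroup,
  and the Riesz theorem turns it into values in \<open>H\<close> for the input map (\<open>mild_exists\<close>).

  Since \<open>B\<close> takes its values outside \<open>H\<close>, identities between vectors are tested against \<open>D(A\<^sup>*)\<close>.
  There every bounded functional has the form \<open>\<psi> \<mapsto> \<langle>\<psi>, b1\<rangle> + \<langle>A\<^sup>*\<psi>, b2\<rangle>\<close>
  (\<open>graph_functional_representation\<close>), which makes \<open>B\<^sup>* T(r)\<^sup>* \<psi>\<close> an explicit continuous function
  of \<open>r\<close> and the input map an integral of scalar functions.
\<close>

section \<open>Scalars\<close>

lemma conjugate_of_real [simp]: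
  "conjugate (of_real r :: 'k::real_or_complex) = of_real r"
proof (cases "r = 0")
  case False
  have "of_real r * conjugate (of_real r :: 'k) = of_real r * of_real r"
    using mult_conjugate[of "of_real r :: 'k"]
    by (simp add: scaleR_conv_of_real power2_eq_square)
  then show ?thesis using False by simp
qed simp

lemma conjugate_one [simp]: "conjugate (1 :: 'k::real_or_complex) = 1"
  using conjugate_of_real[of 1] by simp

lemma norm_conjugate [simp]: "norm (conjugate x :: 'k::real_or_complex) = norm x"
proof (cases "x = 0")
  case False
  have "norm x * norm (conjugate x) = norm x * norm x"
    using arg_cong[OF mult_conjugate[of x], of norm]
    by (simp add: norm_mult power2_eq_square)
  then show ?thesis using False by simp
qed simp

lemma bounded_linear_conjugate: "bounded_linear (conjugate :: 'k::real_or_complex \<Rightarrow> 'k)"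
proof
  show "\<exists>K. \<forall>x. norm (conjugate x :: 'k) \<le> norm x * K" by (intro exI[of _ 1]) simp
qed (auto simp: conjugate_dist_add scaleR_conv_of_real conjugate_dist_mul)

text \<open>
  The polarisation formula makes this the usual real part for both scalar fields; \<open>add_conjugate\<close>
  is the property by which it is used.
\<close>

definition real_part :: "'k::real_or_complex \<Rightarrow> real" where
  "real_part x = ((norm (1 + x))\<^sup>2 - 1 - (norm x)\<^sup>2) / 2"

lemma add_conjugate: "x + conjugate x = of_real (2 * real_part (x :: 'k::real_or_complex))"
proof -
  have "of_real ((norm (1 + x))\<^sup>2) = (1 + x) * conjugate (1 + x)"
    using mult_conjugate[of "1 + x"] by (simp add: scaleR_conv_of_real)
  also have "\<dots> = 1 + x + conjugate x + x * conjugate x"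
    by (simp add: conjugate_dist_add algebra_simps)
  also have "x * conjugate x = of_real ((norm x)\<^sup>2)"
    using mult_conjugate[of x] by (simp add: scaleR_conv_of_real)
  finally have e: "of_real ((norm (1 + x))\<^sup>2) = 1 + x + conjugate x + of_real ((norm x)\<^sup>2)" .
  have "2 * real_part x = (norm (1 + x))\<^sup>2 - 1 - (norm x)\<^sup>2"
    by (simp add: real_part_def)
  then have "of_real (2 * real_part x)
      = (of_real ((norm (1 + x))\<^sup>2) - 1 - of_real ((norm x)\<^sup>2) :: 'k)"
    by simp
  then show ?thesis using e by simp
qed

lemma real_part_unique: "x + conjugate x = of_real (2 * r) \<Longrightarrow> real_part (x :: 'k::real_or_complex) = r"
  using add_conjugate[of x] by simp

lemma real_part_of_real [simp]: "real_part (of_real r :: 'k::real_or_complex) = r"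
  by (rule real_part_unique) simp

lemma real_part_add: "real_part (x + y) = real_part x + real_part (y :: 'k::real_or_complex)"
proof (rule real_part_unique)
  have "x + y + conjugate (x + y) = (x + conjugate x) + (y + conjugate y)"
    by (simp add: conjugate_dist_add algebra_simps)
  then show "x + y + conjugate (x + y) = of_real (2 * (real_part x + real_part y))"
    by (simp add: add_conjugate distrib_left)
qed

lemma real_part_scaleR: "real_part (r *\<^sub>R x) = r * real_part (x :: 'k::real_or_complex)"
proof (rule real_part_unique)
  have "r *\<^sub>R x + conjugate (r *\<^sub>R x) = of_real r * (x + conjugate x)"
    by (simp add: scaleR_conv_of_real conjugate_dist_mul algebra_simps)
  then show "r *\<^sub>R x + conjugate (r *\<^sub>R x) = of_real (2 * (r * real_part x))"
    by (simp add: add_conjugate)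
qed

lemma abs_real_part_le: "\<bar>real_part (x :: 'k::real_or_complex)\<bar> \<le> norm x"
proof -
  have "norm (of_real (2 * real_part x) :: 'k) \<le> norm x + norm (conjugate x)"
    unfolding add_conjugate[symmetric] by (rule norm_triangle_ineq)
  then show ?thesis by simp
qed

lemma bounded_linear_real_part: "bounded_linear (real_part :: 'k::real_or_complex \<Rightarrow> real)"
  by (rule bounded_linear_intro[of _ 1]) (auto simp: real_part_add real_part_scaleR abs_real_part_le)


section \<open>Hilbert spaces\<close>

context hilbert_space
begin

lemma mult_conj: "c * conjugate c = of_real ((norm (c::'k))\<^sup>2)"
  using mult_conjugate[of c] by (simp add: scaleR_conv_of_real)

lemma conj_mult: "conjugate c * c = of_real ((norm (c::'k))\<^sup>2)"
  using mult_conj[of c] by (simp add: mult.commute)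

lemma ip_add_left: "ip (x + y) z = ip x z + ip y z"
  by (metis ip_add ip_conjugate conjugate_dist_add)

lemma ip_scl_left: "ip (c *\<^sub>K x) y = conjugate c * ip x y"
  by (metis ip_scl ip_conjugate conjugate_dist_mul)

lemma ip_scaleR: "ip x (r *\<^sub>R y) = r *\<^sub>R ip x y"
  using ip_scl[of x "of_real r" y] by (simp add: scl_of_real scaleR_conv_of_real)

lemma ip_scaleR_left: "ip (r *\<^sub>R x) y = r *\<^sub>R ip x y"
  using ip_scl_left[of "of_real r" x y] by (simp add: scl_of_real scaleR_conv_of_real)

lemma ip_zero [simp]: "ip x 0 = 0" "ip 0 x = 0"
  using ip_scaleR[of x 0 0] ip_scaleR_left[of 0 0 x] by simp_all

lemma ip_minus: "ip x (- y) = - ip x y" "ip (- x) y = - ip x y"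
  using ip_scaleR[of x "-1" y] ip_scaleR_left[of "-1" x y] by simp_all

lemma ip_diff: "ip x (y - z) = ip x y - ip x z" "ip (x - y) z = ip x z - ip y z"
  using ip_add[of x y "- z"] ip_add_left[of x "- y" z] by (simp_all add: ip_minus)

lemma norm_add_sq: "(norm (x + y))\<^sup>2 = (norm x)\<^sup>2 + (norm y)\<^sup>2 + 2 * real_part (ip x y)"
proof -
  have "of_real ((norm (x + y))\<^sup>2) = ip x x + ip y y + (ip x y + ip y x)"
    unfolding ip_norm[symmetric] by (simp add: ip_add ip_add_left)
  also have "ip x y + ip y x = of_real (2 * real_part (ip x y))"
    using add_conjugate[of "ip x y"] ip_conjugate[of y x] by simp
  finally have "of_real ((norm (x + y))\<^sup>2)
      = (of_real ((norm x)\<^sup>2 + (norm y)\<^sup>2 + 2 * real_part (ip x y)) :: 'k)"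
    by (simp add: ip_norm)
  then show ?thesis by (simp only: of_real_eq_iff)
qed

lemma norm_scl: "norm (c *\<^sub>K x) = norm c * norm x"
proof -
  have "of_real ((norm (c *\<^sub>K x))\<^sup>2) = (of_real ((norm c * norm x)\<^sup>2) :: 'k)"
    by (simp add: ip_norm[symmetric, of "c *\<^sub>K x"] ip_scl ip_scl_left del: of_real_power)
      (simp add: ip_norm mult.assoc[symmetric] mult_conj power_mult_distrib del: of_real_power)
  then have "(norm (c *\<^sub>K x))\<^sup>2 = (norm c * norm x)\<^sup>2" by (simp only: of_real_eq_iff)
  then show ?thesis by (simp add: power2_eq_iff_nonneg)
qed

lemma cauchy_schwarz: "norm (ip x y) \<le> norm x * norm y"
proof (cases "x = 0")
  case False
  define w where "w = (norm x)\<^sup>2 *\<^sub>R y - ip x y *\<^sub>K x"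
  have xw: "ip x w = 0"
    by (simp add: w_def ip_diff ip_scaleR ip_scl ip_norm scaleR_conv_of_real)
  have wx: "ip w x = 0" using xw ip_conjugate[of w x] by simp
  have "of_real ((norm w)\<^sup>2) = ip w ((norm x)\<^sup>2 *\<^sub>R y) - ip x y * ip w x"
    unfolding ip_norm[symmetric] by (subst (2) w_def) (simp add: ip_diff ip_scl)
  also have "\<dots> = of_real ((norm x)\<^sup>2) * ip w y"
    by (simp add: wx ip_scaleR scaleR_conv_of_real)
  also have "ip w y = of_real ((norm x)\<^sup>2 * (norm y)\<^sup>2 - (norm (ip x y))\<^sup>2)"
    by (simp add: w_def ip_diff ip_scaleR_left ip_scl_left ip_norm scaleR_conv_of_real conj_mult
        del: of_real_power)
  finally have "of_real ((norm w)\<^sup>2)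
      = (of_real ((norm x)\<^sup>2 * ((norm x)\<^sup>2 * (norm y)\<^sup>2 - (norm (ip x y))\<^sup>2)) :: 'k)"
    by simp
  then have "(norm w)\<^sup>2 = (norm x)\<^sup>2 * ((norm x)\<^sup>2 * (norm y)\<^sup>2 - (norm (ip x y))\<^sup>2)"
    by (simp only: of_real_eq_iff)
  then have "0 \<le> (norm x)\<^sup>2 * ((norm x)\<^sup>2 * (norm y)\<^sup>2 - (norm (ip x y))\<^sup>2)"
    by (metis zero_le_power2)
  then have "(norm (ip x y))\<^sup>2 \<le> (norm x * norm y)\<^sup>2"
    using False by (simp add: zero_le_mult_iff power_mult_distrib)
  then show ?thesis by (rule power2_le_imp_le) simp
qed simp

lemma bounded_bilinear_ip: "bounded_bilinear ip"
  by standard (auto simp: ip_add ip_add_left ip_scaleR ip_scaleR_left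
      intro!: exI[of _ 1] cauchy_schwarz)

lemma bounded_linear_ip: "bounded_linear (ip x)"
  by (rule bounded_bilinear.bounded_linear_right[OF bounded_bilinear_ip])

lemma bounded_linear_scl: "bounded_linear ((*\<^sub>K) c)"
proof
  show "\<exists>K. \<forall>x. norm (c *\<^sub>K x) \<le> norm x * K"
    by (intro exI[of _ "norm c"]) (simp add: norm_scl mult.commute)
  show "c *\<^sub>K (r *\<^sub>R x) = r *\<^sub>R (c *\<^sub>K x)" for r x
    by (metis scl_of_real scale_left_commute)
qed (auto simp: scale_right_distrib)

lemma ip_eq_norm_sq: "norm (ip x x) = (norm x)\<^sup>2"
  by (simp add: ip_norm norm_power)

text \<open>
  The representing vector minimises \<open>\<parallel>x\<parallel>\<^sup>2 - 2 Re (f x)\<close> over the closure of the subspace; a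
  minimising sequence is Cauchy by the parallelogram law. Only the sequence has to lie in the
  subspace, so the lemma applies to functionals on the domain of an unbounded operator.
\<close>

theorem riesz_subspace:
  assumes V: "subspace V"
    and add: "\<And>x y. x \<in> V \<Longrightarrow> y \<in> V \<Longrightarrow> f (x + y) = f x + f y"
    and scl: "\<And>c x. x \<in> V \<Longrightarrow> f (c *\<^sub>K x) = c * f x"
    and bd: "\<And>x. x \<in> V \<Longrightarrow> norm (f x) \<le> C * norm x" and C: "C \<ge> 0"
  obtains y where "\<And>x. x \<in> V \<Longrightarrow> ip y x = f x" "norm y \<le> C"
proof -
  define J where "J x = (norm x)\<^sup>2 - 2 * real_part (f x)" for x
  have V0: "0 \<in> V" and Vadd: "\<And>x y. x \<in> V \<Longrightarrow> y \<in> V \<Longrightarrow> x + y \<in> V"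
    and Vscl: "\<And>c x. x \<in> V \<Longrightarrow> c *\<^sub>K x \<in> V"
    using V by (auto simp: subspace_def)
  have VR: "r *\<^sub>R x \<in> V" if "x \<in> V" for r x
    using Vscl[OF that, of "of_real r"] by (simp add: scl_of_real)
  have fR: "f (r *\<^sub>R x) = r *\<^sub>R f x" if "x \<in> V" for r x
    using scl[OF that, of "of_real r"] by (simp add: scl_of_real scaleR_conv_of_real)
  have J_low: "- C\<^sup>2 \<le> J x" if "x \<in> V" for x
  proof -
    have "real_part (f x) \<le> C * norm x" using abs_real_part_le[of "f x"] bd[OF that] by linarith
    moreover have "0 \<le> (norm x - C)\<^sup>2" by simp
    ultimately show ?thesis by (simp add: J_def power2_diff algebra_simps)
  qed
  define m where "m = Inf (J ` V)"
  have bdd: "bdd_below (J ` V)" by (rule bdd_belowI2[of _ "- C\<^sup>2"]) (rule J_low)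
  have m_le: "m \<le> J x" if "x \<in> V" for x
    unfolding m_def by (rule cINF_lower[OF bdd that])
  have "\<exists>x\<in>V. J x < m + 1 / real (Suc n)" for n
    using cINF_less_iff[OF _ bdd, of "m + 1 / real (Suc n)"] V0 by (auto simp: m_def)
  then obtain X where XV: "\<And>n. X n \<in> V" and XJ: "\<And>n. J (X n) < m + 1 / real (Suc n)"
    by metis
  have dist2: "(norm (X n - X k))\<^sup>2 \<le> 2 / real (Suc n) + 2 / real (Suc k)" for n k
  proof -
    let ?u = "X n" and ?w = "X k"
    have mid: "m \<le> J ((1/2) *\<^sub>R (?u + ?w))" by (intro m_le VR Vadd XV)
    have "J ((1/2) *\<^sub>R (?u + ?w)) = (norm (?u + ?w))\<^sup>2 / 4 - (real_part (f ?u) + real_part (f ?w))"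
      using XV by (simp add: J_def fR Vadd add real_part_scaleR real_part_add power_divide add_divide_distrib)
    moreover have "(norm (?u + ?w))\<^sup>2 + (norm (?u - ?w))\<^sup>2 = 2 * (norm ?u)\<^sup>2 + 2 * (norm ?w)\<^sup>2"
      using norm_add_sq[of ?u ?w] norm_add_sq[of ?u "- ?w"]
        real_part_scaleR[of "-1" "ip ?u ?w"] by (simp add: ip_minus)
    ultimately have "(norm (?u - ?w))\<^sup>2 \<le> 2 * J ?u + 2 * J ?w - 4 * m"
      using mid by (simp add: J_def algebra_simps)
    then show ?thesis using XJ[of n] XJ[of k] by simp
  qed
  have "Cauchy X"
  proof (rule metric_CauchyI)
    fix e :: real assume e: "0 < e"
    obtain N where N: "4 / e\<^sup>2 < real (Suc N)"
      using reals_Archimedean2[of "4 / e\<^sup>2"] by (meson less_Suc_eq of_nat_less_iff less_trans)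
    have "dist (X n) (X k) < e" if "n \<ge> N" "k \<ge> N" for n k
    proof -
      have "2 / real (Suc n) \<le> 2 / real (Suc N)" "2 / real (Suc k) \<le> 2 / real (Suc N)"
        using that by (auto intro!: divide_left_mono)
      moreover have "4 / real (Suc N) < e\<^sup>2" using N e by (simp add: field_simps)
      ultimately have "(norm (X n - X k))\<^sup>2 < e\<^sup>2" using dist2[of n k] by simp
      then show ?thesis using e by (simp add: dist_norm power2_less_imp_less)
    qed
    then show "\<exists>M. \<forall>m\<ge>M. \<forall>n\<ge>M. dist (X m) (X n) < e" by blast
  qed
  then obtain y where y: "X \<longlonglongrightarrow> y" using Cauchy_convergent convergent_def by blast
  have var: "0 \<le> 2 * real_part (ip y v - f v) + (norm v)\<^sup>2" if v: "v \<in> V" for v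
  proof -
    have ge: "- 1 / real (Suc n) \<le> 2 * real_part (ip (X n) v - f v) + (norm v)\<^sup>2" for n
    proof -
      have "m \<le> J (X n + v)" by (intro m_le Vadd XV v)
      also have "J (X n + v) = J (X n) + 2 * real_part (ip (X n) v - f v) + (norm v)\<^sup>2"
        using real_part_add[of "ip (X n) v - f v" "f v"]
        by (simp add: J_def norm_add_sq add XV v real_part_add)
      finally show ?thesis using XJ[of n] by simp
    qed
    have l1: "(\<lambda>n. - 1 / real (Suc n)) \<longlonglongrightarrow> 0"
      using LIMSEQ_inverse_real_of_nat[THEN tendsto_minus] by (simp add: field_simps)
    have "(\<lambda>n. ip (X n) v) \<longlonglongrightarrow> ip y v"
      by (intro bounded_bilinear.tendsto[OF bounded_bilinear_ip] y tendsto_const)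
    then have l2: "(\<lambda>n. 2 * real_part (ip (X n) v - f v) + (norm v)\<^sup>2)
        \<longlonglongrightarrow> 2 * real_part (ip y v - f v) + (norm v)\<^sup>2"
      by (intro tendsto_intros bounded_linear.tendsto[OF bounded_linear_real_part])
    show ?thesis by (rule LIMSEQ_le[OF l1 l2]) (use ge in auto)
  qed
  have eq: "ip y v = f v" if v: "v \<in> V" for v
  proof (rule ccontr)
    assume ne: "ip y v \<noteq> f v"
    define g where "g = ip y v - f v"
    \<comment> \<open>This multiple of \<open>v\<close> would lower the minimum: the linear term of the variation
      has size \<open>s\<close>, the quadratic one size \<open>s\<^sup>2\<close>.\<close>
    define s where "s = 1 / ((norm v)\<^sup>2 + 1)"
    define c where "c = - (of_real s * conjugate g)"
    have s: "s > 0" "s * (norm v)\<^sup>2 < 1" by (auto simp: s_def field_simps add_pos_nonneg)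
    have "ip y (c *\<^sub>K v) - f (c *\<^sub>K v) = c * g"
      using v by (simp add: ip_scl scl g_def algebra_simps)
    also have "\<dots> = of_real (- s * (norm g)\<^sup>2)"
      by (simp add: c_def mult.assoc conj_mult del: of_real_power)
    finally have "0 \<le> 2 * (- s * (norm g)\<^sup>2) + (norm (c *\<^sub>K v))\<^sup>2"
      using var[OF Vscl[OF v, of c]] by (simp del: of_real_mult of_real_power of_real_minus)
    also have "norm (c *\<^sub>K v) = s * norm g * norm v"
      using s by (simp add: norm_scl c_def norm_mult)
    also have "2 * (- s * (norm g)\<^sup>2) + (s * norm g * norm v)\<^sup>2
        = s * (norm g)\<^sup>2 * (s * (norm v)\<^sup>2 - 2)"
      by (simp add: power2_eq_square algebra_simps)
    finally have "0 \<le> s * (norm g)\<^sup>2 * (s * (norm v)\<^sup>2 - 2)" .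
    moreover have "s * (norm g)\<^sup>2 > 0" using s ne by (simp add: g_def)
    ultimately show False using s by (simp add: zero_le_mult_iff)
  qed
  have "norm y \<le> C"
  proof -
    have "norm (ip y (X n)) \<le> C * norm (X n)" for n using bd[OF XV] eq[OF XV] by simp
    moreover have "(\<lambda>n. norm (ip y (X n))) \<longlonglongrightarrow> norm (ip y y)"
      by (intro tendsto_norm bounded_bilinear.tendsto[OF bounded_bilinear_ip] y tendsto_const)
    moreover have "(\<lambda>n. C * norm (X n)) \<longlonglongrightarrow> C * norm y" by (intro tendsto_intros y)
    ultimately have "norm (ip y y) \<le> C * norm y" using LIMSEQ_le by blast
    then show ?thesis using C by (cases "y = 0") (auto simp: ip_eq_norm_sq power2_eq_square)
  qed
  with eq show ?thesis by (rule that)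
qed

corollary riesz_antilinear:
  assumes V: "subspace V"
    and add: "\<And>x y. x \<in> V \<Longrightarrow> y \<in> V \<Longrightarrow> f (x + y) = f x + f y"
    and scl: "\<And>c x. x \<in> V \<Longrightarrow> f (c *\<^sub>K x) = conjugate c * f x"
    and bd: "\<And>x. x \<in> V \<Longrightarrow> norm (f x) \<le> C * norm x" and C: "C \<ge> 0"
  obtains y where "\<And>x. x \<in> V \<Longrightarrow> ip x y = f x" "norm y \<le> C"
proof -
  obtain y where y: "\<And>x. x \<in> V \<Longrightarrow> ip y x = conjugate (f x)" "norm y \<le> C"
    by (rule riesz_subspace[OF V, of "\<lambda>x. conjugate (f x)" C])
      (use assms in \<open>auto simp: conjugate_dist_add conjugate_dist_mul\<close>)
  have "ip x y = f x" if "x \<in> V" for x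
    using y(1)[OF that] ip_conjugate[of x y] by simp
  then show ?thesis using that y by blast
qed

lemma ip_all_eqI: "(\<And>x. ip x y = ip x z) \<Longrightarrow> y = z"
  using ip_eq_norm_sq[of "y - z"] by (simp add: ip_diff)

lemma eq_0_if_orthogonal_dense:
  assumes "closure D = UNIV" "\<And>x. x \<in> D \<Longrightarrow> ip y x = 0"
  shows "y = 0"
proof -
  have cl: "closed {x. ip y x = 0}"
    using closed_Collect_eq[OF linear_continuous_on[OF bounded_linear_ip] continuous_on_const] .
  have "closure D \<subseteq> {x. ip y x = 0}" by (rule closure_minimal) (use assms cl in auto)
  then have "ip y y = 0" using assms(1) by auto
  then show ?thesis using ip_eq_norm_sq[of y] by simp
qed

end


section \<open>Uniform boundedness\<close>

text \<open>
  Of \<open>p + q\<close> and \<open>p - q\<close> one is at least as long as \<open>q\<close>, so the sign of the \<open>N\<close>-th term can be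
  chosen such that the terms before it do not cancel it. The weights \<open>3\<^sup>-\<^sup>n\<close> make the terms after
  it sum to at most \<open>c N / (2 \<cdot> 3\<^sup>N)\<close>, less than the \<open>N\<close>-th term itself. This replaces the theorem
  of Baire in the two uniform boundedness arguments below, of which one concerns square integrable
  functions that are not collected in a Banach space.
\<close>

lemma gliding_hump_signs:
  fixes a :: "nat \<Rightarrow> nat \<Rightarrow> 'y::banach" and c :: "nat \<Rightarrow> real"
  assumes upper: "\<And>N n. norm (a N n) \<le> c N" and diag: "\<And>N. 3/4 * c N \<le> norm (a N N)"
  obtains \<epsilon> :: "nat \<Rightarrow> real" where "\<And>n. \<bar>\<epsilon> n\<bar> = 1"
    "\<And>N y. (\<lambda>n. (\<epsilon> n / 3 ^ n) *\<^sub>R a N n) sums y \<Longrightarrow> c N / (4 * 3 ^ N) \<le> norm y"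
proof -
  let ?P = "\<lambda>e N r. \<bar>r\<bar> = (1::real) \<and>
    norm (a N N) / 3 ^ N \<le> norm ((\<Sum>n<N. (e n / 3 ^ n) *\<^sub>R a N n) + (r / 3 ^ N) *\<^sub>R a N N)"
  have "\<exists>e. \<forall>N. ?P e N (e N)"
  proof (rule dependent_wf_choice[of less_than])
    show "?P f x r = ?P g x r" if "\<And>z. (z, x) \<in> less_than \<Longrightarrow> f z = g z" for f g :: "nat \<Rightarrow> real" and x r
    proof -
      have "(\<Sum>n<x. (f n / 3 ^ n) *\<^sub>R a x n) = (\<Sum>n<x. (g n / 3 ^ n) *\<^sub>R a x n)"
        using that by (intro sum.cong) auto
      then show ?thesis by simp
    qed
    fix N and e :: "nat \<Rightarrow> real"
    define p where "p = (\<Sum>n<N. (e n / 3 ^ n) *\<^sub>R a N n)"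
    define q where "q = (1 / 3 ^ N) *\<^sub>R a N N"
    have "2 * norm q = norm ((p + q) - (p - q))" by (simp add: scaleR_2[symmetric])
    also have "\<dots> \<le> norm (p + q) + norm (p - q)" by (rule norm_triangle_ineq4)
    finally consider "norm q \<le> norm (p + q)" | "norm q \<le> norm (p - q)" by linarith
    then show "\<exists>r. ?P e N r"
    proof cases
      case 1 then show ?thesis by (intro exI[of _ 1]) (simp add: p_def q_def)
    next
      case 2 then show ?thesis by (intro exI[of _ "-1"]) (simp add: p_def q_def)
    qed
  qed simp
  then obtain e where e: "\<And>N. ?P e N (e N)" by auto
  have "c N / (4 * 3 ^ N) \<le> norm y" if y: "(\<lambda>n. (e n / 3 ^ n) *\<^sub>R a N n) sums y" for N y
  proof -
    let ?f = "\<lambda>n. (e n / 3 ^ n) *\<^sub>R a N n"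
    have tail: "(\<lambda>n. ?f (n + Suc N)) sums (y - (\<Sum>n<Suc N. ?f n))"
      using y by (subst sums_iff_shift) simp
    have geo: "(\<lambda>n. c N / 3 ^ Suc N * (1/3) ^ n) sums (c N / 3 ^ Suc N * (1 / (1 - 1/3)))"
      by (intro sums_mult geometric_sums) simp
    have b: "norm (?f (n + Suc N)) \<le> c N / 3 ^ Suc N * (1/3) ^ n" for n
      using upper[of N "n + Suc N"] e[of "n + Suc N"]
      by (simp add: power_add divide_simps mult.commute)
    have "norm (suminf (\<lambda>n. ?f (n + Suc N))) \<le> (\<Sum>n. c N / 3 ^ Suc N * (1/3) ^ n)"
      by (rule norm_suminf_le, rule b, rule sums_summable[OF geo])
    then have "norm (y - (\<Sum>n<Suc N. ?f n)) \<le> c N / 3 ^ Suc N * (1 / (1 - 1/3))"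
      by (simp only: sums_unique[OF tail, symmetric] sums_unique[OF geo, symmetric])
    moreover have "3/4 * c N / 3 ^ N \<le> norm (\<Sum>n<Suc N. ?f n)"
    proof -
      have "3/4 * c N / 3 ^ N \<le> norm (a N N) / 3 ^ N" by (intro divide_right_mono diag) simp
      also have "\<dots> \<le> norm (\<Sum>n<Suc N. ?f n)" using e[of N] by simp
      finally show ?thesis .
    qed
    moreover have "norm (\<Sum>n<Suc N. ?f n) \<le> norm y + norm (y - (\<Sum>n<Suc N. ?f n))"
      by (subst norm_minus_commute) (rule norm_triangle_sub)
    moreover define q where "q = c N / 3 ^ N"
    moreover have "c N / 3 ^ Suc N * (1 / (1 - 1/3)) = q / 2"
      "3/4 * c N / 3 ^ N = 3/4 * q" "c N / (4 * 3 ^ N) = q / 4"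
      by (simp_all add: q_def)
    ultimately show ?thesis by (simp del: sum.lessThan_Suc)
  qed
  then show ?thesis using that e by blast
qed

text \<open>
  The contradiction in both arguments: norms above \<open>4\<^sup>N\<close> outgrow the weights \<open>3\<^sup>-\<^sup>N\<close>.
\<close>

lemma power_4_not_below_power_3: "\<not> (\<forall>N. (4::real) ^ N < C * 4 * 3 ^ N)"
proof
  assume "\<forall>N. (4::real) ^ N < C * 4 * 3 ^ N"
  then have "(4/3) ^ N < C * 4" for N by (simp add: power_divide field_simps)
  moreover obtain N where "C * 4 < (4/3::real) ^ N" using real_arch_pow[of "4/3" "C * 4"] by auto
  ultimately show False by (meson less_asym)
qed

text \<open>
  Integrate Young's inequality with a weight \<open>s\<close>. The best weight is the quotient of the two \<open>L\<^sup>2\<close>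
  norms; adding \<open>\<eta>\<close> to both of them keeps it meaningful when a norm vanishes, and \<open>\<eta>\<close> tends to
  zero at the end.
\<close>

lemma integral_cauchy_schwarz:
  fixes f g :: "'a \<Rightarrow> 'k::{real_normed_field, banach, second_countable_topology}"
  assumes [measurable]: "f \<in> borel_measurable M" "g \<in> borel_measurable M"
    and f2: "integrable M (\<lambda>x. (norm (f x))\<^sup>2)" and g2: "integrable M (\<lambda>x. (norm (g x))\<^sup>2)"
  shows "integrable M (\<lambda>x. f x * g x)"
    and "(\<integral>x. norm (f x * g x) \<partial>M) \<le> sqrt (\<integral>x. (norm (f x))\<^sup>2 \<partial>M) * sqrt (\<integral>x. (norm (g x))\<^sup>2 \<partial>M)"
proof -
  have young: "norm (u * v) \<le> s / 2 * (norm u)\<^sup>2 + 1 / (2 * s) * (norm v)\<^sup>2"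
    if "s > 0" for u v :: 'k and s :: real
  proof -
    have "0 \<le> (s * norm u - norm v)\<^sup>2 / (2 * s)" using that by simp
    also have "\<dots> = s / 2 * (norm u)\<^sup>2 + 1 / (2 * s) * (norm v)\<^sup>2 - norm u * norm v"
      using that by (simp add: power2_eq_square field_simps)
    finally show ?thesis by (simp add: norm_mult)
  qed
  have weights: "(q / p) / 2 * p\<^sup>2 + 1 / (2 * (q / p)) * q\<^sup>2 = p * q"
    if "p > 0" "q > 0" for p q :: real
    using that by (simp add: power2_eq_square field_simps)
  have int_r: "integrable M (\<lambda>x. s / 2 * (norm (f x))\<^sup>2 + 1 / (2 * s) * (norm (g x))\<^sup>2)" for s
    using f2 g2 by simp
  show int: "integrable M (\<lambda>x. f x * g x)"
    by (rule Bochner_Integration.integrable_bound[OF int_r[of 1]]) (use young[of 1] in auto)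
  let ?A = "sqrt (\<integral>x. (norm (f x))\<^sup>2 \<partial>M)" and ?B = "sqrt (\<integral>x. (norm (g x))\<^sup>2 \<partial>M)"
  have A: "?A \<ge> 0" "(\<integral>x. (norm (f x))\<^sup>2 \<partial>M) = ?A\<^sup>2" and B: "?B \<ge> 0" "(\<integral>x. (norm (g x))\<^sup>2 \<partial>M) = ?B\<^sup>2"
    by (simp_all add: integral_nonneg)
  have le: "(\<integral>x. norm (f x * g x) \<partial>M) \<le> (?A + \<eta>) * (?B + \<eta>)" if \<eta>: "\<eta> > 0" for \<eta>
  proof -
    define s where "s = (?B + \<eta>) / (?A + \<eta>)"
    have p: "?A + \<eta> > 0" "?B + \<eta> > 0" using \<eta> A(1) B(1) by linarith+
    then have s: "s > 0" by (simp add: s_def)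
    have "(\<integral>x. norm (f x * g x) \<partial>M)
        \<le> (\<integral>x. s / 2 * (norm (f x))\<^sup>2 + 1 / (2 * s) * (norm (g x))\<^sup>2 \<partial>M)"
      by (intro integral_mono integrable_norm int int_r young s)
    also have "\<dots> = s / 2 * ?A\<^sup>2 + 1 / (2 * s) * ?B\<^sup>2"
      using f2 g2 A(2) B(2) by simp
    also have "\<dots> \<le> s / 2 * (?A + \<eta>)\<^sup>2 + 1 / (2 * s) * (?B + \<eta>)\<^sup>2"
      using \<eta> A(1) B(1) s by (intro add_mono mult_left_mono power_mono) auto
    also have "\<dots> = (?A + \<eta>) * (?B + \<eta>)"
      unfolding s_def using weights[OF p] .
    finally show ?thesis .
  qed
  have "((\<lambda>\<eta>. (?A + \<eta>) * (?B + \<eta>)) \<longlongrightarrow> (?A + 0) * (?B + 0)) (at_right 0)"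
    by (intro tendsto_intros)
  then have "((\<lambda>\<eta>. (?A + \<eta>) * (?B + \<eta>)) \<longlongrightarrow> ?A * ?B) (at_right 0)" by simp
  then show "(\<integral>x. norm (f x * g x) \<partial>M) \<le> ?A * ?B"
    by (rule tendsto_lowerbound) (auto simp: eventually_at_right_less le intro!: eventually_at_rightI[of 0 1])
qed

text \<open>
  The uniform boundedness principle for the functionals \<open>u \<mapsto> \<integral> u Y\<^sub>i\<close> on \<open>L\<^sup>2\<close>. If the norms \<open>c N\<close>
  of a sequence \<open>y N\<close> exceed \<open>4\<^sup>N\<close>, then the gliding hump over the functions \<open>e n = cnj (y n) / c
  n\<close>, which have norm one and satisfy \<open>\<integral> e n \<cdot> y n = c n\<close>, yields a \<open>u\<close> on which the functionals
  are unbounded.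
\<close>

lemma L2_uniform_boundedness:
  fixes Y :: "'i \<Rightarrow> 'a \<Rightarrow> 'k::real_or_complex"
  assumes meas: "\<And>i. i \<in> I \<Longrightarrow> Y i \<in> borel_measurable M"
    and int: "\<And>i. i \<in> I \<Longrightarrow> integrable M (\<lambda>x. (norm (Y i x))\<^sup>2)"
    and bd: "\<And>u. u \<in> borel_measurable M \<Longrightarrow> integrable M (\<lambda>x. (norm (u x))\<^sup>2)
        \<Longrightarrow> \<exists>C. \<forall>i\<in>I. norm (\<integral>x. u x * Y i x \<partial>M) \<le> C"
  obtains C where "C \<ge> 0" "\<And>i. i \<in> I \<Longrightarrow> (\<integral>x. (norm (Y i x))\<^sup>2 \<partial>M) \<le> C\<^sup>2"
proof (rule ccontr)
  assume "\<not> thesis"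
  then have "\<forall>N. \<exists>i\<in>I. (4 ^ N)\<^sup>2 < (\<integral>x. (norm (Y i x))\<^sup>2 \<partial>M)"
    by (metis that not_less zero_le_numeral zero_le_power)
  then obtain j where jI: "\<And>N. j N \<in> I"
    and j: "\<And>N. (4 ^ N)\<^sup>2 < (\<integral>x. (norm (Y (j N) x))\<^sup>2 \<partial>M)" by metis
  define y where "y N = Y (j N)" for N
  define c where "c N = sqrt (\<integral>x. (norm (y N x))\<^sup>2 \<partial>M)" for N
  have [measurable]: "y N \<in> borel_measurable M" for N using meas jI by (simp add: y_def)
  have y2: "integrable M (\<lambda>x. (norm (y N x))\<^sup>2)" for N using int jI by (simp add: y_def)
  have c: "4 ^ N < c N" for N using j[of N] by (simp add: c_def y_def real_less_rsqrt)
  have cpos: "c N > 0" for N by (rule less_trans[OF _ c[of N]]) simp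
  have csq: "(\<integral>x. (norm (y N x))\<^sup>2 \<partial>M) = (c N)\<^sup>2" for N by (simp add: c_def integral_nonneg)
  define e where "e n x = of_real (1 / c n) * conjugate (y n x)" for n x
  have [measurable]: "e n \<in> borel_measurable M" for n
    unfolding e_def
    by (intro borel_measurable_times borel_measurable_const
        measurable_compose[OF _ borel_measurable_continuous_onI[OF linear_continuous_on[OF bounded_linear_conjugate]]])
      simp
  have ne: "(norm (e n x))\<^sup>2 = 1 / (c n)\<^sup>2 * (norm (y n x))\<^sup>2" for n x
    using cpos[of n] by (simp add: e_def norm_mult norm_divide power_mult_distrib power_divide)
  have e2: "integrable M (\<lambda>x. (norm (e n x))\<^sup>2)" and e1: "(\<integral>x. (norm (e n x))\<^sup>2 \<partial>M) = 1" for n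
    using y2[of n] cpos[of n] by (simp_all add: ne csq)
  define a where "a N n = (\<integral>x. e n x * y N x \<partial>M)" for N n
  have int_ey: "integrable M (\<lambda>x. e n x * y N x)"
    and ey_le: "(\<integral>x. norm (e n x * y N x) \<partial>M) \<le> c N" for n N
    using integral_cauchy_schwarz[of "e n" M "y N"] e2 y2 e1 by (simp_all add: csq less_imp_le[OF cpos])
  have a_le: "norm (a N n) \<le> c N" for N n
    unfolding a_def using integral_norm_bound[of M "\<lambda>x. e n x * y N x"] ey_le[of n N] by linarith
  have "a N N = of_real (c N)" for N
  proof -
    have "e N x * y N x = (1 / c N * (norm (y N x))\<^sup>2) *\<^sub>R 1" for x
      using mult_conjugate[of "y N x"]
      by (simp add: e_def mult.assoc mult.commute[of "conjugate _"] scaleR_conv_of_real)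
    then have "a N N = (\<integral>x. 1 / c N * (norm (y N x))\<^sup>2 \<partial>M) *\<^sub>R 1"
      unfolding a_def using y2[of N] by simp
    also have "(\<integral>x. 1 / c N * (norm (y N x))\<^sup>2 \<partial>M) = 1 / c N * (c N)\<^sup>2"
      by (simp add: csq)
    also have "\<dots> = c N" using cpos[of N] by (simp add: power2_eq_square)
    finally show ?thesis by (simp add: scaleR_conv_of_real)
  qed
  then have "3 / 4 * c N \<le> norm (a N N)" for N using cpos[of N] by simp
  then obtain \<epsilon> where \<epsilon>: "\<And>n. \<bar>\<epsilon> n\<bar> = 1"
    and sum_ge: "\<And>N z. (\<lambda>n. (\<epsilon> n / 3 ^ n) *\<^sub>R a N n) sums z \<Longrightarrow> c N / (4 * 3 ^ N) \<le> norm z"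
    using gliding_hump_signs[of a c] a_le by blast
  define u where "u x = (\<Sum>n. (\<epsilon> n / 3 ^ n) *\<^sub>R e n x)" for x
  have [measurable]: "u \<in> borel_measurable M" unfolding u_def by measurable
  have geo: "summable (\<lambda>n. (1/3::real) ^ n)" by (rule summable_geometric) simp
  have geo1: "(\<Sum>n. (1/3::real) ^ n) = 3/2" by (subst suminf_geometric) auto
  \<comment> \<open>The pointwise convergence of the series for \<open>u\<close> and its square integrability both
    follow from the integrability of this majorant, as \<open>|u|\<^sup>2 \<le> (\<Sum> 3\<^sup>-\<^sup>n) \<cdot> ?w\<close> by the
    Cauchy-Schwarz inequality.\<close>
  let ?w = "\<lambda>x. \<Sum>n. (1/3) ^ n * (norm (e n x))\<^sup>2"
  have sm: "AE x in M. summable (\<lambda>n. (1/3) ^ n * (norm (e n x))\<^sup>2)"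
  proof -
    have nn: "(\<integral>\<^sup>+x. ennreal ((1/3) ^ n * (norm (e n x))\<^sup>2) \<partial>M) = ennreal ((1/3) ^ n)" for n
      by (subst nn_integral_eq_integral) (use e2 e1 in auto)
    have "(\<integral>\<^sup>+x. (\<Sum>n. ennreal ((1/3) ^ n * (norm (e n x))\<^sup>2)) \<partial>M) = (\<Sum>n. ennreal ((1/3) ^ n))"
      by (subst nn_integral_suminf) (simp_all add: nn)
    also have "\<dots> = ennreal (\<Sum>n. (1/3) ^ n)" by (rule suminf_ennreal2[OF _ geo]) simp
    also have "\<dots> \<noteq> \<infinity>" by simp
    finally have "AE x in M. (\<Sum>n. ennreal ((1/3) ^ n * (norm (e n x))\<^sup>2)) \<noteq> \<infinity>"
      by (rule nn_integral_PInf_AE[rotated]) measurable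
    then show ?thesis
    proof eventually_elim
      case (elim x)
      show ?case
        by (rule summable_suminf_not_top) (simp, rule elim[unfolded infinity_ennreal_def])
    qed
  qed
  have w_int: "integrable M ?w"
    by (rule integrable_suminf) (use e2 e1 sm geo in auto)
  have summ_e: "summable (\<lambda>n. (1/3) ^ n * norm (e n x))"
    if "summable (\<lambda>n. (1/3) ^ n * (norm (e n x))\<^sup>2)" for x
  proof (rule summable_comparison_test'[OF summable_add[OF geo that]])
    fix n
    have "t \<le> 1 + t\<^sup>2" if "t \<ge> 0" for t :: real
      using sum_power2_ge_zero[of "t - 1" t] sum_squares_ge_zero[of "t - 1/2" 0] by (simp add: power2_eq_square algebra_simps)
    then have "(1/3) ^ n * norm (e n x) \<le> (1/3) ^ n * (1 + (norm (e n x))\<^sup>2)"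
      by (intro mult_left_mono) auto
    then show "norm ((1/3) ^ n * norm (e n x)) \<le> (1/3) ^ n + (1/3) ^ n * (norm (e n x))\<^sup>2"
      by (simp add: algebra_simps)
  qed
  have nrm: "norm ((\<epsilon> n / 3 ^ n) *\<^sub>R v) = (1/3) ^ n * norm v" for n and v :: 'k
    using \<epsilon>[of n] by (simp add: power_one_over divide_simps)
  have u_le: "(norm (u x))\<^sup>2 \<le> 3/2 * ?w x"
    if s: "summable (\<lambda>n. (1/3) ^ n * (norm (e n x))\<^sup>2)" for x
  proof -
    have "norm (u x) \<le> (\<Sum>n. (1/3) ^ n * norm (e n x))"
      unfolding u_def by (rule norm_suminf_le) (use nrm summ_e[OF s] in auto)
    moreover have "(\<Sum>n. (1/3) ^ n * norm (e n x))\<^sup>2 \<le> 3/2 * ?w x"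
    proof (rule LIMSEQ_le)
      show "(\<lambda>m. (\<Sum>n<m. (1/3) ^ n * norm (e n x))\<^sup>2) \<longlonglongrightarrow> (\<Sum>n. (1/3) ^ n * norm (e n x))\<^sup>2"
        by (intro tendsto_power summable_LIMSEQ summ_e s)
      show "(\<lambda>m. (\<Sum>n<m. (1/3) ^ n) * (\<Sum>n<m. (1/3) ^ n * (norm (e n x))\<^sup>2)) \<longlonglongrightarrow> 3/2 * ?w x"
        unfolding geo1[symmetric] by (intro tendsto_mult summable_LIMSEQ geo s)
      have "(\<Sum>n<m. (1/3) ^ n * norm (e n x))\<^sup>2
          \<le> (\<Sum>n<m. (1/3) ^ n) * (\<Sum>n<m. (1/3) ^ n * (norm (e n x))\<^sup>2)" for m
        using Cauchy_Schwarz_ineq_sum[of "\<lambda>n. sqrt ((1/3) ^ n)" "\<lambda>n. sqrt ((1/3) ^ n) * norm (e n x)" "{..<m}"]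
        by (simp add: power_mult_distrib mult.assoc[symmetric])
      then show "\<exists>N. \<forall>m\<ge>N. (\<Sum>n<m. (1/3) ^ n * norm (e n x))\<^sup>2
          \<le> (\<Sum>n<m. (1/3) ^ n) * (\<Sum>n<m. (1/3) ^ n * (norm (e n x))\<^sup>2)" by blast
    qed
    ultimately show ?thesis by (meson norm_ge_zero order_trans power_mono)
  qed
  have "integrable M (\<lambda>x. (norm (u x))\<^sup>2)"
  proof (rule Bochner_Integration.integrable_bound)
    show "integrable M (\<lambda>x. 3/2 * ?w x)" using w_int by simp
    show "AE x in M. norm ((norm (u x))\<^sup>2) \<le> norm (3/2 * ?w x)"
      using sm by eventually_elim (use u_le in fastforce)
  qed simp
  then obtain C where C: "\<And>N. norm (\<integral>x. u x * y N x \<partial>M) \<le> C"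
    using bd[of u] jI unfolding y_def by auto
  have "c N / (4 * 3 ^ N) \<le> C" for N
  proof -
    let ?f = "\<lambda>n x. ((\<epsilon> n / 3 ^ n) *\<^sub>R e n x) * y N x"
    have "(\<lambda>n. \<integral>x. ?f n x \<partial>M) sums (\<integral>x. (\<Sum>n. ?f n x) \<partial>M)"
    proof (rule sums_integral)
      show "integrable M (?f n)" for n using int_ey[of n N] by simp
      show "AE x in M. summable (\<lambda>n. norm (?f n x))" using sm
      proof eventually_elim
        fix x assume "summable (\<lambda>n. (1/3) ^ n * (norm (e n x))\<^sup>2)"
        then have "summable (\<lambda>n. (1/3) ^ n * norm (e n x) * norm (y N x))"
          by (intro summable_mult2 summ_e)
        then show "summable (\<lambda>n. norm (?f n x))" by (simp only: norm_mult[of _ "y N x"] nrm)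
      qed
      have "(\<integral>x. norm (?f n x) \<partial>M) = (1/3) ^ n * (\<integral>x. norm (e n x * y N x) \<partial>M)" for n
        using \<epsilon>[of n] by (simp add: power_one_over)
      then have "norm (\<integral>x. norm (?f n x) \<partial>M) \<le> (1/3) ^ n * c N" for n
        using mult_left_mono[OF ey_le[of n N], of "(1/3) ^ n"] by (simp add: integral_nonneg)
      then show "summable (\<lambda>n. \<integral>x. norm (?f n x) \<partial>M)"
        by (intro summable_comparison_test'[OF summable_mult2[OF geo, of "c N"]]) auto
    qed
    moreover have "(\<integral>x. (\<Sum>n. ?f n x) \<partial>M) = (\<integral>x. u x * y N x \<partial>M)"
    proof (rule integral_cong_AE)
      show "AE x in M. (\<Sum>n. ?f n x) = u x * y N x" using sm
      proof eventually_elim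
        fix x assume s: "summable (\<lambda>n. (1/3) ^ n * (norm (e n x))\<^sup>2)"
        have "summable (\<lambda>n. norm ((\<epsilon> n / 3 ^ n) *\<^sub>R e n x))" using summ_e[OF s] by (simp only: nrm)
        then show "(\<Sum>n. ?f n x) = u x * y N x"
          unfolding u_def by (rule suminf_mult2[OF summable_norm_cancel, symmetric])
      qed
    qed measurable
    moreover have "(\<integral>x. ?f n x \<partial>M) = (\<epsilon> n / 3 ^ n) *\<^sub>R a N n" for n by (simp add: a_def)
    ultimately have "(\<lambda>n. (\<epsilon> n / 3 ^ n) *\<^sub>R a N n) sums (\<integral>x. u x * y N x \<partial>M)"
      by (simp only:)
    then have "c N / (4 * 3 ^ N) \<le> norm (\<integral>x. u x * y N x \<partial>M)" by (rule sum_ge)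
    then show ?thesis using C[of N] by linarith
  qed
  then have "c N \<le> C * 4 * 3 ^ N" for N by (simp add: field_simps)
  then have "4 ^ N < C * 4 * 3 ^ N" for N using c[of N] less_le_trans by blast
  then show False using power_4_not_below_power_3 by blast
qed


section \<open>Integral equations on the half line\<close>

text \<open>
  The hypothesis says that the derivative is zero, uniformly. It is verified below for expressions
  in which a merely measurable input occurs, so that the product rule is not available for the
  parts.
\<close>

lemma eq_start_if_increments_small:
  fixes e :: "real \<Rightarrow> 'b::real_normed_vector"
  assumes small: "\<And>\<epsilon>. \<epsilon> > 0 \<Longrightarrow> \<exists>\<delta>>0. \<forall>a b. 0 \<le> a \<longrightarrow> a \<le> b \<longrightarrow> b \<le> N \<longrightarrow> b - a < \<delta>
      \<longrightarrow> norm (e b - e a) \<le> \<epsilon> * (b - a)"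
    and t: "0 \<le> t" "t \<le> N"
  shows "e t = e 0"
proof -
  have "(e has_derivative (\<lambda>h. 0)) (at x within {0..N})" if x: "x \<in> {0..N}" for x
    unfolding has_derivative_within_alt
  proof (intro conjI allI impI)
    fix \<epsilon> :: real assume "0 < \<epsilon>"
    then obtain \<delta> where \<delta>: "\<delta> > 0" "\<And>a b. 0 \<le> a \<Longrightarrow> a \<le> b \<Longrightarrow> b \<le> N \<Longrightarrow> b - a < \<delta>
      \<Longrightarrow> norm (e b - e a) \<le> \<epsilon> * (b - a)" using small by blast
    have "norm (e y - e x - 0) \<le> \<epsilon> * norm (y - x)" if y: "y \<in> {0..N}" "norm (y - x) < \<delta>" for y
    proof (cases "x \<le> y")
      case True
      then show ?thesis using \<delta>(2)[of x y] x y by simp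
    next
      case False
      then show ?thesis using \<delta>(2)[of y x] x y by (simp add: norm_minus_commute)
    qed
    then show "\<exists>d>0. \<forall>y\<in>{0..N}. norm (y - x) < d \<longrightarrow> norm (e y - e x - 0) \<le> \<epsilon> * norm (y - x)"
      using \<delta>(1) by blast
  qed simp
  then obtain c where "\<And>x. x \<in> {0..N} \<Longrightarrow> e x = c"
    using has_derivative_zero_constant[of "{0..N}" e] by auto
  then show ?thesis using t by simp
qed

lemma linear_integral_equation_zero:
  fixes e :: "real \<Rightarrow> 'k::{real_normed_field, banach}"
  assumes cont: "continuous_on {0..} e" and eq: "\<And>t. t \<ge> 0 \<Longrightarrow> e t = c * integral {0..t} e"
    and t: "t \<ge> 0"
  shows "e t = 0"
proof -
  define E where "E s = integral {0..s} e" for s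
  \<comment> \<open>The integrating factor turns \<open>E' = c E\<close> into \<open>u' = 0\<close>.\<close>
  define u where "u s = exp (s *\<^sub>R (- c)) * E s" for s
  have "(u has_vector_derivative 0) (at s within {0..t})" if s: "s \<in> {0..t}" for s
  proof -
    have c1: "continuous_on {0..t} e" by (rule continuous_on_subset[OF cont]) auto
    have dE: "(E has_vector_derivative e s) (at s within {0..t})"
      unfolding E_def by (rule integral_has_vector_derivative[OF c1 s])
    have dx: "((\<lambda>s. exp (s *\<^sub>R (- c))) has_vector_derivative exp (s *\<^sub>R (- c)) * (- c)) (at s within {0..t})"
      by (rule exp_scaleR_has_vector_derivative_right)
    have "e s = c * E s" using eq[of s] s by (simp add: E_def)
    then have "exp (s *\<^sub>R (- c)) * e s + exp (s *\<^sub>R (- c)) * (- c) * E s = 0"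
      by (simp only: mult.assoc mult_minus_left mult_minus_right right_minus)
    then show ?thesis
      using has_vector_derivative_mult[OF dx dE] unfolding u_def by (simp only:)
  qed
  then obtain k where k: "\<And>s. s \<in> {0..t} \<Longrightarrow> u s = k"
    using has_vector_derivative_zero_constant[of "{0..t}" u] by auto
  have "u t = u 0" using k[of t] k[of 0] t by simp
  then have "E t = 0" by (simp add: u_def E_def)
  then show ?thesis using eq[OF t] by (simp add: E_def)
qed

text \<open>
  The class of inputs: all controls built below are bounded on bounded intervals, which makes
  products with continuous functions integrable. Measurability is required on the whole line, so
  functions that matter on the half line only are extended, mostly by clamping the argument with
  \<open>max 0\<close>.
\<close>

definition loc_bounded :: "(real \<Rightarrow> 'k::real_normed_vector) \<Rightarrow> bool" where
  "loc_bounded v \<longleftrightarrow> v \<in> borel_measurable lebesgue \<and> (\<forall>N. \<exists>K. \<forall>t\<in>{0..N}. norm (v t) \<le> K)"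

lemma loc_boundedE:
  assumes "loc_bounded v"
  obtains K where "K \<ge> 0" "\<And>t. 0 \<le> t \<Longrightarrow> t \<le> N \<Longrightarrow> norm (v t) \<le> K"
proof -
  obtain K where "\<forall>t\<in>{0..N}. norm (v t) \<le> K" using assms unfolding loc_bounded_def by blast
  then show ?thesis by (intro that[of "max K 0"]) (auto intro: le_max_iff_disj[THEN iffD2])
qed

lemma loc_bounded_add:
  fixes u v :: "real \<Rightarrow> 'k::euclidean_space"
  assumes "loc_bounded u" "loc_bounded v"
  shows "loc_bounded (\<lambda>s. u s + v s)"
  unfolding loc_bounded_def
proof (intro conjI allI)
  show "(\<lambda>s. u s + v s) \<in> borel_measurable lebesgue"
    using assms unfolding loc_bounded_def by (intro borel_measurable_add) auto
  fix N
  obtain K1 where K1: "\<And>t. 0 \<le> t \<Longrightarrow> t \<le> N \<Longrightarrow> norm (u t) \<le> K1" using loc_boundedE[OF assms(1)] by metis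
  obtain K2 where K2: "\<And>t. 0 \<le> t \<Longrightarrow> t \<le> N \<Longrightarrow> norm (v t) \<le> K2" using loc_boundedE[OF assms(2)] by metis
  show "\<exists>K. \<forall>t\<in>{0..N}. norm (u t + v t) \<le> K"
    by (intro exI[of _ "K1 + K2"]) (auto intro!: norm_triangle_mono K1 K2)
qed

lemma loc_bounded_if_continuous:
  fixes v :: "real \<Rightarrow> 'k::euclidean_space"
  assumes "continuous_on UNIV v"
  shows "loc_bounded v"
  unfolding loc_bounded_def
proof (intro conjI allI)
  show "v \<in> borel_measurable lebesgue"
    using borel_measurable_continuous_onI[OF assms] by (simp add: measurable_completion)
  fix N :: real
  have "compact (v ` {0..N})"
    by (intro compact_continuous_image continuous_on_subset[OF assms]) auto
  then have "bounded (v ` {0..N})" by (rule compact_imp_bounded)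
  then show "\<exists>K. \<forall>t\<in>{0..N}. norm (v t) \<le> K" by (auto simp: bounded_iff)
qed

lemma loc_bounded_times_continuous:
  fixes v :: "real \<Rightarrow> 'k::real_or_complex"
  assumes v: "loc_bounded v" and g: "continuous_on {a..b} g" and a: "0 \<le> a"
  shows "(\<lambda>s. v s * g s) absolutely_integrable_on {a..b}"
proof -
  obtain K where K: "K \<ge> 0" "\<And>t. 0 \<le> t \<Longrightarrow> t \<le> b \<Longrightarrow> norm (v t) \<le> K" using loc_boundedE[OF v] by metis
  have "bounded (g ` {a..b})" by (intro compact_imp_bounded compact_continuous_image g) auto
  then obtain K' where K': "\<And>t. t \<in> {a..b} \<Longrightarrow> norm (g t) \<le> K'"
    by (metis bounded_iff imageI)
  show ?thesis
  proof (rule measurable_bounded_by_integrable_imp_absolutely_integrable)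
    have "v \<in> borel_measurable (lebesgue_on {a..b})"
      using v by (simp add: loc_bounded_def measurable_restrict_space1)
    moreover have "g \<in> borel_measurable (lebesgue_on {a..b})"
      by (rule continuous_imp_measurable_on_sets_lebesgue[OF g]) simp
    ultimately show "(\<lambda>s. v s * g s) \<in> borel_measurable (lebesgue_on {a..b})" by simp
    show "(\<lambda>s. K * K') integrable_on {a..b}" by (rule integrable_const_ivl)
    show "norm (v s * g s) \<le> K * K'" if "s \<in> {a..b}" for s
      unfolding norm_mult using that a by (intro mult_mono K K') (auto intro: K)
  qed simp
qed

lemma loc_bounded_integrable:
  fixes v :: "real \<Rightarrow> 'k::real_or_complex"
  assumes "loc_bounded v" "0 \<le> a"
  shows "v absolutely_integrable_on {a..b}"
  using loc_bounded_times_continuous[OF assms(1) continuous_on_const[of _ 1] assms(2)] by simp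

lemma loc_bounded_times_integrable:
  fixes v :: "real \<Rightarrow> 'k::real_or_complex"
  shows "loc_bounded v \<Longrightarrow> continuous_on {a..b} g \<Longrightarrow> 0 \<le> a \<Longrightarrow> (\<lambda>s. v s * g s) integrable_on {a..b}"
  by (rule set_lebesgue_integral_eq_integral(1)[OF loc_bounded_times_continuous])

lemma loc_bounded_integrable_on:
  fixes v :: "real \<Rightarrow> 'k::real_or_complex"
  shows "loc_bounded v \<Longrightarrow> 0 \<le> a \<Longrightarrow> v integrable_on {a..b}"
  by (rule set_lebesgue_integral_eq_integral(1)[OF loc_bounded_integrable])

lemmas integral_combine_interval = Henstock_Kurzweil_Integration.integral_combine

lemma integral_tendsto_at_right:
  fixes g :: "real \<Rightarrow> 'b::banach"
  assumes g: "continuous_on {0..} g" and h: "h \<ge> 0"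
  shows "((\<lambda>t. integral {h..h+t} g /\<^sub>R t) \<longlongrightarrow> g h) (at_right 0)"
proof (rule tendstoI)
  fix e :: real assume e: "e > 0"
  obtain d where d: "d > 0" "\<And>s. s \<ge> 0 \<Longrightarrow> dist s h < d \<Longrightarrow> dist (g s) (g h) < e / 2"
    using g h e unfolding continuous_on_iff by (metis atLeast_iff half_gt_zero)
  have "dist (integral {h..h+t} g /\<^sub>R t) (g h) < e" if t: "0 < t" "t < d" for t
  proof -
    have int: "g integrable_on {h..h+t}"
      by (intro integrable_continuous_interval continuous_on_subset[OF g]) (use h in auto)
    have "integral {h..h+t} g - t *\<^sub>R g h = integral {h..h+t} (\<lambda>s. g s - g h)"
      using int t by (subst integral_diff) auto
    also have "norm \<dots> \<le> e / 2 * (h + t - h)"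
    proof (rule integral_bound)
      show "continuous_on {h..h+t} (\<lambda>s. g s - g h)"
        by (intro continuous_intros continuous_on_subset[OF g]) (use h in auto)
      show "norm (g s - g h) \<le> e / 2" if "s \<in> {h..h+t}" for s
        using d(2)[of s] that t h by (simp add: dist_norm less_imp_le)
    qed (use t in simp)
    finally have "norm (integral {h..h+t} g - t *\<^sub>R g h) \<le> e / 2 * t" by simp
    moreover have "norm (integral {h..h+t} g - t *\<^sub>R g h) = t * dist (integral {h..h+t} g /\<^sub>R t) (g h)"
    proof -
      have "integral {h..h+t} g - t *\<^sub>R g h = t *\<^sub>R (integral {h..h+t} g /\<^sub>R t - g h)"
        using t by (simp add: scaleR_diff_right)
      then show ?thesis using t by (simp add: dist_norm)
    qed
    ultimately have "t * dist (integral {h..h+t} g /\<^sub>R t) (g h) \<le> t * (e / 2)" by (simp add: mult.commute)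
    then have "dist (integral {h..h+t} g /\<^sub>R t) (g h) \<le> e / 2" using t(1) by (simp only: mult_le_cancel_left_pos)
    then show ?thesis using e by simp
  qed
  then show "\<forall>\<^sub>F t in at_right 0. dist (integral {h..h+t} g /\<^sub>R t) (g h) < e"
    by (intro eventually_at_rightI[of 0 d]) (use d in auto)
qed


section \<open>Semigroups and their adjoints\<close>

context hilbert_space
begin

text \<open>
  Density of the domain makes the defining property of the adjoint determine its value.
\<close>

lemma adj_eqI:
  assumes "closure D = UNIV" "\<And>x. x \<in> D \<Longrightarrow> ip y x = ip \<psi> (A x)"
  shows "adj ip D A \<psi> = y"
  unfolding adj_def
proof (rule the_equality)
  fix z assume z: "\<forall>x\<in>D. ip z x = ip \<psi> (A x)"
  have "z - y = 0"
    by (rule eq_0_if_orthogonal_dense[OF assms(1)]) (use z assms(2) in \<open>simp add: ip_diff\<close>)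
  then show "z = y" by simp
qed (use assms(2) in blast)

lemma ip_adj:
  assumes D: "closure D = UNIV" "subspace D"
    and add: "\<And>x y. x \<in> D \<Longrightarrow> y \<in> D \<Longrightarrow> A (x + y) = A x + A y"
    and scl: "\<And>c x. x \<in> D \<Longrightarrow> A (c *\<^sub>K x) = c *\<^sub>K A x"
    and \<psi>: "\<psi> \<in> adj_dom ip D A" and x: "x \<in> D"
  shows "ip (adj ip D A \<psi>) x = ip \<psi> (A x)"
proof -
  obtain c where c: "c > 0" "\<And>x. x \<in> D \<Longrightarrow> norm (ip \<psi> (A x)) \<le> c * norm x"
    using \<psi> unfolding adj_dom_def by blast
  \<comment> \<open>Membership in the domain is boundedness of this functional, and Riesz gives the
    vector that the definite description refers to.\<close>
  obtain y where y: "\<And>x. x \<in> D \<Longrightarrow> ip y x = ip \<psi> (A x)"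
    by (rule riesz_subspace[OF D(2), of "\<lambda>x. ip \<psi> (A x)" c]) (use c add scl in \<open>auto simp: ip_add ip_scl\<close>)
  have "adj ip D A \<psi> = y" by (rule adj_eqI[OF D(1) y])
  then show ?thesis using y[OF x] by simp
qed

lemma ip_adj_UNIV:
  assumes "bounded_linear F" "\<And>c x. F (c *\<^sub>K x) = c *\<^sub>K F x"
  shows "ip (adj ip UNIV F \<psi>) x = ip \<psi> (F x)"
proof (rule ip_adj)
  obtain K where K: "\<And>x. norm (F x) \<le> norm x * K" "K > 0"
    using bounded_linear.pos_bounded[OF assms(1)] by blast
  have "norm (ip \<psi> (F x)) \<le> (norm \<psi> * K + 1) * norm x" for x
  proof -
    have "norm (ip \<psi> (F x)) \<le> norm \<psi> * (norm x * K)"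
      using cauchy_schwarz[of \<psi> "F x"] mult_left_mono[OF K(1)[of x], of "norm \<psi>"] by simp
    moreover have "(norm \<psi> * K + 1) * norm x = norm \<psi> * (norm x * K) + norm x"
      by (simp add: algebra_simps)
    ultimately show ?thesis using norm_ge_zero[of x] by linarith
  qed
  moreover have "norm \<psi> * K + 1 > 0" using K(2) by (simp add: add_nonneg_pos)
  ultimately show "\<psi> \<in> adj_dom ip UNIV F" unfolding adj_dom_def by blast
qed (use assms in \<open>auto simp: linear_add[OF bounded_linear.linear]\<close>)

lemma subspace_scaleR: "subspace W \<Longrightarrow> x \<in> W \<Longrightarrow> r *\<^sub>R x \<in> W"
  by (metis scl_of_real subspace_scale)

end

locale semigroup_generator = hilbert_space scl ip
  for scl :: "'k::real_or_complex \<Rightarrow> 'h::banach \<Rightarrow> 'h" (infixr \<open>*\<^sub>K\<close> 75) and ip :: "'h \<Rightarrow> 'h \<Rightarrow> 'k" +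
  fixes D :: "'h set" and A :: "'h \<Rightarrow> 'h" and T :: "real \<Rightarrow> 'h \<Rightarrow> 'h"
  assumes generates: "generates scl D A T"
begin

lemma T_linear: "t \<ge> 0 \<Longrightarrow> bounded_linear (T t)"
  and T_scl: "t \<ge> 0 \<Longrightarrow> T t (c *\<^sub>K x) = c *\<^sub>K T t x"
  and T_0 [simp]: "T 0 x = x"
  and T_add: "s \<ge> 0 \<Longrightarrow> t \<ge> 0 \<Longrightarrow> T (s + t) x = T s (T t x)"
  and T_right: "((\<lambda>t. T t x) \<longlongrightarrow> x) (at_right 0)"
  using generates unfolding generates_def C0_semigroup_def by auto

lemma D_iff: "x \<in> D \<longleftrightarrow> (\<exists>y. ((\<lambda>t. (T t x - x) /\<^sub>R t) \<longlongrightarrow> y) (at_right 0))"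
  and A_tendsto: "x \<in> D \<Longrightarrow> ((\<lambda>t. (T t x - x) /\<^sub>R t) \<longlongrightarrow> A x) (at_right 0)"
  using generates unfolding generates_def by auto

lemma in_D_if_tendsto:
  assumes "((\<lambda>t. (T t x - x) /\<^sub>R t) \<longlongrightarrow> y) (at_right 0)"
  shows "x \<in> D" "A x = y"
proof -
  show "x \<in> D" using assms D_iff by blast
  then show "A x = y" using tendsto_unique[OF _ A_tendsto assms] by simp
qed

text \<open>
  Strong continuity at zero implies a uniform bound on the operator norms near zero. Otherwise
  these norms exceed \<open>4\<^sup>N\<close> at times \<open>t N \<rightarrow> 0\<close>, and the gliding hump over vectors on which they are
  nearly attained gives one \<open>u\<close> with \<open>T (t N) u\<close> unbounded, whereas \<open>T (t N) u \<rightarrow> u\<close>.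
\<close>

lemma T_bounded_near_0:
  obtains \<delta> M where "\<delta> > 0" "M \<ge> 1" "\<And>t x. 0 \<le> t \<Longrightarrow> t \<le> \<delta> \<Longrightarrow> norm (T t x) \<le> M * norm x"
proof (rule ccontr)
  assume neg: "\<not> thesis"
  have "\<exists>t x. 0 \<le> t \<and> t \<le> 1 / Suc N \<and> norm (T t x) > 4 ^ N * norm x" for N
  proof (rule ccontr)
    assume "\<not> ?thesis"
    then show False using neg that[of "1 / Suc N" "4 ^ N"] by (force simp: not_less)
  qed
  then obtain t x where t: "\<And>N. 0 \<le> t N" "\<And>N. t N \<le> 1 / Suc N"
    and x: "\<And>N. norm (T (t N) (x N)) > 4 ^ N * norm (x N)" by metis
  \<comment> \<open>Time zero cannot occur, as \<open>T 0\<close> is the identity.\<close>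
  have tpos: "t N > 0" for N
  proof (rule ccontr)
    assume "\<not> 0 < t N"
    then have "t N = 0" using t(1)[of N] by simp
    then have "4 ^ N * norm (x N) < 1 * norm (x N)" using x[of N] by simp
    moreover have "1 * norm (x N) \<le> 4 ^ N * norm (x N)" by (intro mult_right_mono) auto
    ultimately show False by simp
  qed
  define c where "c N = onorm (T (t N))" for N
  have c: "4 ^ N < c N" for N
  proof -
    have "4 ^ N * norm (x N) < c N * norm (x N)"
      using x[of N] onorm[OF T_linear[OF t(1)[of N]], of "x N"] by (simp add: c_def)
    then show ?thesis using mult_less_cancel_right_disj by (metis norm_ge_zero not_less)
  qed
  have cpos: "c N > 0" for N by (rule less_trans[OF _ c[of N]]) simp
  have "\<exists>e. norm e = 1 \<and> 3/4 * c N \<le> norm (T (t N) e)" for N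
  proof (rule ccontr)
    assume no_e: "\<nexists>e. norm e = 1 \<and> 3/4 * c N \<le> norm (T (t N) e)"
    interpret bounded_linear "T (t N)" by (rule T_linear[OF t(1)])
    have "norm (T (t N) y) \<le> 3/4 * c N * norm y" for y
    proof (cases "y = 0")
      case False
      have "norm (y /\<^sub>R norm y) = 1" using False by simp
      then have "\<not> 3/4 * c N \<le> norm (T (t N) (y /\<^sub>R norm y))" using no_e by blast
      then have "norm (T (t N) (y /\<^sub>R norm y)) \<le> 3/4 * c N" by simp
      then show ?thesis using False by (simp add: scale field_simps)
    qed (simp add: zero)
    then have "c N \<le> 3/4 * c N" unfolding c_def[of N] using cpos[of N]
      by (intro onorm_bound) (auto simp: c_def)
    then show False using cpos[of N] by simp
  qed
  then obtain e where e: "\<And>N. norm (e N) = 1" "\<And>N. 3/4 * c N \<le> norm (T (t N) (e N))" by metis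
  have "norm (T (t N) (e n)) \<le> c N" for N n
    using onorm[OF T_linear[OF t(1)[of N]], of "e n"] e(1)[of n] by (simp add: c_def)
  then obtain \<epsilon> where \<epsilon>: "\<And>n. \<bar>\<epsilon> n\<bar> = 1"
    and sum_ge: "\<And>N z. (\<lambda>n. (\<epsilon> n / 3 ^ n) *\<^sub>R T (t N) (e n)) sums z \<Longrightarrow> c N / (4 * 3 ^ N) \<le> norm z"
    using gliding_hump_signs[of "\<lambda>N n. T (t N) (e n)" c] e(2) by blast
  define u where "u = (\<Sum>n. (\<epsilon> n / 3 ^ n) *\<^sub>R e n)"
  have "summable (\<lambda>n. (\<epsilon> n / 3 ^ n) *\<^sub>R e n)"
  proof (rule summable_norm_cancel, rule summable_cong[THEN iffD1])
    show "summable (\<lambda>n. (1/3::real) ^ n)" by (rule summable_geometric) simp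
    show "\<forall>\<^sub>F n in sequentially. (1/3::real) ^ n = norm ((\<epsilon> n / 3 ^ n) *\<^sub>R e n)"
      using \<epsilon> e(1) by (simp add: power_one_over)
  qed
  then have u: "(\<lambda>n. (\<epsilon> n / 3 ^ n) *\<^sub>R e n) sums u" by (simp add: u_def summable_sums)
  have Tu: "c N / (4 * 3 ^ N) \<le> norm (T (t N) u)" for N
  proof (rule sum_ge)
    interpret bounded_linear "T (t N)" by (rule T_linear[OF t(1)])
    show "(\<lambda>n. (\<epsilon> n / 3 ^ n) *\<^sub>R T (t N) (e n)) sums T (t N) u"
      using sums[OF u] by (simp add: scale)
  qed
  have "t \<longlonglongrightarrow> 0"
    by (rule tendsto_sandwich[of "\<lambda>_. 0" _ _ "\<lambda>N. 1 / Suc N"])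
       (use t LIMSEQ_inverse_real_of_nat in \<open>auto simp: inverse_eq_divide\<close>)
  then have "filterlim t (at_right 0) sequentially"
    unfolding filterlim_at by (simp add: tpos less_imp_neq[OF tpos, symmetric])
  then have "(\<lambda>N. T (t N) u) \<longlonglongrightarrow> u" by (rule filterlim_compose[OF T_right])
  then have "Bseq (\<lambda>N. T (t N) u)" by (rule convergent_imp_Bseq[OF convergentI])
  then obtain C where C: "\<And>N. norm (T (t N) u) \<le> C" unfolding Bseq_def by blast
  have "4 ^ N < C * 4 * 3 ^ N" for N
  proof -
    have "c N / (4 * 3 ^ N) \<le> C" using Tu C order_trans by blast
    then have "c N \<le> C * 4 * 3 ^ N" by (simp add: field_simps)
    then show ?thesis using c[of N] by simp
  qed
  then show False using power_4_not_below_power_3 by blast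
qed

lemma T_bound:
  obtains M where "M \<ge> 1" "\<And>t x. 0 \<le> t \<Longrightarrow> t \<le> N \<Longrightarrow> norm (T t x) \<le> M * norm x"
proof -
  obtain \<delta> M where d: "\<delta> > 0" "M \<ge> 1" "\<And>t x. 0 \<le> t \<Longrightarrow> t \<le> \<delta> \<Longrightarrow> norm (T t x) \<le> M * norm x"
    using T_bounded_near_0 by metis
  have iter: "norm (T t x) \<le> M ^ n * norm x" if "0 \<le> t" "t \<le> real n * \<delta>" for n t x
    using that
  proof (induction n arbitrary: t x)
    case (Suc n)
    have M1: "M ^ n \<le> M ^ Suc n" using d(2) by (intro power_increasing) auto
    show ?case
    proof (cases "t \<le> \<delta>")
      case True
      have "norm (T t x) \<le> M * norm x" using d(3) True Suc by blast
      also have "\<dots> \<le> M ^ Suc n * norm x"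
        using d(2) by (intro mult_right_mono) (auto simp: self_le_power)
      finally show ?thesis .
    next
      case False
      have "T t x = T \<delta> (T (t - \<delta>) x)" using T_add[of \<delta> "t - \<delta>" x] False d(1) by simp
      also have "norm \<dots> \<le> M * norm (T (t - \<delta>) x)" using d by simp
      also have "\<dots> \<le> M * (M ^ n * norm x)"
        using Suc False d(2) by (intro mult_left_mono Suc.IH) (auto simp: algebra_simps)
      finally show ?thesis by simp
    qed
  qed simp
  obtain n :: nat where n: "N \<le> real n * \<delta>"
    using reals_Archimedean3[OF d(1)] less_imp_le by blast
  show ?thesis by (rule that[of "M ^ n"]) (use d(2) iter n in auto)
qed

lemma T_diff: "t \<ge> 0 \<Longrightarrow> T t (x - y) = T t x - T t y"
  using T_linear by (simp add: linear_diff bounded_linear.linear)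

lemma T_scaleR: "t \<ge> 0 \<Longrightarrow> T t (r *\<^sub>R x) = r *\<^sub>R T t x"
  using T_linear by (simp add: linear_cmul bounded_linear.linear)

lemma T_plus: "t \<ge> 0 \<Longrightarrow> T t (x + y) = T t x + T t y"
  using T_linear by (simp add: linear_add bounded_linear.linear)

lemma T_continuous: "continuous_on {0..} (\<lambda>t. T t x)"
  unfolding continuous_on_iff
proof (intro ballI allI impI)
  fix s e :: real assume s: "s \<in> {0..}" and e: "0 < e"
  obtain M where M: "M \<ge> 1" "\<And>t x. 0 \<le> t \<Longrightarrow> t \<le> s + 1 \<Longrightarrow> norm (T t x) \<le> M * norm x"
    using T_bound by metis
  have "e / M > 0" using e M by simp
  then obtain d where d: "d > 0" "\<And>t. 0 < t \<Longrightarrow> t < d \<Longrightarrow> dist (T t x) x < e / M"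
    using tendstoD[OF T_right[of x], of "e / M"] unfolding eventually_at_right_field by force
  have ord: "dist (T b x) (T a x) < e" if "0 \<le> a" "a < b" "b < a + d" "a \<le> s + 1" for a b
  proof -
    have "T b x - T a x = T a (T (b - a) x - x)"
      using that T_add[of a "b - a" x] by (simp add: T_diff)
    also have "norm \<dots> \<le> M * norm (T (b - a) x - x)" using M that by simp
    also have "\<dots> < M * (e / M)"
      using d(2)[of "b - a"] that M by (intro mult_strict_left_mono) (auto simp: dist_norm)
    finally show ?thesis using M by (simp add: dist_norm)
  qed
  show "\<exists>d>0. \<forall>x'\<in>{0..}. dist x' s < d \<longrightarrow> dist (T x' x) (T s x) < e"
  proof (intro exI[of _ "min d 1"] conjI ballI impI)
    fix t assume t: "t \<in> {0..}" "dist t s < min d 1"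
    consider "t < s" | "t = s" | "s < t" by linarith
    then show "dist (T t x) (T s x) < e"
    proof cases
      case 1
      then show ?thesis using ord[of t s] t s by (simp add: dist_commute dist_real_def)
    next
      case 3
      then show ?thesis using ord[of s t] t s by (simp add: dist_real_def)
    qed (use e in simp)
  qed (use d in simp)
qed

lemma T_continuous_ip: "continuous_on {0..} (\<lambda>t. ip \<psi> (T t x))"
  by (rule bounded_linear.continuous_on[OF bounded_linear_ip T_continuous])

text \<open>
  Joint continuity of \<open>(r, s) \<mapsto> T r (z s)\<close> follows from strong continuity in \<open>r\<close> and the bound on
  the operator norms, which controls the dependence on \<open>z s\<close> uniformly in \<open>r\<close>; compactness makes
  it uniform.
\<close>

lemma T_uniformly_continuous:
  assumes z: "continuous_on {0..N} z" and e: "e > 0"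
  obtains d where "d > 0" "\<And>r r' s s'. r \<in> {0..N} \<Longrightarrow> r' \<in> {0..N} \<Longrightarrow> s \<in> {0..N} \<Longrightarrow> s' \<in> {0..N}
    \<Longrightarrow> \<bar>r - r'\<bar> < d \<Longrightarrow> \<bar>s - s'\<bar> < d \<Longrightarrow> norm (T r (z s) - T r' (z s')) < e"
proof -
  obtain M where M: "M \<ge> 1" "\<And>t x. 0 \<le> t \<Longrightarrow> t \<le> N \<Longrightarrow> norm (T t x) \<le> M * norm x"
    using T_bound by metis
  have cont: "continuous_on ({0..N} \<times> {0..N}) (\<lambda>(r, s). T r (z s))"
    unfolding continuous_on_def
  proof
    fix p assume p: "p \<in> {0..N} \<times> {0..N}"
    let ?F = "at p within {0..N} \<times> {0..N}"
    have "((\<lambda>q. z (snd q)) \<longlongrightarrow> z (snd p)) ?F"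
      using p continuous_on_compose2[OF z continuous_on_snd[OF continuous_on_id], of "{0..N} \<times> {0..N}"]
      by (auto simp: continuous_on_def)
    then have l1: "((\<lambda>q. M * norm (z (snd q) - z (snd p))) \<longlongrightarrow> 0) ?F"
      by (auto intro!: tendsto_eq_intros)
    have c2: "continuous_on {0..N} (\<lambda>r. T r (z (snd p)))"
      by (rule continuous_on_subset[OF T_continuous]) auto
    have "((\<lambda>q. T (fst q) (z (snd p))) \<longlongrightarrow> T (fst p) (z (snd p))) ?F"
      using p continuous_on_compose2[OF c2 continuous_on_fst[OF continuous_on_id], of "{0..N} \<times> {0..N}"]
      by (auto simp: continuous_on_def)
    then have l2: "((\<lambda>q. norm (T (fst q) (z (snd p)) - T (fst p) (z (snd p)))) \<longlongrightarrow> 0) ?F"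
      by (auto intro!: tendsto_eq_intros)
    have "((\<lambda>q. T (fst q) (z (snd q)) - T (fst p) (z (snd p))) \<longlongrightarrow> 0) ?F"
    proof (rule Lim_null_comparison)
      show "((\<lambda>q. M * norm (z (snd q) - z (snd p)) + norm (T (fst q) (z (snd p)) - T (fst p) (z (snd p)))) \<longlongrightarrow> 0) ?F"
        using tendsto_add[OF l1 l2] by simp
      have "norm (T (fst q) (z (snd q)) - T (fst p) (z (snd p)))
          \<le> M * norm (z (snd q) - z (snd p)) + norm (T (fst q) (z (snd p)) - T (fst p) (z (snd p)))"
        if q: "q \<in> {0..N} \<times> {0..N}" for q
      proof -
        have "T (fst q) (z (snd q)) - T (fst p) (z (snd p))
            = T (fst q) (z (snd q) - z (snd p)) + (T (fst q) (z (snd p)) - T (fst p) (z (snd p)))"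
          using q by (auto simp: T_diff)
        also have "norm \<dots> \<le> norm (T (fst q) (z (snd q) - z (snd p))) + norm (T (fst q) (z (snd p)) - T (fst p) (z (snd p)))"
          by (rule norm_triangle_ineq)
        finally show ?thesis using M(2)[of "fst q" "z (snd q) - z (snd p)"] q by auto
      qed
      then show "\<forall>\<^sub>F q in ?F. norm (T (fst q) (z (snd q)) - T (fst p) (z (snd p)))
          \<le> M * norm (z (snd q) - z (snd p)) + norm (T (fst q) (z (snd p)) - T (fst p) (z (snd p)))"
        by (simp add: eventually_at_filter)
    qed
    then show "((\<lambda>(r, s). T r (z s)) \<longlongrightarrow> (case p of (r, s) \<Rightarrow> T r (z s))) ?F"
      by (simp add: case_prod_unfold LIM_zero_iff)
  qed
  have "uniformly_continuous_on ({0..N} \<times> {0..N}) (\<lambda>(r, s). T r (z s))"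
    by (intro compact_uniformly_continuous[OF cont] compact_Times) auto
  then obtain d where d: "d > 0" "\<And>p q. p \<in> {0..N} \<times> {0..N} \<Longrightarrow> q \<in> {0..N} \<times> {0..N} \<Longrightarrow> dist q p < d
     \<Longrightarrow> dist (case q of (r, s) \<Rightarrow> T r (z s)) (case p of (r, s) \<Rightarrow> T r (z s)) < e"
    using e unfolding uniformly_continuous_on_def by metis
  show ?thesis
  proof (rule that[of "d / 2"])
    fix r r' s s' :: real
    assume rs: "r \<in> {0..N}" "r' \<in> {0..N}" "s \<in> {0..N}" "s' \<in> {0..N}" "\<bar>r - r'\<bar> < d / 2" "\<bar>s - s'\<bar> < d / 2"
    have "dist (r, s) (r', s') \<le> \<bar>r - r'\<bar> + \<bar>s - s'\<bar>"
      unfolding dist_prod_def by (simp add: dist_real_def sqrt_sum_squares_le_sum_abs)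
    then show "norm (T r (z s) - T r' (z s')) < e"
      using d(2)[of "(r', s')" "(r, s)"] rs by (simp add: dist_norm)
  qed (use d in simp)
qed

lemma D_subspace: "subspace D"
  and A_add: "x \<in> D \<Longrightarrow> y \<in> D \<Longrightarrow> A (x + y) = A x + A y"
  and A_scl: "x \<in> D \<Longrightarrow> A (c *\<^sub>K x) = c *\<^sub>K A x"
proof -
  have ev: "\<forall>\<^sub>F t in at_right 0. (t::real) \<ge> 0" by (simp add: eventually_at_right_less eventually_at_filter)
  have add: "((\<lambda>t. (T t (x + y) - (x + y)) /\<^sub>R t) \<longlongrightarrow> A x + A y) (at_right 0)" if "x \<in> D" "y \<in> D" for x y
  proof (rule Lim_transform_eventually[OF tendsto_add[OF A_tendsto[OF that(1)] A_tendsto[OF that(2)]]])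
    show "\<forall>\<^sub>F t in at_right 0. (T t x - x) /\<^sub>R t + (T t y - y) /\<^sub>R t = (T t (x + y) - (x + y)) /\<^sub>R t"
      using ev by eventually_elim (simp add: T_plus scaleR_add_right[symmetric])
  qed
  have scl: "((\<lambda>t. (T t (c *\<^sub>K x) - c *\<^sub>K x) /\<^sub>R t) \<longlongrightarrow> c *\<^sub>K A x) (at_right 0)" if "x \<in> D" for c x
  proof (rule Lim_transform_eventually[OF bounded_linear.tendsto[OF bounded_linear_scl A_tendsto[OF that]]])
    show "\<forall>\<^sub>F t in at_right 0. c *\<^sub>K ((T t x - x) /\<^sub>R t) = (T t (c *\<^sub>K x) - c *\<^sub>K x) /\<^sub>R t"
      using ev by eventually_elim
        (simp add: T_scl scale_right_diff_distrib bounded_linear.linear[OF bounded_linear_scl, THEN linear_cmul])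
  qed
  have "((\<lambda>t. (T t 0 - 0) /\<^sub>R t) \<longlongrightarrow> 0) (at_right 0)"
    by (rule Lim_transform_eventually[OF tendsto_const])
       (use ev in eventually_elim, simp add: linear_0 bounded_linear.linear T_linear)
  then have "0 \<in> D" by (rule in_D_if_tendsto)
  then show "subspace D"
    unfolding subspace_def using in_D_if_tendsto(1)[OF add] in_D_if_tendsto(1)[OF scl] by blast
  show "x \<in> D \<Longrightarrow> y \<in> D \<Longrightarrow> A (x + y) = A x + A y" using add in_D_if_tendsto by blast
  show "x \<in> D \<Longrightarrow> A (c *\<^sub>K x) = c *\<^sub>K A x" using scl in_D_if_tendsto by blast
qed

lemma T_in_D:
  assumes "x \<in> D" "t \<ge> 0"
  shows "T t x \<in> D" "A (T t x) = T t (A x)"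
proof -
  have "((\<lambda>r. (T r (T t x) - T t x) /\<^sub>R r) \<longlongrightarrow> T t (A x)) (at_right 0)"
  proof (rule Lim_transform_eventually[OF bounded_linear.tendsto[OF T_linear[OF assms(2)] A_tendsto[OF assms(1)]]])
    have "\<forall>\<^sub>F r in at_right 0. (r::real) \<ge> 0" by (simp add: eventually_at_filter)
    then show "\<forall>\<^sub>F r in at_right 0. T t ((T r x - x) /\<^sub>R r) = (T r (T t x) - T t x) /\<^sub>R r"
    proof eventually_elim
      case (elim r)
      have "T t (T r x) = T r (T t x)" using T_add[of t r x] T_add[of r t x] elim assms by (simp add: add.commute)
      then show ?case using assms by (simp add: T_scaleR T_diff)
    qed
  qed
  then show "T t x \<in> D" "A (T t x) = T t (A x)" using in_D_if_tendsto by auto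
qed

text \<open>
  The integrated semigroup smooths: it maps into the domain of \<open>A\<close>, and \<open>A (J h x) = T h x - x\<close>.
  It replaces resolvents in all density arguments.
\<close>

definition J :: "real \<Rightarrow> 'h \<Rightarrow> 'h" where "J h x = integral {0..h} (\<lambda>s. T s x)"

lemma T_integrable: "a \<ge> 0 \<Longrightarrow> (\<lambda>s. T s x) integrable_on {a..b}"
  by (intro integrable_continuous_interval continuous_on_subset[OF T_continuous]) auto

lemma T_J:
  assumes "t \<ge> 0" "h \<ge> 0"
  shows "T t (J h x) = integral {t..t+h} (\<lambda>s. T s x)" "T t (J h x) = J h (T t x)"
proof -
  have 1: "T t (J h x) = integral {0..h} (\<lambda>s. T t (T s x))"
    unfolding J_def
    using integral_linear[OF T_integrable[where a = 0 and b = h and x = x] T_linear[OF assms(1)]]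
    by (simp add: o_def)
  also have "\<dots> = integral {0..h} (\<lambda>s. T (s + t) x)"
  proof (rule integral_cong)
    show "T t (T s x) = T (s + t) x" if "s \<in> {0..h}" for s
      using T_add[of t s x] that assms by (simp add: add.commute)
  qed
  finally have 2: "T t (J h x) = integral {0..h} (\<lambda>s. T (s + t) x)" .
  also have "\<dots> = J h (T t x)"
    unfolding J_def by (rule integral_cong) (use T_add assms in simp)
  finally show "T t (J h x) = J h (T t x)" .
  have "((\<lambda>s. T s x) has_integral integral {t..t+h} (\<lambda>s. T s x)) {t..t+h}"
    by (rule integrable_integral[OF T_integrable[OF assms(1)]])
  then have "((\<lambda>s. T (s + t) x) has_integral integral {t..t+h} (\<lambda>s. T s x)) {0..h}"
    using has_integral_affinity[of "\<lambda>s. T s x" _ t "t + h" 1 t] by (simp add: image_diff_atLeastAtMost)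
  then show "T t (J h x) = integral {t..t+h} (\<lambda>s. T s x)" unfolding 2 by (rule integral_unique)
qed

lemma J_in_D:
  assumes h: "h \<ge> 0"
  shows "J h x \<in> D" "A (J h x) = T h x - x"
proof -
  have "((\<lambda>t. integral {0..t} (\<lambda>s. T s x) /\<^sub>R t) \<longlongrightarrow> x) (at_right 0)"
    using integral_tendsto_at_right[OF T_continuous[of x], of 0] by simp
  then have lim: "((\<lambda>t. integral {h..h+t} (\<lambda>s. T s x) /\<^sub>R t - integral {0..t} (\<lambda>s. T s x) /\<^sub>R t)
      \<longlongrightarrow> T h x - x) (at_right 0)"
    by (intro tendsto_diff integral_tendsto_at_right T_continuous h)
  have "\<forall>\<^sub>F t in at_right 0. integral {h..h+t} (\<lambda>s. T s x) /\<^sub>R t - integral {0..t} (\<lambda>s. T s x) /\<^sub>R t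
      = (T t (J h x) - J h x) /\<^sub>R t"
  proof -
    have "\<forall>\<^sub>F t in at_right 0. (t::real) \<ge> 0" by (simp add: eventually_at_filter)
    then show ?thesis
    proof eventually_elim
      case (elim t)
      have "integral {0..t} (\<lambda>s. T s x) + integral {t..t+h} (\<lambda>s. T s x) = integral {0..t+h} (\<lambda>s. T s x)"
        by (rule integral_combine_interval) (use elim h in \<open>auto intro: T_integrable\<close>)
      moreover have "integral {0..h} (\<lambda>s. T s x) + integral {h..h+t} (\<lambda>s. T s x) = integral {0..h+t} (\<lambda>s. T s x)"
        by (rule integral_combine_interval) (use elim h in \<open>auto intro: T_integrable\<close>)
      ultimately have "integral {h..h+t} (\<lambda>s. T s x) - integral {0..t} (\<lambda>s. T s x)
          = integral {t..t+h} (\<lambda>s. T s x) - integral {0..h} (\<lambda>s. T s x)"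
        by (simp add: algebra_simps)
      then show ?case using T_J(1)[OF elim h] by (simp add: J_def scaleR_diff_right[symmetric])
    qed
  qed
  then have "((\<lambda>t. (T t (J h x) - J h x) /\<^sub>R t) \<longlongrightarrow> T h x - x) (at_right 0)"
    by (rule Lim_transform_eventually[OF lim])
  then show "J h x \<in> D" "A (J h x) = T h x - x" using in_D_if_tendsto by auto
qed

lemma J_average: "((\<lambda>t. J t x /\<^sub>R t) \<longlongrightarrow> x) (at_right 0)"
  using integral_tendsto_at_right[OF T_continuous, of 0 x] by (simp add: J_def)

lemma D_dense: "closure D = UNIV"
proof -
  have "x \<in> closure D" for x
  proof (rule Lim_in_closed_set[OF closed_closure _ _ J_average[of x]])
    have "\<forall>\<^sub>F t in at_right 0. (t::real) \<ge> 0" by (simp add: eventually_at_filter)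
    then show "\<forall>\<^sub>F t in at_right 0. J t x /\<^sub>R t \<in> closure D"
    proof eventually_elim
      case (elim t)
      show ?case
        by (rule subsetD[OF closure_subset]) (rule subspace_scaleR[OF D_subspace J_in_D(1)[OF elim]])
    qed
  qed simp
  then show ?thesis by auto
qed

lemma J_bounded_linear: "h \<ge> 0 \<Longrightarrow> bounded_linear (J h)"
proof -
  assume h: "h \<ge> 0"
  obtain M where M: "M \<ge> 1" "\<And>t x. 0 \<le> t \<Longrightarrow> t \<le> h \<Longrightarrow> norm (T t x) \<le> M * norm x"
    using T_bound by metis
  show ?thesis
  proof
    show "J h (x + y) = J h x + J h y" for x y
    proof -
      have "J h (x + y) = integral {0..h} (\<lambda>s. T s x + T s y)"
        unfolding J_def by (rule integral_cong) (simp add: T_plus)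
      then show ?thesis by (simp add: J_def integral_add T_integrable)
    qed
    show "J h (r *\<^sub>R x) = r *\<^sub>R J h x" for r x
    proof -
      have "J h (r *\<^sub>R x) = integral {0..h} (\<lambda>s. r *\<^sub>R T s x)"
        unfolding J_def by (rule integral_cong) (simp add: T_scaleR)
      then show ?thesis by (simp add: J_def)
    qed
    have "norm (J h x) \<le> norm x * (M * h)" for x
    proof -
      have "norm (J h x) \<le> M * norm x * (h - 0)"
        unfolding J_def by (intro integral_bound continuous_on_subset[OF T_continuous]) (use M h in auto)
      then show ?thesis by (simp add: mult_ac)
    qed
    then show "\<exists>K. \<forall>x. norm (J h x) \<le> norm x * K" by blast
  qed
qed

text \<open>
  Also in the other order \<open>A\<close> composes with \<open>J h\<close> to a bounded operator. Hence the adjoint of \<open>J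
  h\<close> maps into the domain of \<open>A\<^sup>*\<close>.
\<close>

lemma J_A:
  assumes x: "x \<in> D" and h: "h \<ge> 0"
  shows "J h (A x) = T h x - x"
proof -
  interpret J: bounded_linear "J h" by (rule J_bounded_linear[OF h])
  have 1: "((\<lambda>t. J h ((T t x - x) /\<^sub>R t)) \<longlongrightarrow> J h (A x)) (at_right 0)"
    by (rule J.tendsto[OF A_tendsto[OF x]])
  have "\<forall>\<^sub>F t in at_right 0. J h ((T t x - x) /\<^sub>R t) = (T t (J h x) - J h x) /\<^sub>R t"
  proof -
    have "\<forall>\<^sub>F t in at_right 0. (t::real) \<ge> 0" by (simp add: eventually_at_filter)
    then show ?thesis by eventually_elim (simp add: J.scale J.diff T_J(2) h)
  qed
  then have "((\<lambda>t. (T t (J h x) - J h x) /\<^sub>R t) \<longlongrightarrow> J h (A x)) (at_right 0)"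
    by (rule Lim_transform_eventually[OF 1])
  then show ?thesis using in_D_if_tendsto(2) J_in_D(2)[OF h] by metis
qed

abbreviation V :: "'h set" where "V \<equiv> adj_dom ip D A"
abbreviation As :: "'h \<Rightarrow> 'h" where "As \<equiv> adj ip D A"
abbreviation Ts :: "real \<Rightarrow> 'h \<Rightarrow> 'h" where "Ts t \<equiv> adj ip UNIV (T t)"

lemma ip_As: "\<psi> \<in> V \<Longrightarrow> x \<in> D \<Longrightarrow> ip (As \<psi>) x = ip \<psi> (A x)"
  by (rule ip_adj[OF D_dense D_subspace A_add A_scl])

lemma As_eqI: "(\<And>x. x \<in> D \<Longrightarrow> ip y x = ip \<psi> (A x)) \<Longrightarrow> As \<psi> = y"
  by (rule adj_eqI[OF D_dense])

lemma in_V_if: "(\<And>x. x \<in> D \<Longrightarrow> ip \<psi> (A x) = ip y x) \<Longrightarrow> \<psi> \<in> V"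
proof -
  assume *: "\<And>x. x \<in> D \<Longrightarrow> ip \<psi> (A x) = ip y x"
  have "norm (ip \<psi> (A x)) \<le> (norm y + 1) * norm x" if "x \<in> D" for x
  proof -
    have "(norm y + 1) * norm x = norm y * norm x + norm x" by (simp add: algebra_simps)
    moreover have "norm (ip \<psi> (A x)) \<le> norm y * norm x"
      using *[OF that] cauchy_schwarz[of y x] by simp
    ultimately show ?thesis using norm_ge_zero[of x] by linarith
  qed
  moreover have "norm y + 1 > 0" by (simp add: add_nonneg_pos)
  ultimately show "\<psi> \<in> V" unfolding adj_dom_def by blast
qed

lemma ip_Ts: "t \<ge> 0 \<Longrightarrow> ip (Ts t \<psi>) x = ip \<psi> (T t x)"
  by (rule ip_adj_UNIV[OF T_linear T_scl])

lemma V_subspace: "subspace V"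
  and As_add: "\<psi> \<in> V \<Longrightarrow> \<eta> \<in> V \<Longrightarrow> As (\<psi> + \<eta>) = As \<psi> + As \<eta>"
  and As_scl: "\<psi> \<in> V \<Longrightarrow> As (c *\<^sub>K \<psi>) = c *\<^sub>K As \<psi>"
proof -
  have a: "ip (As \<psi> + As \<eta>) x = ip (\<psi> + \<eta>) (A x)" if "\<psi> \<in> V" "\<eta> \<in> V" "x \<in> D" for \<psi> \<eta> x
    using that by (simp add: ip_add_left ip_As)
  have s: "ip (c *\<^sub>K As \<psi>) x = ip (c *\<^sub>K \<psi>) (A x)" if "\<psi> \<in> V" "x \<in> D" for c \<psi> x
    using that by (simp add: ip_scl_left ip_As)
  have "0 \<in> V" by (rule in_V_if[of 0 0]) simp
  moreover have "\<psi> + \<eta> \<in> V" if "\<psi> \<in> V" "\<eta> \<in> V" for \<psi> \<eta>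
    by (rule in_V_if[OF a[symmetric]]) (use that in auto)
  moreover have "c *\<^sub>K \<psi> \<in> V" if "\<psi> \<in> V" for c \<psi>
    by (rule in_V_if[OF s[symmetric]]) (use that in auto)
  ultimately show "subspace V" unfolding subspace_def by blast
  show "\<psi> \<in> V \<Longrightarrow> \<eta> \<in> V \<Longrightarrow> As (\<psi> + \<eta>) = As \<psi> + As \<eta>" by (rule As_eqI) (rule a)
  show "\<psi> \<in> V \<Longrightarrow> As (c *\<^sub>K \<psi>) = c *\<^sub>K As \<psi>" by (rule As_eqI) (rule s)
qed

lemma Ts_in_V:
  assumes "\<psi> \<in> V" "t \<ge> 0"
  shows "Ts t \<psi> \<in> V" "As (Ts t \<psi>) = Ts t (As \<psi>)"
proof -
  have *: "ip (Ts t (As \<psi>)) x = ip (Ts t \<psi>) (A x)" if "x \<in> D" for x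
    using that assms T_in_D[OF that assms(2)] ip_As[OF assms(1), of "T t x"] by (simp add: ip_Ts)
  show "Ts t \<psi> \<in> V" by (rule in_V_if[OF *[symmetric]])
  show "As (Ts t \<psi>) = Ts t (As \<psi>)" by (rule As_eqI[OF *])
qed

text \<open>
  The vectors \<open>(J t)\<^sup>* \<psi>\<close> lie in \<open>V\<close>. A vector orthogonal to them has \<open>J t y = 0\<close> for all \<open>t\<close>, and
  the averages \<open>J t y / t\<close> tend to \<open>y\<close>.
\<close>

lemma V_separates:
  assumes "\<And>\<psi>. \<psi> \<in> V \<Longrightarrow> ip \<psi> y = 0"
  shows "y = 0"
proof -
  have "J t y = 0" if t: "t \<ge> 0" for t
  proof (rule ip_all_eqI)
    fix \<psi>
    have scl: "J t (c *\<^sub>K x) = c *\<^sub>K J t x" for c x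
    proof -
      have "J t (c *\<^sub>K x) = integral {0..t} (\<lambda>s. c *\<^sub>K T s x)"
        unfolding J_def by (rule integral_cong) (simp add: T_scl)
      then show ?thesis
        using integral_linear[OF T_integrable[where a = 0 and b = t and x = x] bounded_linear_scl[of c]]
        by (simp add: J_def o_def)
    qed
    define \<eta> where "\<eta> = adj ip UNIV (J t) \<psi>"
    have \<eta>: "ip \<eta> x = ip \<psi> (J t x)" for x
      unfolding \<eta>_def by (rule ip_adj_UNIV[OF J_bounded_linear[OF t] scl])
    have "\<eta> \<in> V"
      by (rule in_V_if[of _ "Ts t \<psi> - \<psi>"]) (simp add: \<eta> J_A t ip_diff ip_Ts)
    then show "ip \<psi> (J t y) = ip \<psi> 0" using assms[of \<eta>] \<eta>[of y] by simp
  qed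
  then have "((\<lambda>t. J t y /\<^sub>R t) \<longlongrightarrow> 0) (at_right 0)"
    by (intro Lim_transform_eventually[OF tendsto_const]) (auto simp: eventually_at_filter)
  then show ?thesis using tendsto_unique[OF _ J_average] by fastforce
qed

text \<open>
  The identity \<open>T t y - y = A (J t y)\<close> tested on \<open>\<psi>\<close>: orbits of arbitrary vectors are weak
  solutions of the homogeneous equation.
\<close>

lemma ip_T_eq_integral:
  assumes "\<psi> \<in> V" "t \<ge> 0"
  shows "ip \<psi> (T t y) = ip \<psi> y + integral {0..t} (\<lambda>s. ip (As \<psi>) (T s y))"
proof -
  have "ip \<psi> (T t y - y) = ip (As \<psi>) (J t y)"
    using ip_As[OF assms(1) J_in_D(1)[OF assms(2)]] J_in_D(2)[OF assms(2)] by simp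
  also have "\<dots> = integral {0..t} (\<lambda>s. ip (As \<psi>) (T s y))"
    unfolding J_def
    using integral_linear[OF T_integrable[where a = 0 and b = t and x = y] bounded_linear_ip[of "As \<psi>"]]
    by (simp add: o_def)
  finally show ?thesis by (simp add: ip_diff algebra_simps)
qed

text \<open>
  By the Riesz theorem some vector of norm at most \<open>C\<close> has the same products with \<open>V\<close> as \<open>y\<close>, and
  \<open>V\<close> separates.
\<close>

lemma norm_le_if_V:
  assumes "\<And>\<psi>. \<psi> \<in> V \<Longrightarrow> norm (ip \<psi> y) \<le> C * norm \<psi>" "C \<ge> 0"
  shows "norm y \<le> C"
proof -
  obtain z where z: "\<And>\<psi>. \<psi> \<in> V \<Longrightarrow> ip \<psi> z = ip \<psi> y" "norm z \<le> C"
    by (rule riesz_antilinear[OF V_subspace, of "\<lambda>\<psi>. ip \<psi> y" C])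
       (use assms in \<open>auto simp: ip_add_left ip_scl_left\<close>)
  have "z - y = 0" by (rule V_separates) (simp add: ip_diff z(1))
  then show ?thesis using z(2) by simp
qed

end


section \<open>Observations and admissible inputs\<close>

lemma split_epsilon:
  fixes \<epsilon> p q :: real
  assumes "\<epsilon> > 0" "p \<ge> 0" "q \<ge> 0"
  obtains e1 e2 where "e1 > 0" "e2 > 0" "p * e1 + q * e2 \<le> \<epsilon>"
proof
  have *: "p * (\<epsilon> / 2 / (p + 1)) \<le> \<epsilon> / 2" if "p \<ge> 0" for p
  proof -
    have "p * (\<epsilon> / 2 / (p + 1)) = \<epsilon> / 2 * (p / (p + 1))" by simp
    also have "\<dots> \<le> \<epsilon> / 2 * 1" using assms(1) that by (intro mult_left_mono) auto
    finally show ?thesis by simp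
  qed
  show "p * (\<epsilon> / 2 / (p + 1)) + q * (\<epsilon> / 2 / (q + 1)) \<le> \<epsilon>"
    using *[OF assms(2)] *[OF assms(3)] by linarith
qed (use assms in auto)

lemma norm_integral_le:
  fixes f :: "real \<Rightarrow> 'b::euclidean_space"
  assumes "f integrable_on {a..b}" "a \<le> b" "\<And>s. s \<in> {a..b} \<Longrightarrow> norm (f s) \<le> B" "0 \<le> B"
  shows "norm (integral {a..b} f) \<le> B * (b - a)"
  using has_integral_bound[OF assms(4), of f "integral {a..b} f" a b] assms
  by (auto simp: has_integral_integral)

lemma integral_shift_start:
  fixes f :: "real \<Rightarrow> 'b::euclidean_space"
  assumes "continuous_on {0..b - a} f" "a \<le> b"
  shows "integral {0..b - a} f = integral {a..b} (\<lambda>s. f (s - a))"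
proof -
  have "(f has_integral integral {0..b - a} f) {0..b - a}"
    by (intro integrable_integral integrable_continuous_interval assms)
  then have "((\<lambda>s. f (s - a)) has_integral integral {0..b - a} f) {a..b}"
    using has_integral_affinity[of f _ 0 "b - a" 1 "- a"] by (simp add: image_diff_atLeastAtMost)
  then show ?thesis by (simp add: integral_unique)
qed

lemma integral_reverse:
  fixes f :: "real \<Rightarrow> 'b::euclidean_space"
  assumes "continuous_on {0..b - a} f" "a \<le> b"
  shows "integral {a..b} (\<lambda>s. f (b - s)) = integral {0..b - a} f"
proof -
  have "(f has_integral integral {0..b - a} f) {0..b - a}"
    by (intro integrable_integral integrable_continuous_interval assms)
  moreover have "(\<lambda>x. b - x) ` {0..b - a} = {a..b}"
    using image_affinity_atLeastAtMost[of "-1" b 0 "b - a"] assms(2) by auto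
  ultimately have "((\<lambda>s. f (b - s)) has_integral integral {0..b - a} f) {a..b}"
    using has_integral_affinity[of f _ 0 "b - a" "-1" b] by simp
  then show ?thesis by (simp add: integral_unique)
qed

lemma loc_bounded_norm_sq: "loc_bounded v \<Longrightarrow> loc_bounded (\<lambda>s. (norm (v s))\<^sup>2)"
  unfolding loc_bounded_def
proof (intro conjI allI)
  fix N :: real
  assume "v \<in> borel_measurable lebesgue \<and> (\<forall>N. \<exists>K. \<forall>t\<in>{0..N}. norm (v t) \<le> K)"
  then obtain K where "\<forall>t\<in>{0..N}. norm (v t) \<le> K" by blast
  then show "\<exists>K. \<forall>t\<in>{0..N}. norm ((norm (v t))\<^sup>2) \<le> K"
    by (intro exI[of _ "K\<^sup>2"]) (auto intro: power_mono)
qed auto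

lemma interval_cauchy_schwarz:
  fixes v g :: "real \<Rightarrow> 'k::real_or_complex"
  assumes v: "loc_bounded v" and g: "continuous_on {a..b} g" and a: "0 \<le> a"
  shows "integral {a..b} (\<lambda>s. norm (v s * g s))
      \<le> sqrt (integral {a..b} (\<lambda>s. (norm (v s))\<^sup>2)) * sqrt (integral {a..b} (\<lambda>s. (norm (g s))\<^sup>2))"
    and "norm (integral {a..b} (\<lambda>s. v s * g s))
      \<le> sqrt (integral {a..b} (\<lambda>s. (norm (v s))\<^sup>2)) * sqrt (integral {a..b} (\<lambda>s. (norm (g s))\<^sup>2))"
proof -
  let ?M = "lebesgue_on {a..b}"
  have vm: "v \<in> borel_measurable ?M"
    using v by (simp add: loc_bounded_def measurable_restrict_space1)
  have gm: "g \<in> borel_measurable ?M"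
    by (rule continuous_imp_measurable_on_sets_lebesgue[OF g]) simp
  have v2: "integrable ?M (\<lambda>s. (norm (v s))\<^sup>2)"
    by (rule absolutely_integrable_imp_integrable[OF loc_bounded_integrable[OF loc_bounded_norm_sq[OF v] a]]) simp
  have g2: "integrable ?M (\<lambda>s. (norm (g s))\<^sup>2)"
    by (rule absolutely_integrable_imp_integrable[OF absolutely_integrable_continuous_real])
       (auto intro!: continuous_intros g)
  have vg: "(\<lambda>s. v s * g s) absolutely_integrable_on {a..b}"
    by (rule loc_bounded_times_continuous[OF v g a])
  have nvg: "integrable ?M (\<lambda>s. norm (v s * g s))"
    by (intro integrable_norm absolutely_integrable_imp_integrable[OF vg]) simp
  show 1: "integral {a..b} (\<lambda>s. norm (v s * g s))
      \<le> sqrt (integral {a..b} (\<lambda>s. (norm (v s))\<^sup>2)) * sqrt (integral {a..b} (\<lambda>s. (norm (g s))\<^sup>2))"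
    using integral_cauchy_schwarz(2)[OF vm gm v2 g2]
    by (simp only: lebesgue_integral_eq_integral[OF v2] lebesgue_integral_eq_integral[OF g2]
        lebesgue_integral_eq_integral[OF nvg] lmeasurable_interval(1) fmeasurableD)
  have "norm (integral {a..b} (\<lambda>s. v s * g s)) \<le> integral {a..b} (\<lambda>s. norm (v s * g s))"
    using vg by (intro integral_norm_bound_integral)
      (auto simp: absolutely_integrable_on_def)
  then show "norm (integral {a..b} (\<lambda>s. v s * g s))
      \<le> sqrt (integral {a..b} (\<lambda>s. (norm (v s))\<^sup>2)) * sqrt (integral {a..b} (\<lambda>s. (norm (g s))\<^sup>2))"
    using 1 by linarith
qed

lemma loc_bounded_combine:
  fixes v :: "real \<Rightarrow> 'k::real_or_complex"
  assumes "loc_bounded v" "continuous_on {a..b} g" "continuous_on {a..b} h" "0 \<le> a"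
  shows "(\<lambda>s. g s + v s * h s) integrable_on {a..b}"
  by (intro integrable_add integrable_continuous_interval assms
      loc_bounded_times_integrable[OF assms(1,3,4)])

text \<open>
  The vectors \<open>b1\<close> and \<open>b2\<close> encode the control operator \<open>B 1 = b1 + A b2\<close>, where \<open>A\<close> is extended
  to \<open>H\<close> with values in the dual of \<open>V\<close>.
\<close>

locale observed_semigroup = semigroup_generator scl ip D A T
  for scl :: "'k::real_or_complex \<Rightarrow> 'h::banach \<Rightarrow> 'h" (infixr \<open>*\<^sub>K\<close> 75) and ip :: "'h \<Rightarrow> 'h \<Rightarrow> 'k"
    and D :: "'h set" and A :: "'h \<Rightarrow> 'h" and T :: "real \<Rightarrow> 'h \<Rightarrow> 'h" +
  fixes b1 b2 :: 'h
begin

text \<open>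
  The functional \<open>B 1\<close> applied to \<open>T(r)\<^sup>* \<psi>\<close>, the conjugate of the observation \<open>B\<^sup>* T(r)\<^sup>* \<psi>\<close>.
  Written with \<open>T\<close> instead of \<open>T\<^sup>*\<close> it is visibly continuous in \<open>r\<close>.
\<close>

definition obs :: "'h \<Rightarrow> real \<Rightarrow> 'k" where
  "obs \<psi> r = ip \<psi> (T r b1) + ip (As \<psi>) (T r b2)"

lemma obs_continuous: "continuous_on {0..} (obs \<psi>)"
  unfolding obs_def by (intro continuous_on_add T_continuous_ip)

lemma obs_0: "obs \<psi> 0 = ip \<psi> b1 + ip (As \<psi>) b2"
  by (simp add: obs_def)

lemma obs_add: "\<psi> \<in> V \<Longrightarrow> \<eta> \<in> V \<Longrightarrow> obs (\<psi> + \<eta>) r = obs \<psi> r + obs \<eta> r"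
  by (simp add: obs_def As_add ip_add_left)

lemma obs_scl: "\<psi> \<in> V \<Longrightarrow> obs (c *\<^sub>K \<psi>) r = conjugate c * obs \<psi> r"
  by (simp add: obs_def As_scl ip_scl_left distrib_left)

lemma obs_Ts:
  assumes "\<psi> \<in> V" "r \<ge> 0" "s \<ge> 0"
  shows "obs (Ts r \<psi>) s = obs \<psi> (r + s)"
  using assms by (simp add: obs_def Ts_in_V ip_Ts T_add)

lemma obs_continuous_reverse: "t \<ge> b \<Longrightarrow> continuous_on {a..b} (\<lambda>s. obs \<psi> (t - s))"
  by (rule continuous_on_compose2[OF obs_continuous]) (auto intro!: continuous_intros)

lemma obs_uniformly_continuous:
  assumes "e > 0"
  obtains d where "d > 0" "\<And>r s. r \<in> {0..N} \<Longrightarrow> s \<in> {0..N} \<Longrightarrow> \<bar>r - s\<bar> < d \<Longrightarrow> norm (obs \<psi> r - obs \<psi> s) < e"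
proof -
  have "uniformly_continuous_on {0..N} (obs \<psi>)"
    by (intro compact_uniformly_continuous continuous_on_subset[OF obs_continuous]) auto
  then obtain d where "d > 0" "\<And>r s. r \<in> {0..N} \<Longrightarrow> s \<in> {0..N} \<Longrightarrow> dist s r < d \<Longrightarrow> dist (obs \<psi> s) (obs \<psi> r) < e"
    using assms unfolding uniformly_continuous_on_def by metis
  then show ?thesis by (intro that[of d]) (auto simp: dist_norm)
qed

lemma norm_Ts_le:
  assumes "t \<ge> 0" "\<And>x. norm (T t x) \<le> M * norm x" "M \<ge> 0"
  shows "norm (Ts t \<psi>) \<le> M * norm \<psi>"
proof (cases "Ts t \<psi> = 0")
  case False
  let ?y = "Ts t \<psi>"
  have "(norm ?y)\<^sup>2 = norm (ip \<psi> (T t ?y))"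
    using ip_eq_norm_sq[of ?y] ip_Ts[OF assms(1), of \<psi> ?y] by simp
  also have "\<dots> \<le> norm \<psi> * (M * norm ?y)"
    using cauchy_schwarz[of \<psi> "T t ?y"] mult_left_mono[OF assms(2)[of ?y], of "norm \<psi>"] by simp
  finally have "norm ?y * norm ?y \<le> (M * norm \<psi>) * norm ?y" by (simp add: power2_eq_square mult_ac)
  then show ?thesis using False by simp
qed (use assms(3) in simp)

lemma integral_T_shift:
  assumes "\<psi> \<in> V" "a \<le> b"
  shows "ip \<psi> (T (b - a) y) = ip \<psi> y + integral {a..b} (\<lambda>s. ip (As \<psi>) (T (s - a) y))"
proof -
  have "continuous_on {0..b - a} (\<lambda>s. ip (As \<psi>) (T s y))"
    by (rule continuous_on_subset[OF T_continuous_ip]) auto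
  from integral_shift_start[OF this assms(2)] show ?thesis
    using ip_T_eq_integral[OF assms(1), of "b - a" y] assms(2) by simp
qed

text \<open>
  The common estimate behind the two passages between weak and mild solutions below. Both compare
  the integrands of two integral equations over a short interval.
\<close>

lemma integrand_uniformly_continuous:
  assumes z: "continuous_on {0..t} z" and v: "loc_bounded v" and \<epsilon>: "\<epsilon> > 0"
  obtains \<delta> where "\<delta> > 0" "\<And>r r' s s' q q' c. {r, r', s, s', q, q', c} \<subseteq> {0..t} \<Longrightarrow>
      \<bar>r - r'\<bar> < \<delta> \<Longrightarrow> \<bar>s - s'\<bar> < \<delta> \<Longrightarrow> \<bar>q - q'\<bar> < \<delta> \<Longrightarrow>
      norm (ip (As \<psi>) (T r (z s) - T r' (z s')) + v c * (obs \<psi> q - obs \<psi> q')) \<le> \<epsilon>"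
proof -
  obtain K where K: "K \<ge> 0" "\<And>s. 0 \<le> s \<Longrightarrow> s \<le> t \<Longrightarrow> norm (v s) \<le> K" using loc_boundedE[OF v] by metis
  obtain \<epsilon>1 \<epsilon>2 where e12: "\<epsilon>1 > 0" "\<epsilon>2 > 0" and sum_le: "norm (As \<psi>) * \<epsilon>1 + K * \<epsilon>2 \<le> \<epsilon>"
    using split_epsilon[OF \<epsilon> norm_ge_zero K(1)] by metis
  obtain d1 where d1: "d1 > 0" "\<And>r r' s s'. r \<in> {0..t} \<Longrightarrow> r' \<in> {0..t} \<Longrightarrow> s \<in> {0..t} \<Longrightarrow> s' \<in> {0..t}
      \<Longrightarrow> \<bar>r - r'\<bar> < d1 \<Longrightarrow> \<bar>s - s'\<bar> < d1 \<Longrightarrow> norm (T r (z s) - T r' (z s')) < \<epsilon>1"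
    using T_uniformly_continuous[OF z e12(1)] by auto
  obtain d2 where d2: "d2 > 0" "\<And>r s. r \<in> {0..t} \<Longrightarrow> s \<in> {0..t} \<Longrightarrow> \<bar>r - s\<bar> < d2 \<Longrightarrow> norm (obs \<psi> r - obs \<psi> s) < \<epsilon>2"
    using obs_uniformly_continuous[OF e12(2)] by metis
  show ?thesis
  proof (rule that[of "min d1 d2"])
    fix r r' s s' q q' c
    assume m: "{r, r', s, s', q, q', c} \<subseteq> {0..t}"
      and near: "\<bar>r - r'\<bar> < min d1 d2" "\<bar>s - s'\<bar> < min d1 d2" "\<bar>q - q'\<bar> < min d1 d2"
    have n1: "norm (T r (z s) - T r' (z s')) < \<epsilon>1" using d1(2)[of r r' s s'] m near by simp
    have n2: "norm (obs \<psi> q - obs \<psi> q') < \<epsilon>2" using d2(2)[of q q'] m near by simp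
    have n3: "norm (v c) \<le> K" using K(2)[of c] m by simp
    have "norm (ip (As \<psi>) (T r (z s) - T r' (z s')) + v c * (obs \<psi> q - obs \<psi> q'))
        \<le> norm (As \<psi>) * norm (T r (z s) - T r' (z s')) + norm (v c) * norm (obs \<psi> q - obs \<psi> q')"
      by (intro order_trans[OF norm_triangle_ineq] add_mono cauchy_schwarz) (simp add: norm_mult)
    also have "\<dots> \<le> norm (As \<psi>) * \<epsilon>1 + K * \<epsilon>2"
      by (rule add_mono[OF mult_left_mono[OF less_imp_le[OF n1] norm_ge_zero]
          mult_mono[OF n3 less_imp_le[OF n2] K(1) norm_ge_zero]])
    finally show "norm (ip (As \<psi>) (T r (z s) - T r' (z s')) + v c * (obs \<psi> q - obs \<psi> q')) \<le> \<epsilon>"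
      using sum_le by linarith
  qed (use d1(1) d2(1) in simp)
qed

text \<open>
  The function \<open>s \<mapsto> \<langle>\<psi>, T (t - s) (z s)\<rangle> - \<integral>\<^sub>0\<^sup>s v r \<cdot> obs \<psi> (t - r)\<close> is constant. Over a short
  interval \<open>[a, b]\<close> its increment is obtained by moving \<open>T (t - b)\<close> to \<open>\<psi>\<close> and comparing the weak
  equation for \<open>z\<close> with the one for the free motion from \<open>z a\<close>; the integrands then differ by
  little.
\<close>

lemma weak_solution_variation_of_constants:
  assumes z: "continuous_on {0..} z" and v: "loc_bounded v"
    and weak: "\<And>\<psi> t. \<psi> \<in> V \<Longrightarrow> t \<ge> 0 \<Longrightarrow>
      ip \<psi> (z t) = ip \<psi> (z 0) + integral {0..t} (\<lambda>s. ip (As \<psi>) (z s) + v s * obs \<psi> 0)"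
    and \<psi>: "\<psi> \<in> V" and t: "t \<ge> 0"
  shows "ip \<psi> (z t) = ip \<psi> (T t (z 0)) + integral {0..t} (\<lambda>s. v s * obs \<psi> (t - s))"
proof -
  define e where "e s = ip \<psi> (T (t - s) (z s)) - integral {0..s} (\<lambda>r. v r * obs \<psi> (t - r))" for s
  have zc: "continuous_on {a..b} z" if "a \<ge> 0" for a b
    by (rule continuous_on_subset[OF z]) (use that in auto)
  have intw: "(\<lambda>s. ip \<eta> (z s) + v s * c) integrable_on {a..b}" if "a \<ge> 0" for a b \<eta> c
    by (intro loc_bounded_combine[OF v] bounded_linear.continuous_on[OF bounded_linear_ip] zc that continuous_on_const)
  have into: "(\<lambda>r. v r * obs \<psi> (t - r)) integrable_on {a..b}" if "0 \<le> a" "b \<le> t" for a b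
    by (rule loc_bounded_times_integrable[OF v obs_continuous_reverse[OF that(2)] that(1)])
  have weak2: "ip \<eta> (z b) - ip \<eta> (z a) = integral {a..b} (\<lambda>s. ip (As \<eta>) (z s) + v s * obs \<eta> 0)"
    if "\<eta> \<in> V" "0 \<le> a" "a \<le> b" for \<eta> a b
  proof -
    have "integral {0..a} (\<lambda>s. ip (As \<eta>) (z s) + v s * obs \<eta> 0) + integral {a..b} (\<lambda>s. ip (As \<eta>) (z s) + v s * obs \<eta> 0)
      = integral {0..b} (\<lambda>s. ip (As \<eta>) (z s) + v s * obs \<eta> 0)"
      by (rule integral_combine_interval) (use that intw in auto)
    moreover have "u + w = x \<Longrightarrow> p = q + u \<Longrightarrow> p' = q + x \<Longrightarrow> p' - p = w" for u w x p p' q :: 'k by auto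
    ultimately show ?thesis using weak[OF that(1), of a] weak[OF that(1), of b] that(2,3) order_trans by blast
  qed
  have "e t = e 0"
  proof (rule eq_start_if_increments_small[where N = t])
    fix \<epsilon> :: real assume \<epsilon>: "\<epsilon> > 0"
    obtain \<delta> where \<delta>: "\<delta> > 0" "\<And>r r' s s' q q' c. {r, r', s, s', q, q', c} \<subseteq> {0..t} \<Longrightarrow>
        \<bar>r - r'\<bar> < \<delta> \<Longrightarrow> \<bar>s - s'\<bar> < \<delta> \<Longrightarrow> \<bar>q - q'\<bar> < \<delta> \<Longrightarrow>
        norm (ip (As \<psi>) (T r (z s) - T r' (z s')) + v c * (obs \<psi> q - obs \<psi> q')) \<le> \<epsilon>"
      by (rule integrand_uniformly_continuous[OF zc[OF order_refl, of t] v \<epsilon>, of \<psi>]) blast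
    have "norm (e b - e a) \<le> \<epsilon> * (b - a)" if ab: "0 \<le> a" "a \<le> b" "b \<le> t" "b - a < \<delta>" for a b
    proof -
      \<comment> \<open>Both motions are tested on this vector of \<open>V\<close> from time \<open>a\<close> to time \<open>b\<close>.\<close>
      define P where "P = Ts (t - b) \<psi>"
      have P: "P \<in> V" "As P = Ts (t - b) (As \<psi>)" using Ts_in_V[OF \<psi>, of "t - b"] ab by (auto simp: P_def)
      have ipP: "ip P x = ip \<psi> (T (t - b) x)" for x using ip_Ts[of "t - b"] ab by (simp add: P_def)
      have ipAP: "ip (As P) x = ip (As \<psi>) (T (t - b) x)" for x using ip_Ts[of "t - b"] ab by (simp add: P(2))
      have obsP: "obs P 0 = obs \<psi> (t - b)" using obs_Ts[OF \<psi>, of "t - b" 0] ab by (simp add: P_def)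
      have 1: "ip \<psi> (T (t - b) (z b)) - ip P (z a) = integral {a..b} (\<lambda>s. ip (As P) (z s) + v s * obs \<psi> (t - b))"
        using weak2[OF P(1) ab(1,2)] by (simp add: ipP obsP)
      have "T (t - a) (z a) = T (t - b) (T (b - a) (z a))" using T_add[of "t - b" "b - a" "z a"] ab by simp
      then have 2: "ip \<psi> (T (t - a) (z a)) - ip P (z a) = integral {a..b} (\<lambda>s. ip (As P) (T (s - a) (z a)))"
        using integral_T_shift[OF P(1) ab(2), of "z a"] by (simp add: ipP)
      have 3: "integral {0..b} (\<lambda>r. v r * obs \<psi> (t - r)) - integral {0..a} (\<lambda>r. v r * obs \<psi> (t - r))
          = integral {a..b} (\<lambda>r. v r * obs \<psi> (t - r))"
        using integral_combine_interval[OF ab(1,2) into[of 0 b]] ab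
        by (simp add: algebra_simps)
      have i1: "(\<lambda>s. ip (As P) (z s) + v s * obs \<psi> (t - b)) integrable_on {a..b}" by (rule intw[OF ab(1)])
      have i2: "(\<lambda>s. ip (As P) (T (s - a) (z a))) integrable_on {a..b}"
        by (intro integrable_continuous_interval continuous_on_compose2[OF T_continuous_ip]) (auto intro!: continuous_intros)
      have i3: "(\<lambda>r. v r * obs \<psi> (t - r)) integrable_on {a..b}" by (rule into) (use ab in auto)
      let ?g = "\<lambda>s. ip (As P) (z s) + v s * obs \<psi> (t - b) - ip (As P) (T (s - a) (z a)) - v s * obs \<psi> (t - s)"
      have gi: "?g integrable_on {a..b}" by (intro integrable_diff i1 i2 i3)
      have "p1 - p = x \<Longrightarrow> p2 - p = y \<Longrightarrow> q1 - q2 = z \<Longrightarrow> p1 - q1 - (p2 - q2) = x - y - z"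
        for p p1 p2 q1 q2 x y z :: 'k by (auto simp: algebra_simps)
      from this[OF 1 2 3] have "e b - e a = integral {a..b} ?g"
        unfolding e_def integral_diff[OF integrable_diff[OF i1 i2] i3] integral_diff[OF i1 i2] .
      also have "norm \<dots> \<le> \<epsilon> * (b - a)"
      proof (rule norm_integral_le[OF gi ab(2)])
        fix s assume s: "s \<in> {a..b}"
        have near: "0 \<le> s - a" "s - a < \<delta>" "s - a \<le> b - a" "0 \<le> b - s" "b - s < \<delta>"
          using s ab by auto
        have "T (t - b) (T (s - a) (z a)) = T (t - b + (s - a)) (z a)"
          using T_add[of "t - b" "s - a" "z a"] s ab by simp
        then have "?g s = ip (As \<psi>) (T (t - b) (z s) - T (t - b + (s - a)) (z a)) + v s * (obs \<psi> (t - b) - obs \<psi> (t - s))"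
          by (simp add: ipAP ip_diff algebra_simps)
        moreover have "norm (ip (As \<psi>) (T (t - b) (z s) - T (t - b + (s - a)) (z a)) + v s * (obs \<psi> (t - b) - obs \<psi> (t - s))) \<le> \<epsilon>"
          by (rule \<delta>(2)) (use near ab s in simp_all)
        ultimately show "norm (?g s) \<le> \<epsilon>" by (simp only:)
      qed (use \<epsilon> in simp)
      finally show ?thesis .
    qed
    then show "\<exists>\<delta>>0. \<forall>a b. 0 \<le> a \<longrightarrow> a \<le> b \<longrightarrow> b \<le> t \<longrightarrow> b - a < \<delta> \<longrightarrow> norm (e b - e a) \<le> \<epsilon> * (b - a)"
      using \<delta>(1) by blast
  qed (use t in auto)
  then show ?thesis by (simp add: e_def algebra_simps)
qed

text \<open>
  Variation of constants tested on \<open>V\<close>. Imposing it between any two times, not only from zero,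
  builds in that trajectories can be restarted.
\<close>

definition mild :: "(real \<Rightarrow> 'k) \<Rightarrow> (real \<Rightarrow> 'h) \<Rightarrow> bool" where
  "mild v z \<longleftrightarrow> (\<forall>a b \<psi>. 0 \<le> a \<longrightarrow> a \<le> b \<longrightarrow> \<psi> \<in> V \<longrightarrow>
    ip \<psi> (z b) = ip \<psi> (T (b - a) (z a)) + integral {a..b} (\<lambda>s. v s * obs \<psi> (b - s)))"

end

text \<open>
  Admissibility in its dual form, as an estimate of observations.
\<close>

locale admissible_observation = observed_semigroup scl ip D A T b1 b2
  for scl :: "'k::real_or_complex \<Rightarrow> 'h::banach \<Rightarrow> 'h" (infixr \<open>*\<^sub>K\<close> 75) and ip :: "'h \<Rightarrow> 'h \<Rightarrow> 'k"
    and D :: "'h set" and A :: "'h \<Rightarrow> 'h" and T :: "real \<Rightarrow> 'h \<Rightarrow> 'h" and b1 b2 :: 'h +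
  assumes admissible: "\<exists>t>0. \<exists>C. \<forall>\<psi>\<in>V. integral {0..t} (\<lambda>r. (norm (obs \<psi> r))\<^sup>2) \<le> C * (norm \<psi>)\<^sup>2"
begin

lemma obs_sq_integrable: "a \<ge> 0 \<Longrightarrow> (\<lambda>r. (norm (obs \<psi> r))\<^sup>2) integrable_on {a..b}"
  by (intro integrable_continuous_interval continuous_intros continuous_on_subset[OF obs_continuous]) auto

text \<open>
  Admissibility concerns one interval. Observing on the next one is observing \<open>T(t)\<^sup>* \<psi>\<close> on the
  first, so that finitely many intervals, with the bound on the semigroup, reach any time.
\<close>

lemma obs_L2_bound:
  obtains C where "C \<ge> 0" "\<And>\<psi> t. \<psi> \<in> V \<Longrightarrow> 0 \<le> t \<Longrightarrow> t \<le> N \<Longrightarrow>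
    sqrt (integral {0..t} (\<lambda>r. (norm (obs \<psi> r))\<^sup>2)) \<le> C * norm \<psi>"
proof -
  obtain t0 C0 where t0: "t0 > 0"
    and C0: "\<And>\<psi>. \<psi> \<in> V \<Longrightarrow> integral {0..t0} (\<lambda>r. (norm (obs \<psi> r))\<^sup>2) \<le> C0 * (norm \<psi>)\<^sup>2"
    using admissible by blast
  obtain n :: nat where n: "N \<le> real n * t0" using reals_Archimedean3[OF t0] less_imp_le by blast
  obtain M where M: "M \<ge> 1" "\<And>t x. 0 \<le> t \<Longrightarrow> t \<le> real n * t0 \<Longrightarrow> norm (T t x) \<le> M * norm x"
    using T_bound by metis
  define B where "B = \<bar>C0\<bar> * M\<^sup>2"
  have step: "integral {0..real k * t0} (\<lambda>r. (norm (obs \<psi> r))\<^sup>2) \<le> real k * (B * (norm \<psi>)\<^sup>2)"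
    if "k \<le> n" "\<psi> \<in> V" for k \<psi>
    using that(1)
  proof (induction k)
    case (Suc k)
    let ?a = "real k * t0" and ?b = "real (Suc k) * t0"
    have kt: "?a \<ge> 0" "?a \<le> real n * t0" "?a \<le> ?b" "?b - ?a = t0"
      using t0 Suc.prems by (auto simp: algebra_simps)
    have \<eta>: "Ts ?a \<psi> \<in> V" using Ts_in_V[OF that(2) kt(1)] by simp
    have "integral {?a..?b} (\<lambda>r. (norm (obs \<psi> r))\<^sup>2) = integral {?a..?b} (\<lambda>r. (norm (obs (Ts ?a \<psi>) (r - ?a)))\<^sup>2)"
      by (rule integral_cong) (use obs_Ts[OF that(2) kt(1)] in auto)
    also have "\<dots> = integral {0..?b - ?a} (\<lambda>r. (norm (obs (Ts ?a \<psi>) r))\<^sup>2)"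
      by (rule integral_shift_start[where f = "\<lambda>r. (norm (obs (Ts ?a \<psi>) r))\<^sup>2", symmetric])
         (use kt in \<open>auto intro!: continuous_intros continuous_on_subset[OF obs_continuous]\<close>)
    also have "\<dots> \<le> C0 * (norm (Ts ?a \<psi>))\<^sup>2" unfolding kt(4) by (rule C0[OF \<eta>])
    also have "\<dots> \<le> \<bar>C0\<bar> * (M * norm \<psi>)\<^sup>2"
      using norm_Ts_le[OF kt(1) M(2)[OF kt(1,2)], of \<psi>] M(1)
      by (intro mult_mono power_mono) auto
    also have "\<dots> = B * (norm \<psi>)\<^sup>2" by (simp add: B_def power_mult_distrib)
    finally have "integral {?a..?b} (\<lambda>r. (norm (obs \<psi> r))\<^sup>2) \<le> B * (norm \<psi>)\<^sup>2" .
    moreover have "integral {0..?a} (\<lambda>r. (norm (obs \<psi> r))\<^sup>2) + integral {?a..?b} (\<lambda>r. (norm (obs \<psi> r))\<^sup>2)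
        = integral {0..?b} (\<lambda>r. (norm (obs \<psi> r))\<^sup>2)"
      by (rule integral_combine_interval[OF kt(1,3)]) (rule obs_sq_integrable, simp)
    ultimately show ?case using Suc by (simp add: algebra_simps)
  qed simp
  have B: "B \<ge> 0" by (simp add: B_def)
  have "sqrt (integral {0..t} (\<lambda>r. (norm (obs \<psi> r))\<^sup>2)) \<le> sqrt (real n * B) * norm \<psi>"
    if "\<psi> \<in> V" "0 \<le> t" "t \<le> N" for \<psi> t
  proof -
    have "integral {0..t} (\<lambda>r. (norm (obs \<psi> r))\<^sup>2) \<le> integral {0..real n * t0} (\<lambda>r. (norm (obs \<psi> r))\<^sup>2)"
      using that n by (intro integral_subset_le obs_sq_integrable) auto
    also have "\<dots> \<le> real n * B * (norm \<psi>)\<^sup>2" using step[of n \<psi>] that by (simp add: mult.assoc)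
    finally have "sqrt (integral {0..t} (\<lambda>r. (norm (obs \<psi> r))\<^sup>2)) \<le> sqrt (real n * B * (norm \<psi>)\<^sup>2)"
      by (rule real_sqrt_le_mono)
    then show ?thesis by (simp add: real_sqrt_mult)
  qed
  then show ?thesis by (intro that[of "sqrt (real n * B)"]) (use B in auto)
qed

lemma input_integral_bound:
  assumes C: "\<And>\<psi> t. \<psi> \<in> V \<Longrightarrow> 0 \<le> t \<Longrightarrow> t \<le> N \<Longrightarrow>
      sqrt (integral {0..t} (\<lambda>r. (norm (obs \<psi> r))\<^sup>2)) \<le> C * norm \<psi>"
    and v: "loc_bounded v" and ab: "0 \<le> a" "a \<le> b" "b \<le> N" and \<psi>: "\<psi> \<in> V"
  shows "norm (integral {a..b} (\<lambda>s. v s * obs \<psi> (b - s)))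
    \<le> C * sqrt (integral {a..b} (\<lambda>s. (norm (v s))\<^sup>2)) * norm \<psi>"
proof -
  have "integral {a..b} (\<lambda>s. (norm (obs \<psi> (b - s)))\<^sup>2) = integral {0..b - a} (\<lambda>r. (norm (obs \<psi> r))\<^sup>2)"
    by (rule integral_reverse[OF _ ab(2)]) (auto intro!: continuous_intros continuous_on_subset[OF obs_continuous])
  then have 1: "sqrt (integral {a..b} (\<lambda>s. (norm (obs \<psi> (b - s)))\<^sup>2)) \<le> C * norm \<psi>"
    using C[OF \<psi>, of "b - a"] ab by simp
  have "norm (integral {a..b} (\<lambda>s. v s * obs \<psi> (b - s)))
    \<le> sqrt (integral {a..b} (\<lambda>s. (norm (v s))\<^sup>2)) * sqrt (integral {a..b} (\<lambda>s. (norm (obs \<psi> (b - s)))\<^sup>2))"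
    by (rule interval_cauchy_schwarz(2)[OF v obs_continuous_reverse ab(1)]) simp
  also have "\<dots> \<le> sqrt (integral {a..b} (\<lambda>s. (norm (v s))\<^sup>2)) * (C * norm \<psi>)"
    by (intro mult_left_mono 1) (simp add: integral_nonneg loc_bounded_integrable_on loc_bounded_norm_sq v ab)
  finally show ?thesis by (simp add: mult_ac)
qed

text \<open>
  The input integral is a conjugate linear functional of \<open>\<psi>\<close>, which the observation estimate
  bounds by the norm of \<open>\<psi>\<close>; its Riesz vector is the value at time \<open>t\<close> of the trajectory with zero
  initial state.
\<close>

lemma mild_exists:
  assumes v: "loc_bounded v"
  obtains z where "z 0 = z0" "mild v z"
proof -
  have into: "(\<lambda>r. v r * obs \<psi> (t - r)) integrable_on {a..b}" if "0 \<le> a" "b \<le> t" for a b t \<psi>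
    by (rule loc_bounded_times_integrable[OF v obs_continuous_reverse[OF that(2)] that(1)])
  have ex: "\<exists>x. \<forall>\<psi>\<in>V. ip \<psi> x = integral {0..t} (\<lambda>s. v s * obs \<psi> (t - s))" if t: "t \<ge> 0" for t
  proof -
    obtain C where C: "C \<ge> 0" "\<And>\<psi> s. \<psi> \<in> V \<Longrightarrow> 0 \<le> s \<Longrightarrow> s \<le> t \<Longrightarrow>
      sqrt (integral {0..s} (\<lambda>r. (norm (obs \<psi> r))\<^sup>2)) \<le> C * norm \<psi>" using obs_L2_bound by metis
    let ?n = "sqrt (integral {0..t} (\<lambda>s. (norm (v s))\<^sup>2))"
    have n0: "?n \<ge> 0"
      by (simp add: integral_nonneg loc_bounded_integrable_on loc_bounded_norm_sq v)
    show ?thesis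
    proof (rule riesz_antilinear[OF V_subspace, of "\<lambda>\<psi>. integral {0..t} (\<lambda>s. v s * obs \<psi> (t - s))" "C * ?n"])
      show "integral {0..t} (\<lambda>s. v s * obs (\<psi> + \<eta>) (t - s))
          = integral {0..t} (\<lambda>s. v s * obs \<psi> (t - s)) + integral {0..t} (\<lambda>s. v s * obs \<eta> (t - s))"
        if "\<psi> \<in> V" "\<eta> \<in> V" for \<psi> \<eta>
        using that by (simp add: obs_add distrib_left integral_add into)
      show "integral {0..t} (\<lambda>s. v s * obs (c *\<^sub>K \<psi>) (t - s)) = conjugate c * integral {0..t} (\<lambda>s. v s * obs \<psi> (t - s))"
        if "\<psi> \<in> V" for c \<psi>
        using that by (simp add: obs_scl mult.left_commute[of _ "conjugate c"])
      show "norm (integral {0..t} (\<lambda>s. v s * obs \<psi> (t - s))) \<le> C * ?n * norm \<psi>" if "\<psi> \<in> V" for \<psi>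
        by (rule input_integral_bound[OF C(2) v]) (use t that in auto)
    qed (use C(1) n0 in auto)
  qed
  then obtain x where x: "\<And>t \<psi>. t \<ge> 0 \<Longrightarrow> \<psi> \<in> V \<Longrightarrow> ip \<psi> (x t) = integral {0..t} (\<lambda>s. v s * obs \<psi> (t - s))"
    by metis
  have "x 0 = 0" by (rule V_separates) (simp add: x)
  moreover define z where "z t = T t z0 + x t" for t
  ultimately have "z 0 = z0" by simp
  moreover have "mild v z"
    unfolding mild_def
  proof (intro allI impI)
    fix a b :: real and \<psi> assume ab: "0 \<le> a" "a \<le> b" and \<psi>: "\<psi> \<in> V"
    have \<eta>: "Ts (b - a) \<psi> \<in> V" using Ts_in_V \<psi> ab by simp
    have "integral {0..a} (\<lambda>s. v s * obs (Ts (b - a) \<psi>) (a - s)) = integral {0..a} (\<lambda>s. v s * obs \<psi> (b - s))"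
      by (rule integral_cong) (use obs_Ts[OF \<psi>] ab in auto)
    then have "ip \<psi> (T (b - a) (x a)) = integral {0..a} (\<lambda>s. v s * obs \<psi> (b - s))"
      using x[OF ab(1) \<eta>] ip_Ts[of "b - a" \<psi> "x a"] ab by simp
    moreover have "integral {0..a} (\<lambda>s. v s * obs \<psi> (b - s)) + integral {a..b} (\<lambda>s. v s * obs \<psi> (b - s))
        = integral {0..b} (\<lambda>s. v s * obs \<psi> (b - s))"
      by (rule integral_combine_interval[OF ab]) (rule into, auto)
    moreover have "T (b - a) (T a z0) = T b z0" using T_add[of "b - a" a z0] ab by simp
    ultimately show "ip \<psi> (z b) = ip \<psi> (T (b - a) (z a)) + integral {a..b} (\<lambda>s. v s * obs \<psi> (b - s))"
      using ab x[of b \<psi>] \<psi> by (simp add: z_def T_plus ip_add)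
  qed
  ultimately show ?thesis using that by blast
qed

lemma mild_increment:
  assumes C: "C \<ge> 0" "\<And>\<psi> t. \<psi> \<in> V \<Longrightarrow> 0 \<le> t \<Longrightarrow> t \<le> N \<Longrightarrow>
      sqrt (integral {0..t} (\<lambda>r. (norm (obs \<psi> r))\<^sup>2)) \<le> C * norm \<psi>"
    and v: "loc_bounded v" and z: "mild v z" and ab: "0 \<le> a" "a \<le> b" "b \<le> N"
  shows "norm (z b - T (b - a) (z a)) \<le> C * sqrt (integral {a..b} (\<lambda>s. (norm (v s))\<^sup>2))"
proof (rule norm_le_if_V)
  fix \<psi> assume \<psi>: "\<psi> \<in> V"
  have "ip \<psi> (z b - T (b - a) (z a)) = integral {a..b} (\<lambda>s. v s * obs \<psi> (b - s))"
    using z ab \<psi> unfolding mild_def by (simp add: ip_diff)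
  then show "norm (ip \<psi> (z b - T (b - a) (z a))) \<le> C * sqrt (integral {a..b} (\<lambda>s. (norm (v s))\<^sup>2)) * norm \<psi>"
    using input_integral_bound[OF C(2) v ab \<psi>] by simp
qed (simp add: C(1) integral_nonneg loc_bounded_integrable_on loc_bounded_norm_sq v ab)

text \<open>
  Both \<open>z s\<close> and \<open>z t\<close> are compared with the free motion starting from \<open>z c\<close> at a time \<open>c\<close> at most
  \<open>\<eta>\<close> before \<open>t\<close>. This treats left and right limits alike, and only continuity of a single orbit
  is used.
\<close>

lemma mild_continuous:
  assumes v: "loc_bounded v" and z: "mild v z"
  shows "continuous_on {0..} z"
  unfolding continuous_on_iff
proof (intro ballI allI impI)
  fix t \<epsilon> :: real assume t: "t \<in> {0..}" and \<epsilon>: "\<epsilon> > 0"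
  obtain C where C: "C \<ge> 0" "\<And>\<psi> s. \<psi> \<in> V \<Longrightarrow> 0 \<le> s \<Longrightarrow> s \<le> t + 1 \<Longrightarrow>
    sqrt (integral {0..s} (\<lambda>r. (norm (obs \<psi> r))\<^sup>2)) \<le> C * norm \<psi>" using obs_L2_bound by metis
  obtain K where K: "K \<ge> 0" "\<And>s. 0 \<le> s \<Longrightarrow> s \<le> t + 1 \<Longrightarrow> norm (v s) \<le> K" using loc_boundedE[OF v] by metis
  \<comment> \<open>An interval of length \<open>2 \<eta>\<close> costs at most \<open>C \<cdot> K \<cdot> sqrt (2 \<eta>) < \<epsilon> / 3\<close>.\<close>
  define \<eta> where "\<eta> = min 1 ((\<epsilon> / (3 * (C * K + 1)))\<^sup>2 / 2)"
  have CK: "C * K + 1 > 0" using C(1) K(1) by (simp add: add_nonneg_pos)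
  have \<eta>: "\<eta> > 0" "\<eta> \<le> 1" "2 * \<eta> \<le> (\<epsilon> / (3 * (C * K + 1)))\<^sup>2" using \<epsilon> CK by (auto simp: \<eta>_def)
  have small: "norm (z s - T (s - a) (z a)) < \<epsilon> / 3" if "0 \<le> a" "a \<le> s" "s \<le> t + 1" "s - a \<le> 2 * \<eta>" for a s
  proof -
    have "integral {a..s} (\<lambda>s. (norm (v s))\<^sup>2) \<le> K\<^sup>2 * (s - a)"
      using norm_integral_le[OF loc_bounded_integrable_on[OF loc_bounded_norm_sq[OF v] that(1)] that(2), of "K\<^sup>2"]
        K that by (force intro: power_mono)
    also have "\<dots> \<le> K\<^sup>2 * (\<epsilon> / (3 * (C * K + 1)))\<^sup>2"
      using that \<eta>(3) by (intro mult_left_mono) auto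
    also have "\<dots> = (K * (\<epsilon> / (3 * (C * K + 1))))\<^sup>2" by (rule power_mult_distrib[symmetric])
    finally have "sqrt (integral {a..s} (\<lambda>s. (norm (v s))\<^sup>2)) \<le> K * (\<epsilon> / (3 * (C * K + 1)))"
      using K(1) \<epsilon> CK by (intro real_le_lsqrt) auto
    then have "C * sqrt (integral {a..s} (\<lambda>s. (norm (v s))\<^sup>2)) \<le> C * (K * (\<epsilon> / (3 * (C * K + 1))))"
      by (rule mult_left_mono[OF _ C(1)])
    also have "\<dots> < \<epsilon> / 3" using \<epsilon> CK by (simp add: field_simps)
    finally show ?thesis using mild_increment[OF C v z that(1-3)] by simp
  qed
  define c where "c = max 0 (t - \<eta>)"
  have c: "0 \<le> c" "c \<le> t" "t - c \<le> \<eta>" using t \<eta> by (auto simp: c_def)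
  obtain d where d: "d > 0" "\<And>r. r \<ge> 0 \<Longrightarrow> dist r (t - c) < d \<Longrightarrow> dist (T r (z c)) (T (t - c) (z c)) < \<epsilon> / 3"
    using T_continuous[of "z c"] c \<epsilon> unfolding continuous_on_iff
    by (metis atLeast_iff diff_ge_0_iff_ge divide_pos_pos zero_less_numeral)
  have "dist (z s) (z t) < \<epsilon>" if s: "s \<ge> 0" "dist s t < min \<eta> d" for s
  proof -
    have sc: "c \<le> s" "s \<le> t + 1" "s - c \<le> 2 * \<eta>" using s c \<eta> by (auto simp: c_def dist_real_def)
    have "norm (z s - z t) \<le> norm (z s - T (s - c) (z c)) + norm (T (s - c) (z c) - T (t - c) (z c))
        + norm (z t - T (t - c) (z c))"
      using norm_triangle_ineq4[of "z s - T (t - c) (z c)" "z t - T (t - c) (z c)"]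
        norm_triangle_ineq[of "z s - T (s - c) (z c)" "T (s - c) (z c) - T (t - c) (z c)"] by simp
    moreover have "norm (z s - T (s - c) (z c)) < \<epsilon> / 3" using small[of c s] sc c by simp
    moreover have "norm (z t - T (t - c) (z c)) < \<epsilon> / 3" using small[of c t] c \<eta> by simp
    moreover have "norm (T (s - c) (z c) - T (t - c) (z c)) < \<epsilon> / 3"
      using d(2)[of "s - c"] s sc by (simp add: dist_norm)
    ultimately show ?thesis by (simp add: dist_norm)
  qed
  then show "\<exists>d>0. \<forall>x'\<in>{0..}. dist x' t < d \<longrightarrow> dist (z x') (z t) < \<epsilon>"
    using \<eta>(1) d(1) by (intro exI[of _ "min \<eta> d"]) auto
qed

text \<open>
  The converse of \<open>weak_solution_variation_of_constants\<close>: on a short interval the trajectory stays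
  close to the free motion, and the observation close to its value at zero.
\<close>

lemma mild_weak_solution:
  assumes v: "loc_bounded v" and z: "mild v z" and \<psi>: "\<psi> \<in> V" and t: "t \<ge> 0"
  shows "ip \<psi> (z t) = ip \<psi> (z 0) + integral {0..t} (\<lambda>s. ip (As \<psi>) (z s) + v s * obs \<psi> 0)"
proof -
  define e where "e s = ip \<psi> (z s) - integral {0..s} (\<lambda>s. ip (As \<psi>) (z s) + v s * obs \<psi> 0)" for s
  have zc: "continuous_on {a..b} z" if "a \<ge> 0" for a b
    by (rule continuous_on_subset[OF mild_continuous[OF v z]]) (use that in auto)
  have intw: "(\<lambda>s. ip (As \<psi>) (z s) + v s * obs \<psi> 0) integrable_on {a..b}" if "a \<ge> 0" for a b
    by (intro loc_bounded_combine[OF v] bounded_linear.continuous_on[OF bounded_linear_ip] zc that continuous_on_const)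
  have "e t = e 0"
  proof (rule eq_start_if_increments_small[where N = t])
    fix \<epsilon> :: real assume \<epsilon>: "\<epsilon> > 0"
    obtain \<delta> where \<delta>: "\<delta> > 0" "\<And>r r' s s' q q' c. {r, r', s, s', q, q', c} \<subseteq> {0..t} \<Longrightarrow>
        \<bar>r - r'\<bar> < \<delta> \<Longrightarrow> \<bar>s - s'\<bar> < \<delta> \<Longrightarrow> \<bar>q - q'\<bar> < \<delta> \<Longrightarrow>
        norm (ip (As \<psi>) (T r (z s) - T r' (z s')) + v c * (obs \<psi> q - obs \<psi> q')) \<le> \<epsilon>"
      by (rule integrand_uniformly_continuous[OF zc[OF order_refl, of t] v \<epsilon>, of \<psi>]) blast
    have "norm (e b - e a) \<le> \<epsilon> * (b - a)" if ab: "0 \<le> a" "a \<le> b" "b \<le> t" "b - a < \<delta>" for a b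
    proof -
      have 1: "ip \<psi> (z b) = ip \<psi> (z a) + integral {a..b} (\<lambda>s. ip (As \<psi>) (T (s - a) (z a)))
          + integral {a..b} (\<lambda>s. v s * obs \<psi> (b - s))"
        using z ab(1,2) \<psi> unfolding mild_def integral_T_shift[OF \<psi> ab(2), symmetric] by blast
      have 2: "integral {0..b} (\<lambda>s. ip (As \<psi>) (z s) + v s * obs \<psi> 0) - integral {0..a} (\<lambda>s. ip (As \<psi>) (z s) + v s * obs \<psi> 0)
          = integral {a..b} (\<lambda>s. ip (As \<psi>) (z s) + v s * obs \<psi> 0)"
        using integral_combine_interval[OF ab(1,2) intw[of 0 b]]
        by (simp only: add_diff_cancel_left' order_refl eq_commute[of "_ + _"])
      have i1: "(\<lambda>s. ip (As \<psi>) (z s) + v s * obs \<psi> 0) integrable_on {a..b}" by (rule intw[OF ab(1)])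
      have i2: "(\<lambda>s. ip (As \<psi>) (T (s - a) (z a))) integrable_on {a..b}"
        by (intro integrable_continuous_interval continuous_on_compose2[OF T_continuous_ip]) (auto intro!: continuous_intros)
      have i3: "(\<lambda>r. v r * obs \<psi> (b - r)) integrable_on {a..b}"
        by (rule loc_bounded_times_integrable[OF v obs_continuous_reverse ab(1)]) simp
      let ?g = "\<lambda>s. ip (As \<psi>) (T (s - a) (z a)) + v s * obs \<psi> (b - s) - (ip (As \<psi>) (z s) + v s * obs \<psi> 0)"
      have gi: "?g integrable_on {a..b}" by (intro integrable_diff integrable_add i1 i2 i3)
      have "p1 = p2 + x + y \<Longrightarrow> q1 - q2 = z \<Longrightarrow> p1 - q1 - (p2 - q2) = x + y - z"
        for p1 p2 q1 q2 x y z :: 'k by (auto simp: algebra_simps)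
      from this[OF 1 2] have "e b - e a = integral {a..b} ?g"
        unfolding e_def integral_diff[OF integrable_add[OF i2 i3] i1] integral_add[OF i2 i3] .
      also have "norm \<dots> \<le> \<epsilon> * (b - a)"
      proof (rule norm_integral_le[OF gi ab(2)])
        fix s assume s: "s \<in> {a..b}"
        have near: "0 \<le> s - a" "s - a < \<delta>" "0 \<le> b - s" "b - s < \<delta>"
          using s ab by auto
        have "?g s = ip (As \<psi>) (T (s - a) (z a) - T 0 (z s)) + v s * (obs \<psi> (b - s) - obs \<psi> 0)"
          by (simp add: ip_diff algebra_simps)
        moreover have "norm (ip (As \<psi>) (T (s - a) (z a) - T 0 (z s)) + v s * (obs \<psi> (b - s) - obs \<psi> 0)) \<le> \<epsilon>"
          by (rule \<delta>(2)) (use near ab s in simp_all)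
        ultimately show "norm (?g s) \<le> \<epsilon>" by (simp only:)
      qed (use \<epsilon> in simp)
      finally show ?thesis .
    qed
    then show "\<exists>\<delta>>0. \<forall>a b. 0 \<le> a \<longrightarrow> a \<le> b \<longrightarrow> b \<le> t \<longrightarrow> b - a < \<delta> \<longrightarrow> norm (e b - e a) \<le> \<epsilon> * (b - a)"
      using \<delta>(1) by blast
  qed (use t in auto)
  then show ?thesis by (simp add: e_def algebra_simps)
qed

end


section \<open>The dual of the domain of the adjoint\<close>

context hilbert_space
begin

text \<open>
  Needed for the graph of the adjoint generator, a subspace of \<open>H \<times> H\<close>.
\<close>

lemma hilbert_space_product:
  "hilbert_space (\<lambda>c p. (c *\<^sub>K fst p, c *\<^sub>K snd p)) (\<lambda>p q. ip (fst p) (fst q) + ip (snd p) (snd q))"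
proof
  fix p q r :: "'h \<times> 'h" and a b :: 'k and s :: real
  show "(of_real s *\<^sub>K fst p, of_real s *\<^sub>K snd p) = s *\<^sub>R p"
    by (simp add: scl_of_real prod_eq_iff)
  have "of_real ((norm p)\<^sup>2) = (of_real ((norm (fst p))\<^sup>2) + of_real ((norm (snd p))\<^sup>2) :: 'k)"
    by (simp add: norm_prod_def)
  then show "ip (fst p) (fst p) + ip (snd p) (snd p) = of_real ((norm p)\<^sup>2)"
    by (simp add: ip_norm)
  show "ip (fst q) (fst p) + ip (snd q) (snd p) = conjugate (ip (fst p) (fst q) + ip (snd p) (snd q))"
    using ip_conjugate[of "fst q" "fst p"] ip_conjugate[of "snd q" "snd p"]
    by (simp add: conjugate_dist_add)
qed (auto simp: scale_right_distrib scale_left_distrib ip_add ip_scl algebra_simps)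

end

context semigroup_generator
begin

abbreviation N :: "'h \<Rightarrow> real" where "N \<equiv> graph_norm As"

lemma As_0 [simp]: "As 0 = 0"
  using As_scl[of 0 0] V_subspace by (simp add: subspace_0)

lemma norm_le_N: "norm \<psi> \<le> N \<psi>" "norm (As \<psi>) \<le> N \<psi>" "0 \<le> N \<psi>"
  by (simp_all add: graph_norm_def real_le_rsqrt)

text \<open>
  A functional that is bounded for the graph norm is a bounded functional on the graph, and the
  Riesz theorem in \<open>H \<times> H\<close> represents it by a pair of vectors.
\<close>

lemma graph_functional_representation:
  assumes f: "f \<in> antidual scl V N"
  obtains b1 b2 where "\<And>\<psi>. \<psi> \<in> V \<Longrightarrow> f \<psi> = ip \<psi> b1 + ip (As \<psi>) b2"
proof -
  interpret P: hilbert_space "\<lambda>c p. (c *\<^sub>K fst p, c *\<^sub>K snd p)"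
    "\<lambda>p q. ip (fst p) (fst q) + ip (snd p) (snd q)" by (rule hilbert_space_product)
  let ?G = "(\<lambda>\<psi>. (\<psi>, As \<psi>)) ` V"
  obtain C where C: "\<And>\<psi>. \<psi> \<in> V \<Longrightarrow> norm (f \<psi>) \<le> C * N \<psi>"
    and fa: "\<And>\<psi> \<eta>. \<psi> \<in> V \<Longrightarrow> \<eta> \<in> V \<Longrightarrow> f (\<psi> + \<eta>) = f \<psi> + f \<eta>"
    and fs: "\<And>c \<psi>. \<psi> \<in> V \<Longrightarrow> f (c *\<^sub>K \<psi>) = conjugate c * f \<psi>"
    using f unfolding antidual_def by blast
  have V: "0 \<in> V" "\<And>x y. x \<in> V \<Longrightarrow> y \<in> V \<Longrightarrow> x + y \<in> V" "\<And>c x. x \<in> V \<Longrightarrow> c *\<^sub>K x \<in> V"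
    using V_subspace by (auto simp: subspace_def)
  obtain y where y: "\<And>p. p \<in> ?G \<Longrightarrow> ip (fst p) (fst y) + ip (snd p) (snd y) = f (fst p)"
  proof (rule P.riesz_antilinear[of ?G "\<lambda>p. f (fst p)" "\<bar>C\<bar>"])
    show "P.subspace ?G"
      unfolding P.subspace_def
    proof (intro conjI ballI allI)
      show "0 \<in> ?G" using V(1) by (auto simp: zero_prod_def image_iff intro!: bexI[of _ 0])
      show "p + q \<in> ?G" if "p \<in> ?G" "q \<in> ?G" for p q
        using that V(2) As_add by (auto simp: image_iff)
      show "(c *\<^sub>K fst p, c *\<^sub>K snd p) \<in> ?G" if "p \<in> ?G" for c p
        using that V(3) As_scl by (auto simp: image_iff)
    qed
    show "norm (f (fst p)) \<le> \<bar>C\<bar> * norm p" if p: "p \<in> ?G" for p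
    proof -
      have "norm (f (fst p)) \<le> C * N (fst p)" using p C by auto
      also have "\<dots> \<le> \<bar>C\<bar> * N (fst p)" by (intro mult_right_mono norm_le_N) auto
      also have "N (fst p) = norm p" using p by (auto simp: graph_norm_def norm_prod_def)
      finally show ?thesis .
    qed
  qed (use fa fs in auto)
  show ?thesis by (rule that[of "fst y" "snd y"]) (use y in force)
qed

lemma dual_norm_le:
  assumes "\<And>\<psi>. \<psi> \<in> V \<Longrightarrow> norm (f \<psi>) \<le> K * N \<psi>" "K \<ge> 0"
  shows "dual_norm V N f \<le> K"
  unfolding dual_norm_def
proof (rule cSUP_least)
  show "{\<psi> \<in> V. N \<psi> \<le> 1} \<noteq> {}"
    using V_subspace by (auto simp: subspace_0 graph_norm_def intro!: exI[of _ 0])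
  show "norm (f \<psi>) \<le> K" if "\<psi> \<in> {\<psi> \<in> V. N \<psi> \<le> 1}" for \<psi>
    using that assms(1)[of \<psi>] mult_left_mono[of "N \<psi>" 1 K] assms(2) by auto
qed

lemma le_dual_norm:
  assumes "\<And>\<psi>. \<psi> \<in> V \<Longrightarrow> norm (f \<psi>) \<le> K * N \<psi>" "K \<ge> 0" "\<psi> \<in> V" "N \<psi> \<le> 1"
  shows "norm (f \<psi>) \<le> dual_norm V N f"
  unfolding dual_norm_def
proof (rule cSUP_upper)
  show "bdd_above ((\<lambda>\<psi>. norm (f \<psi>)) ` {\<psi> \<in> V. N \<psi> \<le> 1})"
  proof (rule bdd_aboveI2)
    show "norm (f \<psi>) \<le> K" if "\<psi> \<in> {\<psi> \<in> V. N \<psi> \<le> 1}" for \<psi>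
      using that assms(1)[of \<psi>] mult_left_mono[of "N \<psi>" 1 K] assms(2) by auto
  qed
qed (use assms in auto)

lemma dual_norm_nonneg:
  assumes "\<And>\<psi>. \<psi> \<in> V \<Longrightarrow> norm (f \<psi>) \<le> K * N \<psi>" "K \<ge> 0"
  shows "0 \<le> dual_norm V N f"
proof -
  have "norm (f 0) \<le> dual_norm V N f"
    by (rule le_dual_norm[OF assms]) (use V_subspace in \<open>auto simp: subspace_0 graph_norm_def\<close>)
  then show ?thesis using norm_ge_zero order_trans by blast
qed

text \<open>
  The norm is a supremum over real numbers, so boundedness of the functionals has to accompany
  every estimate; therefore the bounds are carried as explicit constants.
\<close>

lemma dual_norm_triangle:
  assumes "\<And>\<psi>. \<psi> \<in> V \<Longrightarrow> norm (f \<psi>) \<le> K * N \<psi>" "\<And>\<psi>. \<psi> \<in> V \<Longrightarrow> norm (g \<psi> - f \<psi>) \<le> K' * N \<psi>"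
    "K \<ge> 0" "K' \<ge> 0"
  shows "dual_norm V N g \<le> dual_norm V N f + K'"
  unfolding dual_norm_def[of _ _ g]
proof (rule cSUP_least)
  show "{\<psi> \<in> V. N \<psi> \<le> 1} \<noteq> {}"
    using V_subspace by (auto simp: subspace_0 graph_norm_def intro!: exI[of _ 0])
  fix \<psi> assume \<psi>: "\<psi> \<in> {\<psi> \<in> V. N \<psi> \<le> 1}"
  have "norm (g \<psi>) \<le> norm (f \<psi>) + norm (g \<psi> - f \<psi>)" by (rule norm_triangle_sub)
  also have "norm (f \<psi>) \<le> dual_norm V N f" using \<psi> by (intro le_dual_norm[OF assms(1,3)]) auto
  also have "norm (g \<psi> - f \<psi>) \<le> K'"
    using \<psi> assms(2)[of \<psi>] mult_left_mono[of "N \<psi>" 1 K'] assms(4) by auto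
  finally show "norm (g \<psi>) \<le> dual_norm V N f + K'" by simp
qed

lemma functional_bound:
  assumes k: "\<And>\<psi>. \<psi> \<in> V \<Longrightarrow> norm (k \<psi>) \<le> C * N \<psi>" and \<psi>: "\<psi> \<in> V"
  shows "norm (ip \<psi> x + ip (As \<psi>) y + c * k \<psi>) \<le> (norm x + norm y + C * norm c) * N \<psi>"
proof -
  have "norm (ip \<psi> x) \<le> norm x * N \<psi>"
    using cauchy_schwarz[of \<psi> x] mult_right_mono[OF norm_le_N(1)[of \<psi>], of "norm x"] by (simp add: mult.commute)
  moreover have "norm (ip (As \<psi>) y) \<le> norm y * N \<psi>"
    using cauchy_schwarz[of "As \<psi>" y] mult_right_mono[OF norm_le_N(2)[of \<psi>], of "norm y"] by (simp add: mult.commute)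
  moreover have "norm (c * k \<psi>) \<le> C * norm c * N \<psi>"
    using mult_left_mono[OF k[OF \<psi>], of "norm c"] by (simp add: norm_mult mult_ac)
  ultimately show ?thesis
    using norm_triangle_ineq[of "ip \<psi> x + ip (As \<psi>) y" "c * k \<psi>"] norm_triangle_ineq[of "ip \<psi> x" "ip (As \<psi>) y"]
    by (simp add: algebra_simps)
qed

text \<open>
  Bochner measurability has to be shown from simple functions with values in the dual. They arise
  by evaluating \<open>x\<close>, \<open>y\<close> at simple functions that tend to the identity of the time axis, and by
  replacing \<open>c\<close> with simple functions that tend to it; continuity of \<open>x\<close> and \<open>y\<close> gives convergence
  in the dual norm. The dual norm of \<open>g\<close> is then measurable as a limit of simple functions.
\<close>

lemma antidual_L2_locI:
  assumes x: "continuous_on {0..} x" and y: "continuous_on {0..} y" and c: "loc_bounded c"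
    and k: "k \<in> antidual scl V N"
    and g: "\<And>t \<psi>. t \<ge> 0 \<Longrightarrow> \<psi> \<in> V \<Longrightarrow> g t \<psi> = ip \<psi> (x t) + ip (As \<psi>) (y t) + c t * k \<psi>"
  shows "antidual_L2_loc scl V N g"
proof -
  obtain C0 where C0: "\<And>\<psi>. \<psi> \<in> V \<Longrightarrow> norm (k \<psi>) \<le> C0 * N \<psi>"
    and ka: "\<And>\<psi> \<eta>. \<psi> \<in> V \<Longrightarrow> \<eta> \<in> V \<Longrightarrow> k (\<psi> + \<eta>) = k \<psi> + k \<eta>"
    and ks: "\<And>a \<psi>. \<psi> \<in> V \<Longrightarrow> k (a *\<^sub>K \<psi>) = conjugate a * k \<psi>"
    using k unfolding antidual_def by blast
  define C where "C = \<bar>C0\<bar>"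
  have C: "C \<ge> 0" "\<And>\<psi>. \<psi> \<in> V \<Longrightarrow> norm (k \<psi>) \<le> C * N \<psi>"
    using C0 mult_right_mono[OF abs_ge_self[of C0] norm_le_N(3)] order_trans unfolding C_def by fastforce+
  define \<Phi> where "\<Phi> r a \<psi> = ip \<psi> (x r) + ip (As \<psi>) (y r) + a * k \<psi>" for r a \<psi>
  define K where "K r a = norm (x r) + norm (y r) + C * norm (a::'k)" for r a
  have K0: "K r a \<ge> 0" for r a using C(1) by (simp add: K_def)
  have \<Phi>K: "norm (\<Phi> r a \<psi>) \<le> K r a * N \<psi>" if "\<psi> \<in> V" for r a \<psi>
    unfolding \<Phi>_def K_def by (rule functional_bound[OF C(2) that])
  have Vc: "\<psi> + \<eta> \<in> V" "a *\<^sub>K \<psi> \<in> V" if "\<psi> \<in> V" "\<eta> \<in> V" for \<psi> \<eta> a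
    using that V_subspace by (auto simp: subspace_def)
  have \<Phi>_dual: "\<Phi> r a \<in> antidual scl V N" for r a
    unfolding antidual_def
  proof (intro CollectI conjI ballI allI)
    show "\<Phi> r a (\<psi> + \<eta>) = \<Phi> r a \<psi> + \<Phi> r a \<eta>" if "\<psi> \<in> V" "\<eta> \<in> V" for \<psi> \<eta>
      using that by (simp add: \<Phi>_def ip_add_left As_add ka algebra_simps)
    show "\<Phi> r a (b *\<^sub>K \<psi>) = conjugate b * \<Phi> r a \<psi>" if "\<psi> \<in> V" for b \<psi>
      using that by (simp add: \<Phi>_def ip_scl_left As_scl ks algebra_simps)
    show "\<exists>C. \<forall>\<psi>\<in>V. norm (\<Phi> r a \<psi>) \<le> C * N \<psi>" using \<Phi>K by blast
  qed
  have g\<Phi>: "g t \<psi> = \<Phi> t (c t) \<psi>" if "t \<ge> 0" "\<psi> \<in> V" for t \<psi>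
    using g that by (simp add: \<Phi>_def)
  have gK: "norm (g t \<psi>) \<le> K t (c t) * N \<psi>" if "t \<ge> 0" "\<psi> \<in> V" for t \<psi>
    using g\<Phi>[OF that] \<Phi>K[OF that(2)] by simp
  have g_dual: "g t \<in> antidual scl V N" if "t \<ge> 0" for t
    using \<Phi>_dual[of t "c t"] g\<Phi>[OF that] Vc unfolding antidual_def by auto
  obtain cn where cn: "\<And>n. simple_function lebesgue (cn n)" "\<And>t. (\<lambda>n. cn n t) \<longlonglongrightarrow> c t"
    using borel_measurable_implies_sequence_metric[of c lebesgue 0] c unfolding loc_bounded_def by auto
  have id: "(\<lambda>t::real. t) \<in> borel_measurable lebesgue" by (rule measurable_completion) simp
  obtain sn where sn: "\<And>n. simple_function lebesgue (sn n)" "\<And>t. (\<lambda>n. sn n t) \<longlonglongrightarrow> (t::real)"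
    using borel_measurable_implies_sequence_metric[OF id, of 0] by auto
  \<comment> \<open>The clamp keeps the approximating times in the half line, where \<open>x\<close> and \<open>y\<close> are
    continuous.\<close>
  define rn where "rn n t = max 0 (sn n t)" for n t
  define G where "G n t = \<Phi> (rn n t) (cn n t)" for n t
  have G_simple: "simple_function lebesgue (G n)" for n
    unfolding G_def rn_def by (rule simple_function_compose2[OF simple_function_compose1[OF sn(1)] cn(1)])
  define \<delta> where "\<delta> n t = norm (x t - x (rn n t)) + norm (y t - y (rn n t)) + C * norm (c t - cn n t)" for n t
  have \<delta>0: "\<delta> n t \<ge> 0" for n t using C(1) by (simp add: \<delta>_def)
  have \<delta>_le: "norm (g t \<psi> - G n t \<psi>) \<le> \<delta> n t * N \<psi>" if "t \<ge> 0" "\<psi> \<in> V" for n t \<psi>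
  proof -
    have "g t \<psi> - G n t \<psi> = ip \<psi> (x t - x (rn n t)) + ip (As \<psi>) (y t - y (rn n t)) + (c t - cn n t) * k \<psi>"
      unfolding g\<Phi>[OF that] G_def \<Phi>_def by (simp add: ip_diff algebra_simps)
    then show ?thesis using functional_bound[OF C(2) that(2)] unfolding \<delta>_def by simp
  qed
  have rn: "(\<lambda>n. rn n t) \<longlonglongrightarrow> t" "\<And>n. rn n t \<ge> 0" if "t \<ge> 0" for t
    unfolding rn_def using tendsto_max[OF tendsto_const[of 0] sn(2)[of t]] that by (simp_all add: max_def)
  have conv: "(\<lambda>n. u (rn n t)) \<longlonglongrightarrow> u t" if u: "continuous_on {0..} u" and t: "t \<ge> 0" for u :: "real \<Rightarrow> 'h" and t
    by (rule continuous_on_tendsto_compose[OF u rn(1)[OF t]]) (use t rn(2)[OF t] in auto)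
  have \<delta>_lim: "(\<lambda>n. \<delta> n t) \<longlonglongrightarrow> 0" if t: "t \<ge> 0" for t
    unfolding \<delta>_def by (rule tendsto_eq_intros conv[OF x t] conv[OF y t] cn(2) refl | simp)+
  have lim0: "(\<lambda>n. dual_norm V N (\<lambda>\<psi>. g t \<psi> - G n t \<psi>)) \<longlonglongrightarrow> 0" if t: "t \<ge> 0" for t
    by (rule tendsto_sandwich[OF _ _ tendsto_const \<delta>_lim[OF t]])
       (auto intro!: always_eventually dual_norm_nonneg dual_norm_le \<delta>_le t \<delta>0)
  have meas: "antidual_measurable scl V N g"
    unfolding antidual_measurable_def
    by (intro exI[of _ G] conjI allI G_simple AE_I2 impI lim0) (auto simp: G_def \<Phi>_dual)
  have limG: "(\<lambda>n. dual_norm V N (G n t)) \<longlonglongrightarrow> dual_norm V N (g t)" if t: "t \<ge> 0" for t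
  proof -
    have "dual_norm V N (g t) \<le> dual_norm V N (G n t) + \<delta> n t" for n
      by (rule dual_norm_triangle[where K = "K (rn n t) (cn n t)"]) (use \<Phi>K K0 \<delta>0 \<delta>_le t in \<open>auto simp: G_def\<close>)
    moreover have "dual_norm V N (G n t) \<le> dual_norm V N (g t) + \<delta> n t" for n
      by (rule dual_norm_triangle[where K = "K t (c t)"])
         (use gK K0 \<delta>0 \<delta>_le t in \<open>auto simp: norm_minus_commute[of "G _ _ _"]\<close>)
    ultimately have "\<bar>dual_norm V N (G n t) - dual_norm V N (g t)\<bar> \<le> \<delta> n t" for n
      by (simp add: abs_le_iff algebra_simps)
    then have "(\<lambda>n. dual_norm V N (G n t) - dual_norm V N (g t)) \<longlonglongrightarrow> 0"
      by (intro Lim_null_comparison[OF _ \<delta>_lim[OF t]]) auto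
    then show ?thesis by (rule LIM_zero_cancel)
  qed
  define q where "q t = indicator {0..} t * dual_norm V N (g t)" for t :: real
  have q_bounded: "loc_bounded q"
    unfolding loc_bounded_def
  proof (intro conjI allI)
    show "q \<in> borel_measurable lebesgue"
    proof (rule borel_measurable_LIMSEQ_real)
      show "(\<lambda>n. indicator {0..} t * dual_norm V N (G n t)) \<longlonglongrightarrow> q t" for t :: real
        unfolding q_def by (cases "t \<ge> 0") (auto intro: limG)
      show "(\<lambda>t. indicator {0..} t * dual_norm V N (G n t)) \<in> borel_measurable lebesgue" for n
        by (intro borel_measurable_times borel_measurable_indicator borel_measurable_simple_function
            simple_function_compose1[OF G_simple]) auto
    qed
    fix R :: real
    obtain Kc where Kc: "Kc \<ge> 0" "\<And>t. 0 \<le> t \<Longrightarrow> t \<le> R \<Longrightarrow> norm (c t) \<le> Kc" using loc_boundedE[OF c] by metis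
    have "bounded (x ` {0..R})" "bounded (y ` {0..R})"
      by (auto intro!: compact_imp_bounded compact_continuous_image continuous_on_subset[OF x] continuous_on_subset[OF y])
    then obtain Kx Ky where xy: "\<And>t. t \<in> {0..R} \<Longrightarrow> norm (x t) \<le> Kx" "\<And>t. t \<in> {0..R} \<Longrightarrow> norm (y t) \<le> Ky"
      unfolding bounded_iff by (metis imageI)
    have "norm (q t) \<le> Kx + Ky + C * Kc" if t: "t \<in> {0..R}" for t
    proof -
      have "dual_norm V N (g t) \<le> K t (c t)" "0 \<le> dual_norm V N (g t)"
        using t by (auto intro!: dual_norm_le gK K0 dual_norm_nonneg[OF gK])
      moreover have "K t (c t) \<le> Kx + Ky + C * Kc"
        unfolding K_def using xy[OF t] Kc(2)[of t] t C(1) by (intro add_mono mult_left_mono) auto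
      ultimately show ?thesis using t by (simp add: q_def)
    qed
    then show "\<exists>K. \<forall>t\<in>{0..R}. norm (q t) \<le> K" by blast
  qed
  have "set_integrable lebesgue {0..t} (\<lambda>s. (dual_norm V N (g s))\<^sup>2)" for t
  proof -
    have "set_integrable lebesgue {0..t} (\<lambda>s. (norm (q s))\<^sup>2)"
      by (rule loc_bounded_integrable[OF loc_bounded_norm_sq[OF q_bounded]]) simp
    then show ?thesis
      by (rule set_integrable_cong[THEN iffD1, rotated -1]) (auto simp: q_def)
  qed
  then show ?thesis unfolding antidual_L2_loc_def using g_dual meas by blast
qed

end


section \<open>Admissibility is stable under bounded feedback\<close>

lemma (in observed_semigroup) admissible_observationI:
  assumes "t > 0" "\<And>\<psi>. \<psi> \<in> V \<Longrightarrow> integral {0..t} (\<lambda>r. (norm (obs \<psi> r))\<^sup>2) \<le> C * (norm \<psi>)\<^sup>2"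
  shows "admissible_observation scl ip D A T b1 b2"
  by unfold_locales (use assms in blast)

text \<open>
  Let \<open>I\<close> be the square integral over \<open>[0, t1]\<close> of the observation of \<open>\<psi>\<close> under \<open>S\<close>. Drive the
  system with semigroup \<open>T\<close> from rest by the conjugate of this observation, run backwards in time.
  The resulting \<open>z\<close> also is a trajectory of the system with semigroup \<open>S\<close>, for the input
  diminished by \<open>\<langle>l, z\<rangle>\<close>, so that \<open>\<langle>\<psi>, z t1\<rangle>\<close> equals \<open>I\<close> minus the integral of \<open>\<langle>l, z\<rangle>\<close> times the
  observation. Admissibility for \<open>T\<close> gives \<open>\<parallel>z\<parallel> \<le> C \<cdot> sqrt I\<close>. Thus the left side is at most \<open>C
  \<parallel>\<psi>\<parallel> sqrt I\<close> and, if \<open>t1\<close> is small, the correction is at most \<open>I / 2\<close>; it follows that \<open>sqrt I \<le>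
  2 C \<parallel>\<psi>\<parallel>\<close>.
\<close>

theorem admissible_observation_feedback:
  fixes scl :: "'k::real_or_complex \<Rightarrow> 'h::banach \<Rightarrow> 'h" and ip :: "'h \<Rightarrow> 'h \<Rightarrow> 'k"
  assumes T: "admissible_observation scl ip D A T b1 b2"
    and S: "observed_semigroup scl ip D' A' S"
    and dom: "adj_dom ip D' A' = adj_dom ip D A"
    and obs0: "\<And>\<psi>. \<psi> \<in> adj_dom ip D A \<Longrightarrow>
      ip \<psi> c1 + ip (adj ip D' A' \<psi>) c2 = ip \<psi> b1 + ip (adj ip D A \<psi>) b2"
    and fb: "\<And>\<psi>. \<psi> \<in> adj_dom ip D A \<Longrightarrow>
      adj ip D' A' \<psi> = adj ip D A \<psi> + scl (conjugate (ip \<psi> b1 + ip (adj ip D A \<psi>) b2)) l"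
  shows "admissible_observation scl ip D' A' S c1 c2"
proof -
  interpret T: admissible_observation scl ip D A T b1 b2 by (rule T)
  interpret S: observed_semigroup scl ip D' A' S c1 c2 by (rule S)
  have o0: "S.obs \<psi> 0 = T.obs \<psi> 0" if "\<psi> \<in> T.V" for \<psi> using obs0[OF that] by (simp add: S.obs_0 T.obs_0)
  obtain C where C: "C \<ge> 0" "\<And>\<psi> t. \<psi> \<in> T.V \<Longrightarrow> 0 \<le> t \<Longrightarrow> t \<le> 1 \<Longrightarrow>
      sqrt (integral {0..t} (\<lambda>r. (norm (T.obs \<psi> r))\<^sup>2)) \<le> C * norm \<psi>" using T.obs_L2_bound by metis
  define a where "a = norm l * C"
  \<comment> \<open>The time is chosen such that \<open>a \<cdot> sqrt t1 \<le> 1 / 2\<close>, and at most \<open>1\<close> so that \<open>C\<close>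
    applies.\<close>
  define t1 where "t1 = 1 / (2 * a + 1)\<^sup>2"
  have a: "a \<ge> 0" using C(1) by (simp add: a_def)
  have t1: "t1 > 0" "t1 \<le> 1" using a by (simp_all add: t1_def add_nonneg_pos divide_le_eq_1 one_le_power)
  have "sqrt t1 = 1 / (2 * a + 1)" using a by (simp add: t1_def real_sqrt_divide)
  moreover have "a / (2 * a + 1) \<le> 1 / 2" using a by (subst pos_divide_le_eq) auto
  ultimately have half: "a * sqrt t1 \<le> 1 / 2" by simp
  have bound: "integral {0..t1} (\<lambda>r. (norm (S.obs \<psi> r))\<^sup>2) \<le> (2 * C)\<^sup>2 * (norm \<psi>)\<^sup>2" if \<psi>: "\<psi> \<in> S.V" for \<psi>
  proof -
    define o1 where "o1 s = S.obs \<psi> (t1 - s)" for s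
    define I where "I = integral {0..t1} (\<lambda>r. (norm (S.obs \<psi> r))\<^sup>2)"
    have o1c: "continuous_on {0..t1} o1" unfolding o1_def by (rule S.obs_continuous_reverse) simp
    have I: "I = integral {0..t1} (\<lambda>s. (norm (o1 s))\<^sup>2)"
      unfolding I_def o1_def
      using integral_reverse[of t1 0 "\<lambda>r. (norm (S.obs \<psi> r))\<^sup>2"] t1
        continuous_on_subset[OF S.obs_continuous, of "{0..t1}" \<psi>]
      by (simp add: continuous_on_power continuous_on_norm)
    have I0: "I \<ge> 0" unfolding I
      by (intro integral_nonneg integrable_continuous_interval continuous_intros o1c) auto
    \<comment> \<open>The clamp extends the input continuously to the whole line.\<close>
    define v where "v s = conjugate (S.obs \<psi> (t1 - min t1 (max 0 s)))" for s
    have "continuous_on UNIV v" unfolding v_def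
      by (intro bounded_linear.continuous_on[OF bounded_linear_conjugate] continuous_on_compose2[OF S.obs_continuous])
         (auto intro!: continuous_intros)
    then have vb: "loc_bounded v" by (rule loc_bounded_if_continuous)
    have vo: "v s = conjugate (o1 s)" if "s \<in> {0..t1}" for s using that by (simp add: v_def o1_def)
    obtain z where z: "z 0 = 0" "T.mild v z" using T.mild_exists[OF vb] by metis
    have zc: "continuous_on {0..} z" by (rule T.mild_continuous[OF vb z(2)])
    define w where "w s = ip l (z (max 0 s))" for s
    have "continuous_on UNIV w" unfolding w_def
      by (intro bounded_linear.continuous_on[OF T.bounded_linear_ip] continuous_on_compose2[OF zc])
         (auto intro!: continuous_intros)
    then have wb: "loc_bounded w" by (rule loc_bounded_if_continuous)
    \<comment> \<open>The input that produces the same trajectory in the system with feedback.\<close>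
    define h where "h s = v s - w s" for s
    have "continuous_on UNIV h" unfolding h_def
      by (intro continuous_on_diff) fact+
    then have hb: "loc_bounded h" by (rule loc_bounded_if_continuous)
    have weak: "ip \<eta> (z t) = ip \<eta> (z 0) + integral {0..t} (\<lambda>s. ip (S.As \<eta>) (z s) + h s * S.obs \<eta> 0)"
      if \<eta>: "\<eta> \<in> S.V" and t: "t \<ge> 0" for \<eta> t
    proof -
      have \<eta>': "\<eta> \<in> T.V" using \<eta> dom by simp
      have "integral {0..t} (\<lambda>s. ip (S.As \<eta>) (z s) + h s * S.obs \<eta> 0)
          = integral {0..t} (\<lambda>s. ip (T.As \<eta>) (z s) + v s * T.obs \<eta> 0)"
      proof (rule integral_cong)
        fix s assume "s \<in> {0..t}"
        then have "w s = ip l (z s)" by (simp add: w_def)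
        then show "ip (S.As \<eta>) (z s) + h s * S.obs \<eta> 0 = ip (T.As \<eta>) (z s) + v s * T.obs \<eta> 0"
          using fb[OF \<eta>'] o0[OF \<eta>']
          by (simp add: h_def T.obs_0 T.ip_add_left T.ip_scl_left algebra_simps)
      qed
      then show ?thesis using T.mild_weak_solution[OF vb z(2) \<eta>' t] by simp
    qed
    \<comment> \<open>Variation of constants for \<open>S\<close> reproduces the observation of \<open>\<psi>\<close> under the
      integral.\<close>
    have var: "ip \<psi> (z t1) = integral {0..t1} (\<lambda>s. h s * o1 s)"
      using S.weak_solution_variation_of_constants[OF zc hb weak \<psi>, of t1] t1 z(1)
        linear_0[OF bounded_linear.linear[OF S.T_linear[of t1]]] by (simp add: o1_def)
    have zb: "norm (z s) \<le> C * sqrt I" if s: "0 \<le> s" "s \<le> t1" for s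
    proof -
      have "integral {0..s} (\<lambda>s. (norm (v s))\<^sup>2) \<le> integral {0..t1} (\<lambda>s. (norm (v s))\<^sup>2)"
        using s by (intro integral_subset_le loc_bounded_integrable_on loc_bounded_norm_sq vb) auto
      also have "\<dots> = I" unfolding I by (rule integral_cong) (simp add: vo)
      finally have "C * sqrt (integral {0..s} (\<lambda>s. (norm (v s))\<^sup>2)) \<le> C * sqrt I"
        by (intro mult_left_mono C) simp
      moreover have "norm (z s - T (s - 0) (z 0)) \<le> C * sqrt (integral {0..s} (\<lambda>s. (norm (v s))\<^sup>2))"
        by (rule T.mild_increment[OF C vb z(2)]) (use s t1 in auto)
      ultimately show ?thesis using s z(1) linear_0[OF bounded_linear.linear[OF T.T_linear[of s]]] by simp
    qed
    have i1: "(\<lambda>s. v s * o1 s) integrable_on {0..t1}"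
      by (rule loc_bounded_times_integrable[OF vb o1c]) simp
    have i2: "(\<lambda>s. w s * o1 s) integrable_on {0..t1}"
      by (rule loc_bounded_times_integrable[OF wb o1c]) simp
    have "integral {0..t1} (\<lambda>s. v s * o1 s) = integral {0..t1} (\<lambda>s. (norm (o1 s))\<^sup>2 *\<^sub>R 1)"
      by (rule integral_cong) (simp add: vo T.conj_mult scaleR_conv_of_real)
    also have "\<dots> = I *\<^sub>R 1"
      unfolding I by (rule integral_unique[OF has_integral_scaleR_left[OF integrable_integral]])
        (intro integrable_continuous_interval continuous_intros o1c)
    finally have "I *\<^sub>R 1 = ip \<psi> (z t1) + integral {0..t1} (\<lambda>s. w s * o1 s)"
      unfolding var h_def left_diff_distrib integral_diff[OF i1 i2] by simp
    then have "I \<le> norm (ip \<psi> (z t1)) + norm (integral {0..t1} (\<lambda>s. w s * o1 s))"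
      using norm_triangle_ineq[of "ip \<psi> (z t1)" "integral {0..t1} (\<lambda>s. w s * o1 s)"] I0
      by (metis abs_of_nonneg mult.right_neutral norm_one norm_scaleR)
    moreover have "norm (ip \<psi> (z t1)) \<le> norm \<psi> * (C * sqrt I)"
      by (rule order_trans[OF T.cauchy_schwarz mult_left_mono[OF zb]]) (use t1 in auto)
    moreover have "norm (integral {0..t1} (\<lambda>s. w s * o1 s)) \<le> I / 2"
    proof -
      have wle: "norm (w s) \<le> a * sqrt I" if "s \<in> {0..t1}" for s
      proof -
        have "norm (w s) \<le> norm l * norm (z s)" using T.cauchy_schwarz[of l "z s"] that by (simp add: w_def)
        also have "\<dots> \<le> norm l * (C * sqrt I)" using that by (intro mult_left_mono zb) auto
        finally show ?thesis by (simp add: a_def mult.assoc)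
      qed
      have wsq: "(norm (w s))\<^sup>2 \<le> a\<^sup>2 * I" if "s \<in> {0..t1}" for s
        using power_mono[OF wle[OF that] norm_ge_zero, of 2] I0 by (simp add: power_mult_distrib)
      have "integral {0..t1} (\<lambda>s. (norm (w s))\<^sup>2) \<le> a\<^sup>2 * I * (t1 - 0)"
        using norm_integral_le[OF loc_bounded_integrable_on[OF loc_bounded_norm_sq[OF wb]], of 0 t1 "a\<^sup>2 * I"]
          wsq t1 I0 by auto
      then have "sqrt (integral {0..t1} (\<lambda>s. (norm (w s))\<^sup>2)) \<le> sqrt (a\<^sup>2 * I * t1)" by simp
      also have "\<dots> = a * sqrt t1 * sqrt I" using a by (simp add: real_sqrt_mult)
      also have "\<dots> \<le> 1 / 2 * sqrt I" using half I0 by (intro mult_right_mono) auto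
      finally have le: "sqrt (integral {0..t1} (\<lambda>s. (norm (w s))\<^sup>2)) \<le> 1 / 2 * sqrt I" .
      have "norm (integral {0..t1} (\<lambda>s. w s * o1 s)) \<le> sqrt (integral {0..t1} (\<lambda>s. (norm (w s))\<^sup>2)) * sqrt I"
        using interval_cauchy_schwarz(2)[OF wb o1c] unfolding I by simp
      also have "\<dots> \<le> 1 / 2 * sqrt I * sqrt I" by (intro mult_right_mono le) (simp add: I0)
      finally show ?thesis using I0 by simp
    qed
    ultimately have "sqrt I * sqrt I \<le> 2 * C * norm \<psi> * sqrt I" using I0 by (simp add: mult_ac)
    then have "sqrt I \<le> 2 * C * norm \<psi>"
    proof (cases "I = 0")
      case False
      then have "sqrt I > 0" using I0 by simp
      then show ?thesis using \<open>sqrt I * sqrt I \<le> 2 * C * norm \<psi> * sqrt I\<close> by (simp only: mult_le_cancel_right_pos)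
    qed (use C(1) in simp)
    then have "(sqrt I)\<^sup>2 \<le> (2 * C * norm \<psi>)\<^sup>2" by (rule power_mono) (simp add: I0)
    then show ?thesis using I0 unfolding I_def[symmetric] by (simp add: power_mult_distrib)
  qed
  show ?thesis by (rule S.admissible_observationI[OF t1(1) bound])
qed


section \<open>The closed loop\<close>

context feedback_system
begin

abbreviation AD :: "'h set" where "AD \<equiv> feedback_dom ip D A B DL L"
abbreviation AL :: "'h \<Rightarrow> 'h" where "AL \<equiv> feedback_op ip D A B L"

text \<open>
  \<open>G\<close> is the open loop with generator \<open>A\<close>, \<open>F\<close> the loop closed by \<open>L\<close>.
\<close>

sublocale G: semigroup_generator scl ip D A T
  by unfold_locales (rule A_generates)

sublocale F: semigroup_generator scl ip AD AL S
  by unfold_locales (rule AL_generates)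

lemma B_scale: "\<psi> \<in> G.V \<Longrightarrow> B u \<psi> = u * B 1 \<psi>"
  using B_control unfolding control_operator_def by (metis mult.right_neutral)

lemma B1_dual: "B 1 \<in> antidual scl G.V G.N"
  using B_control unfolding control_operator_def by blast

lemma control_adj_eq:
  assumes \<psi>: "\<psi> \<in> G.V"
  shows "control_adj B \<psi> = conjugate (B 1 \<psi>)"
  unfolding control_adj_def
proof (rule the_equality)
  have "conjugate (conjugate (B 1 \<psi>)) * u = B u \<psi>" for u
    using B_scale[OF \<psi>, of u] by (simp add: mult.commute)
  then show "\<forall>u. conjugate (conjugate (B 1 \<psi>)) * u = B u \<psi>" by blast
  show "b = conjugate (B 1 \<psi>)" if "\<forall>u. conjugate b * u = B u \<psi>" for b
    using that[rule_format, of 1] by (metis conjugate_id mult.right_neutral)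
qed

lemma ip_AL:
  assumes z: "z \<in> AD" and \<psi>: "\<psi> \<in> G.V"
  shows "ip \<psi> (AL z) = ip (G.As \<psi>) z + L z * B 1 \<psi>"
proof -
  obtain y where y: "\<forall>\<psi>\<in>G.V. ip \<psi> y = feedback_value ip D A B L z \<psi>"
    using z unfolding feedback_dom_def by blast
  have "AL z = y"
    unfolding feedback_op_def
  proof (rule the_equality)
    show "\<forall>\<psi>\<in>G.V. ip \<psi> y = feedback_value ip D A B L z \<psi>" by (rule y)
    fix y' assume y': "\<forall>\<psi>\<in>G.V. ip \<psi> y' = feedback_value ip D A B L z \<psi>"
    have "y' - y = 0" by (rule G.V_separates) (use y y' in \<open>simp add: ip_diff\<close>)
    then show "y' = y" by simp
  qed
  then show ?thesis using y \<psi> B_scale[OF \<psi>, of "L z"] by (simp add: feedback_value_def)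
qed

lemma \<phi>_in_V: "\<phi> \<in> G.V"
  using eigen_dom AL_adj_dom by blast

text \<open>
  If \<open>B 1 \<phi> = 0\<close>, then \<open>\<langle>\<phi>, A\<^sub>L x\<rangle> = \<langle>A\<^sup>*\<phi>, x\<rangle>\<close> on \<open>D(A\<^sub>L)\<close>, so \<open>\<phi>\<close> is also an eigenvector of
  \<open>A\<^sup>*\<close>. Its observation then satisfies a linear equation with initial value \<open>B 1 \<phi> = 0\<close>, hence
  vanishes for all times, and controllability yields the contradiction \<open>\<phi> = 0\<close>.
\<close>

lemma B_eigenvector_nonzero: "B 1 \<phi> \<noteq> 0"
proof
  assume B0: "B 1 \<phi> = 0"
  obtain b1 b2 where b: "\<And>\<psi>. \<psi> \<in> G.V \<Longrightarrow> B 1 \<psi> = ip \<psi> b1 + ip (G.As \<psi>) b2"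
    using G.graph_functional_representation[OF B1_dual] by metis
  interpret O: observed_semigroup scl ip D A T b1 b2 by unfold_locales
  have orth: "ip (G.As \<phi> - scl \<mu> \<phi>) x = 0" if "x \<in> AD" for x
    using F.ip_As[OF eigen_dom that] ip_AL[OF that \<phi>_in_V] by (simp add: eigen B0 ip_diff)
  have "G.As \<phi> - scl \<mu> \<phi> = 0" by (rule eq_0_if_orthogonal_dense[OF F.D_dense orth])
  then have As: "G.As \<phi> = scl \<mu> \<phi>" by simp
  have eq: "ip \<phi> (T t y) = ip \<phi> y + conjugate \<mu> * integral {0..t} (\<lambda>s. ip \<phi> (T s y))" if "t \<ge> 0" for t y
    using G.ip_T_eq_integral[OF \<phi>_in_V that, of y] by (simp add: As ip_scl_left)
  have obs_eq: "O.obs \<phi> t = conjugate \<mu> * integral {0..t} (O.obs \<phi>)" if t: "t \<ge> 0" for t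
  proof -
    have int: "(\<lambda>s. ip \<phi> (T s y)) integrable_on {0..t}" for y
      by (intro integrable_continuous_interval continuous_on_subset[OF G.T_continuous_ip]) auto
    have "integral {0..t} (O.obs \<phi>)
        = integral {0..t} (\<lambda>s. ip \<phi> (T s b1)) + conjugate \<mu> * integral {0..t} (\<lambda>s. ip \<phi> (T s b2))"
      unfolding O.obs_def[abs_def] As ip_scl_left
      by (subst integral_add) (auto intro!: int integrable_on_mult_right)
    moreover have "ip \<phi> b1 + conjugate \<mu> * ip \<phi> b2 = 0"
      using b[OF \<phi>_in_V] B0 by (simp add: As ip_scl_left)
    moreover have "O.obs \<phi> t = ip \<phi> b1 + conjugate \<mu> * ip \<phi> b2
        + conjugate \<mu> * (integral {0..t} (\<lambda>s. ip \<phi> (T s b1)) + conjugate \<mu> * integral {0..t} (\<lambda>s. ip \<phi> (T s b2)))"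
      unfolding O.obs_def As ip_scl_left eq[OF t, of b1] eq[OF t, of b2] by (simp add: algebra_simps)
    ultimately show ?thesis by simp
  qed
  have obs0: "O.obs \<phi> t = 0" if "t \<ge> 0" for t
    by (rule linear_integral_equation_zero[OF O.obs_continuous obs_eq that])
  have "control_adj B (adj ip UNIV (T (\<tau> - t)) \<phi>) = 0" if t: "t \<in> {0..\<tau>}" for t
  proof -
    have V: "G.Ts (\<tau> - t) \<phi> \<in> G.V" using G.Ts_in_V[OF \<phi>_in_V] t by simp
    have "B 1 (G.Ts (\<tau> - t) \<phi>) = O.obs (G.Ts (\<tau> - t) \<phi>) 0" using b[OF V] by (simp add: O.obs_0)
    also have "\<dots> = O.obs \<phi> (\<tau> - t)" using O.obs_Ts[OF \<phi>_in_V, of "\<tau> - t" 0] t by simp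
    finally show ?thesis using control_adj_eq[OF V] obs0[of "\<tau> - t"] t by simp
  qed
  then have "\<phi> = 0" using controllable \<phi>_in_V unfolding approx_controllable_def by blast
  then show False using eigen_nonzero by simp
qed

text \<open>
  Evaluate \<open>\<langle>\<phi>, A\<^sub>L x\<rangle>\<close> in two ways: \<open>\<langle>\<mu> \<phi>, x\<rangle> = \<langle>A\<^sup>*\<phi>, x\<rangle> + L x \<cdot> B 1 \<phi>\<close>. Since the last factor
  is not zero, \<open>L x\<close> is the product of \<open>x\<close> with a fixed vector.
\<close>

lemma feedback_is_bounded:
  obtains l where "\<And>x. x \<in> AD \<Longrightarrow> L x = ip l x"
proof
  fix x assume x: "x \<in> AD"
  have "ip (scl \<mu> \<phi>) x = ip (G.As \<phi>) x + L x * B 1 \<phi>"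
    using F.ip_As[OF eigen_dom x] ip_AL[OF x \<phi>_in_V] by (simp add: eigen)
  then have "L x * B 1 \<phi> = ip (scl \<mu> \<phi> - G.As \<phi>) x" by (simp add: ip_diff)
  then show "L x = ip (scl (conjugate (1 / B 1 \<phi>)) (scl \<mu> \<phi> - G.As \<phi>)) x"
    using B_eigenvector_nonzero by (simp only: ip_scl_left conjugate_id) (simp add: field_simps)
qed

text \<open>
  As \<open>L\<close> is bounded, \<open>x \<mapsto> \<langle>\<psi>, A\<^sub>L x\<rangle>\<close> is bounded on \<open>D(A\<^sub>L)\<close> for every \<open>\<psi> \<in> D(A\<^sup>*)\<close>. With the
  assumed inclusion the two domains coincide.
\<close>

lemma feedback_adjoint:
  obtains l where "F.V = G.V" "\<And>\<psi>. \<psi> \<in> G.V \<Longrightarrow> F.As \<psi> = G.As \<psi> + scl (conjugate (B 1 \<psi>)) l"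
proof -
  obtain l where l: "\<And>x. x \<in> AD \<Longrightarrow> L x = ip l x" using feedback_is_bounded by metis
  have eq: "ip (G.As \<psi> + scl (conjugate (B 1 \<psi>)) l) x = ip \<psi> (AL x)" if "\<psi> \<in> G.V" "x \<in> AD" for \<psi> x
    using ip_AL[OF that(2,1)] l[OF that(2)] by (simp add: ip_add_left ip_scl_left mult.commute)
  have "\<psi> \<in> F.V" if "\<psi> \<in> G.V" for \<psi> by (rule F.in_V_if[OF eq[OF that, symmetric]])
  moreover have "F.As \<psi> = G.As \<psi> + scl (conjugate (B 1 \<psi>)) l" if "\<psi> \<in> G.V" for \<psi>
    by (rule F.As_eqI[OF eq[OF that]])
  ultimately show ?thesis using that AL_adj_dom by blast
qed

text \<open>
  For each \<open>u\<close>, admissibility represents \<open>\<psi> \<mapsto> \<integral> u \<cdot> obs \<psi>\<close> by a vector of \<open>H\<close>, so these integrals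
  are bounded over the unit sphere of \<open>V\<close>. Uniform boundedness makes the bound an \<open>L\<^sup>2\<close> estimate.
\<close>

lemma admissible_T:
  assumes b: "\<And>\<psi>. \<psi> \<in> G.V \<Longrightarrow> B 1 \<psi> = ip \<psi> b1 + ip (G.As \<psi>) b2"
  shows "admissible_observation scl ip D A T b1 b2"
proof -
  interpret O: observed_semigroup scl ip D A T b1 b2 by unfold_locales
  obtain t where t: "t > 0" and ex: "\<And>u. L2_loc u \<Longrightarrow> \<exists>x. \<forall>\<psi>\<in>G.V. ip \<psi> x = input_map ip T B u t \<psi>"
    using B_admissible unfolding admissible_def by blast
  let ?M = "lebesgue_on {0..t}"
  let ?I = "{\<psi> \<in> G.V. norm \<psi> = 1}"
  define Y where "Y \<psi> s = O.obs \<psi> (t - s)" for \<psi> s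
  have Yc: "continuous_on {0..t} (Y \<psi>)" for \<psi> unfolding Y_def by (rule O.obs_continuous_reverse) simp
  have Y2: "integrable ?M (\<lambda>s. (norm (Y \<psi> s))\<^sup>2)" for \<psi>
    by (rule absolutely_integrable_imp_integrable[OF absolutely_integrable_continuous_real])
       (auto intro!: continuous_intros Yc)
  have Yint: "(\<integral>s. (norm (Y \<psi> s))\<^sup>2 \<partial>?M) = integral {0..t} (\<lambda>r. (norm (O.obs \<psi> r))\<^sup>2)" for \<psi>
  proof -
    have "(\<integral>s. (norm (Y \<psi> s))\<^sup>2 \<partial>?M) = integral {0..t} (\<lambda>s. (norm (Y \<psi> s))\<^sup>2)"
      by (rule lebesgue_integral_eq_integral[OF Y2]) simp
    also have "\<dots> = integral {0..t} (\<lambda>r. (norm (O.obs \<psi> r))\<^sup>2)"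
      unfolding Y_def using integral_reverse[of t 0 "\<lambda>r. (norm (O.obs \<psi> r))\<^sup>2"] t
        continuous_on_subset[OF O.obs_continuous, of "{0..t}" \<psi>]
      by (simp add: continuous_on_power continuous_on_norm)
    finally show ?thesis .
  qed
  have bounded: "\<exists>C. \<forall>\<psi>\<in>?I. norm (\<integral>s. u s * Y \<psi> s \<partial>?M) \<le> C"
    if um: "u \<in> borel_measurable ?M" and u2: "integrable ?M (\<lambda>s. (norm (u s))\<^sup>2)" for u :: "real \<Rightarrow> 'k"
  proof -
    \<comment> \<open>Admissible inputs live on the half line; outside \<open>[0, t]\<close> the values are
      irrelevant.\<close>
    define u' where "u' s = indicator {0..t} s *\<^sub>R u s" for s
    have u'm: "u' \<in> borel_measurable lebesgue"
      using um unfolding u'_def by (subst (asm) borel_measurable_restrict_space_iff) auto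
    have "integrable lebesgue (\<lambda>s. indicator {0..t} s *\<^sub>R (norm (u s))\<^sup>2)"
      using u2 by (subst (asm) integrable_restrict_space) auto
    then have u'2: "integrable lebesgue (\<lambda>s. (norm (u' s))\<^sup>2)"
      by (rule Bochner_Integration.integrable_cong[THEN iffD1, rotated -1]) (auto simp: u'_def indicator_def)
    have "L2_loc u'"
      unfolding L2_loc_def set_borel_measurable_def set_integrable_def
      by (intro conjI allI impI integrable_mult_indicator u'2 borel_measurable_scaleR borel_measurable_indicator u'm) auto
    then obtain x where x: "\<And>\<psi>. \<psi> \<in> G.V \<Longrightarrow> ip \<psi> x = input_map ip T B u' t \<psi>" using ex by blast
    have "(\<integral>s. u s * Y \<psi> s \<partial>?M) = ip \<psi> x" if \<psi>: "\<psi> \<in> G.V" for \<psi>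
    proof -
      have "ip \<psi> x = (LINT s:{0..t}|lebesgue. B (u' s) (adj ip UNIV (T (t - s)) \<psi>))"
        using x[OF \<psi>] by (simp add: input_map_def)
      also have "\<dots> = (LINT s:{0..t}|lebesgue. u s * Y \<psi> s)"
      proof (rule set_lebesgue_integral_cong)
        show "\<forall>s. s \<in> {0..t} \<longrightarrow> B (u' s) (adj ip UNIV (T (t - s)) \<psi>) = u s * Y \<psi> s"
        proof (intro allI impI)
          fix s assume s: "s \<in> {0..t}"
          have V: "G.Ts (t - s) \<psi> \<in> G.V" using G.Ts_in_V[OF \<psi>] s by simp
          have "B (u' s) (G.Ts (t - s) \<psi>) = u s * O.obs (G.Ts (t - s) \<psi>) 0"
            using B_scale[OF V, of "u' s"] b[OF V] s by (simp add: u'_def O.obs_0)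
          then show "B (u' s) (adj ip UNIV (T (t - s)) \<psi>) = u s * Y \<psi> s"
            using O.obs_Ts[OF \<psi>, of "t - s" 0] s by (simp add: Y_def)
        qed
      qed simp
      also have "\<dots> = (\<integral>s. u s * Y \<psi> s \<partial>?M)"
        unfolding set_lebesgue_integral_def by (subst integral_restrict_space) auto
      finally show ?thesis by simp
    qed
    then have "norm (\<integral>s. u s * Y \<psi> s \<partial>?M) \<le> norm x" if "\<psi> \<in> ?I" for \<psi>
      using cauchy_schwarz[of \<psi> x] that by simp
    then show ?thesis by blast
  qed
  obtain C where C: "C \<ge> 0" "\<And>\<psi>. \<psi> \<in> ?I \<Longrightarrow> (\<integral>s. (norm (Y \<psi> s))\<^sup>2 \<partial>?M) \<le> C\<^sup>2"
  proof (rule L2_uniform_boundedness[of ?I Y ?M])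
    show "Y \<psi> \<in> borel_measurable ?M" for \<psi>
      by (rule continuous_imp_measurable_on_sets_lebesgue[OF Yc]) simp
  qed (use Y2 bounded in auto)
  have bound: "integral {0..t} (\<lambda>r. (norm (O.obs \<psi> r))\<^sup>2) \<le> C\<^sup>2 * (norm \<psi>)\<^sup>2" if \<psi>: "\<psi> \<in> G.V" for \<psi>
  proof (cases "\<psi> = 0")
    case True
    then show ?thesis by (simp add: O.obs_def)
  next
    case False
    define c where "c = (of_real (inverse (norm \<psi>)) :: 'k)"
    have nc: "norm c = inverse (norm \<psi>)" by (simp add: c_def norm_inverse)
    have "scl c \<psi> \<in> ?I"
      using \<psi> G.V_subspace False by (simp add: subspace_def norm_scl nc)
    then have "integral {0..t} (\<lambda>r. (norm (O.obs (scl c \<psi>) r))\<^sup>2) \<le> C\<^sup>2" using C(2) Yint by simp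
    moreover have "(\<lambda>r. (norm (O.obs (scl c \<psi>) r))\<^sup>2) = (\<lambda>r. (inverse (norm \<psi>))\<^sup>2 * (norm (O.obs \<psi> r))\<^sup>2)"
      using O.obs_scl[OF \<psi>] by (auto simp: norm_mult nc power_mult_distrib fun_eq_iff)
    ultimately have "(inverse (norm \<psi>))\<^sup>2 * integral {0..t} (\<lambda>r. (norm (O.obs \<psi> r))\<^sup>2) \<le> C\<^sup>2"
      by (simp only: integral_mult_right)
    then show ?thesis using False by (simp add: divide_simps power_inverse)
  qed
  show ?thesis by (rule O.admissible_observationI[OF t bound])
qed

text \<open>
  To apply the preceding results to \<open>S\<close>, the functional \<open>B 1\<close> has to be written with the adjoint
  \<open>F.As\<close> of the closed loop. Inserting \<open>A\<^sup>*\<psi> = A\<^sub>L\<^sup>*\<psi> - (B\<^sup>*\<psi>) l\<close> in its representation gives \<open>(1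
  + \<langle>l, b2\<rangle>) B 1 \<psi> = \<langle>\<psi>, b1\<rangle> + \<langle>A\<^sub>L\<^sup>*\<psi>, b2\<rangle>\<close>, so the factor on the left must not vanish. It does
  not if \<open>b2\<close> is small, and a vector \<open>\<eta> \<in> D\<close> can be moved from \<open>b2\<close> to \<open>b1\<close> at the price of adding
  \<open>A \<eta>\<close>.
\<close>

lemma closed_loop_representation:
  obtains c1 c2 l where "F.V = G.V"
    "\<And>\<psi>. \<psi> \<in> G.V \<Longrightarrow> F.As \<psi> = G.As \<psi> + scl (conjugate (B 1 \<psi>)) l"
    "\<And>\<psi>. \<psi> \<in> G.V \<Longrightarrow> B 1 \<psi> = ip \<psi> c1 + ip (F.As \<psi>) c2"
    "admissible_observation scl ip AD AL S c1 c2"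
proof -
  obtain l where V: "F.V = G.V" and l: "\<And>\<psi>. \<psi> \<in> G.V \<Longrightarrow> F.As \<psi> = G.As \<psi> + scl (conjugate (B 1 \<psi>)) l"
    using feedback_adjoint by metis
  obtain b1 b2 where b: "\<And>\<psi>. \<psi> \<in> G.V \<Longrightarrow> B 1 \<psi> = ip \<psi> b1 + ip (G.As \<psi>) b2"
    using G.graph_functional_representation[OF B1_dual] by metis
  have "b2 \<in> closure D" using A_dense by simp
  moreover have "1 / (norm l + 1) > 0" by (simp add: add_nonneg_pos)
  ultimately obtain \<eta> where \<eta>: "\<eta> \<in> D" "dist \<eta> b2 < 1 / (norm l + 1)"
    unfolding closure_approachable by blast
  define b1' where "b1' = b1 + A \<eta>"
  define b2' where "b2' = b2 - \<eta>"
  have b': "B 1 \<psi> = ip \<psi> b1' + ip (G.As \<psi>) b2'" if "\<psi> \<in> G.V" for \<psi>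
    using b[OF that] G.ip_As[OF that \<eta>(1)] by (simp add: b1'_def b2'_def ip_add ip_diff)
  define \<delta> where "\<delta> = 1 + ip l b2'"
  have "norm (ip l b2') < 1"
  proof -
    have "norm (ip l b2') \<le> norm l * norm b2'" by (rule cauchy_schwarz)
    also have "\<dots> \<le> norm l * (1 / (norm l + 1))"
      using \<eta>(2) by (intro mult_left_mono) (auto simp: b2'_def dist_norm norm_minus_commute)
    also have "\<dots> < 1" by (simp add: divide_simps add_nonneg_pos)
    finally show ?thesis .
  qed
  then have \<delta>: "\<delta> \<noteq> 0" unfolding \<delta>_def by (metis add_eq_0_iff norm_minus_cancel norm_one order_less_irrefl)
  define c1 where "c1 = scl (1 / \<delta>) b1'"
  define c2 where "c2 = scl (1 / \<delta>) b2'"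
  have c: "B 1 \<psi> = ip \<psi> c1 + ip (F.As \<psi>) c2" if \<psi>: "\<psi> \<in> G.V" for \<psi>
  proof -
    have "ip \<psi> c1 + ip (F.As \<psi>) c2 = 1 / \<delta> * (ip \<psi> b1' + ip (G.As \<psi>) b2' + B 1 \<psi> * ip l b2')"
      unfolding l[OF \<psi>] c1_def c2_def by (simp add: ip_scl ip_add_left ip_scl_left distrib_left)
    also have "\<dots> = 1 / \<delta> * (\<delta> * B 1 \<psi>)" unfolding b'[OF \<psi>, symmetric] by (simp add: \<delta>_def algebra_simps)
    finally show ?thesis using \<delta> by simp
  qed
  have "admissible_observation scl ip AD AL S c1 c2"
  proof (rule admissible_observation_feedback[OF admissible_T[OF b'] _ V])
    show "observed_semigroup scl ip AD AL S" by unfold_locales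
    show "ip \<psi> c1 + ip (F.As \<psi>) c2 = ip \<psi> b1' + ip (G.As \<psi>) b2'" if "\<psi> \<in> G.V" for \<psi>
      using b'[OF that] c[OF that] by simp
    show "F.As \<psi> = G.As \<psi> + scl (conjugate (ip \<psi> b1' + ip (G.As \<psi>) b2')) l" if "\<psi> \<in> G.V" for \<psi>
      using l[OF that] b'[OF that] by simp
  qed
  then show ?thesis using that V l c by blast
qed

text \<open>
  The trajectory provided by admissibility for \<open>S\<close> solves the open-loop equation \<open>z' = A z + B
  (\<langle>l, z\<rangle> + h)\<close> in the dual of \<open>D(A\<^sup>*)\<close>. This exhibits its derivative there as a sum of the form
  treated by \<open>antidual_L2_locI\<close>. Testing on \<open>\<phi>\<close> gives the scalar equation of the output.
\<close>

theorem closed_loop_trajectory: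
  assumes h: "loc_bounded h"
  obtains z where "mild_trajectory scl ip D A B DL L S z0 h z"
    "\<And>t. t \<ge> 0 \<Longrightarrow> ip \<phi> (z t) = ip \<phi> z0 + integral {0..t} (\<lambda>s. conjugate \<mu> * ip \<phi> (z s) + h s * B 1 \<phi>)"
proof -
  obtain c1 c2 l where V: "F.V = G.V"
    and l: "\<And>\<psi>. \<psi> \<in> G.V \<Longrightarrow> F.As \<psi> = G.As \<psi> + scl (conjugate (B 1 \<psi>)) l"
    and c: "\<And>\<psi>. \<psi> \<in> G.V \<Longrightarrow> B 1 \<psi> = ip \<psi> c1 + ip (F.As \<psi>) c2"
    and adm: "admissible_observation scl ip AD AL S c1 c2"
    using closed_loop_representation by metis
  interpret O: admissible_observation scl ip AD AL S c1 c2 by (rule adm)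
  have o0: "O.obs \<psi> 0 = B 1 \<psi>" if "\<psi> \<in> G.V" for \<psi> using c[OF that] by (simp add: O.obs_0)
  obtain z where z: "z 0 = z0" "O.mild h z" using O.mild_exists[OF h] by metis
  have zc: "continuous_on {0..} z" by (rule O.mild_continuous[OF h z(2)])
  define w where "w s = ip l (z (max 0 s))" for s
  have wc: "continuous_on UNIV w" unfolding w_def
    by (intro bounded_linear.continuous_on[OF bounded_linear_ip] continuous_on_compose2[OF zc])
       (auto intro!: continuous_intros)
  then have wb: "loc_bounded w" by (rule loc_bounded_if_continuous)
  have whb: "loc_bounded (\<lambda>s. w s + h s)" by (rule loc_bounded_add[OF wb h])
  define g where "g s \<psi> = ip (G.As \<psi>) (z s) + (w s + h s) * B 1 \<psi>" for s \<psi>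
  have weak: "ip \<psi> (z t) = ip \<psi> z0 + integral {0..t} (\<lambda>s. g s \<psi>)" if \<psi>: "\<psi> \<in> G.V" and t: "t \<ge> 0" for \<psi> t
  proof -
    have "integral {0..t} (\<lambda>s. ip (F.As \<psi>) (z s) + h s * O.obs \<psi> 0) = integral {0..t} (\<lambda>s. g s \<psi>)"
      by (rule integral_cong)
         (simp add: l[OF \<psi>] o0[OF \<psi>] g_def w_def ip_add_left ip_scl_left algebra_simps)
    then show ?thesis using O.mild_weak_solution[OF h z(2) _ t, of \<psi>] \<psi> V z(1) by simp
  qed
  have H1: "antidual_H1_loc scl G.V G.N (\<lambda>t \<psi>. ip \<psi> (z t))"
    unfolding antidual_H1_loc_def
  proof (intro conjI exI allI impI ballI)
    have z0: "loc_bounded (\<lambda>_::real. 0::'k)" by (rule loc_bounded_if_continuous) simp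
    show "antidual_L2_loc scl G.V G.N (\<lambda>t \<psi>. ip \<psi> (z t))"
      by (rule G.antidual_L2_locI[OF zc continuous_on_const[of _ 0] z0 B1_dual]) simp
    show "antidual_L2_loc scl G.V G.N g"
      by (rule G.antidual_L2_locI[OF continuous_on_const[of _ 0] zc whb B1_dual]) (simp add: g_def)
    fix t :: real and \<psi> assume t: "t \<ge> 0" and \<psi>: "\<psi> \<in> G.V"
    have "(\<lambda>s. ip (G.As \<psi>) (z s)) absolutely_integrable_on {0..t}"
      by (intro absolutely_integrable_continuous_real bounded_linear.continuous_on[OF bounded_linear_ip]
          continuous_on_subset[OF zc]) auto
    from set_integral_add(1)[OF this loc_bounded_times_continuous[OF whb continuous_on_const order_refl]]
    have "(\<lambda>s. g s \<psi>) absolutely_integrable_on {0..t}"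
      unfolding g_def .
    then have "(LINT s:{0..t}|lebesgue. g s \<psi>) = integral {0..t} (\<lambda>s. g s \<psi>)"
      by (rule set_lebesgue_integral_eq_integral(2))
    then show "ip \<psi> (z t) = ip \<psi> (z 0) + (LINT s:{0..t}|lebesgue. g s \<psi>)"
      using weak[OF \<psi> t] z(1) by simp
  qed
  have var: "ip \<psi> (z t) = ip \<psi> (S t z0) + input_map ip S B h t \<psi>" if t: "t \<ge> 0" and \<psi>: "\<psi> \<in> F.V" for t \<psi>
  proof -
    have "input_map ip S B h t \<psi> = (LINT s:{0..t}|lebesgue. h s * O.obs \<psi> (t - s))"
      unfolding input_map_def
    proof (rule set_lebesgue_integral_cong)
      show "\<forall>s. s \<in> {0..t} \<longrightarrow> B (h s) (adj ip UNIV (S (t - s)) \<psi>) = h s * O.obs \<psi> (t - s)"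
      proof (intro allI impI)
        fix s assume s: "s \<in> {0..t}"
        have "F.Ts (t - s) \<psi> \<in> G.V" using F.Ts_in_V[OF \<psi>] s V by simp
        then show "B (h s) (adj ip UNIV (S (t - s)) \<psi>) = h s * O.obs \<psi> (t - s)"
          using B_scale[of "F.Ts (t - s) \<psi>" "h s"] o0 O.obs_Ts[OF \<psi>, of "t - s" 0] s by simp
      qed
    qed simp
    also have "\<dots> = integral {0..t} (\<lambda>s. h s * O.obs \<psi> (t - s))"
      by (rule set_lebesgue_integral_eq_integral(2)[OF loc_bounded_times_continuous[OF h O.obs_continuous_reverse]]) auto
    finally show ?thesis
      using z(2)[unfolded O.mild_def, rule_format, OF order_refl t \<psi>] z(1) by simp
  qed
  have "mild_trajectory scl ip D A B DL L S z0 h z"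
    unfolding mild_trajectory_def using zc H1 var by blast
  moreover have "ip \<phi> (z t) = ip \<phi> z0 + integral {0..t} (\<lambda>s. conjugate \<mu> * ip \<phi> (z s) + h s * B 1 \<phi>)"
    if t: "t \<ge> 0" for t
    using O.mild_weak_solution[OF h z(2) eigen_dom t] z(1) o0[OF \<phi>_in_V] by (simp add: eigen ip_scl_left)
  ultimately show ?thesis using that by blast
qed

corollary closed_loop_with_output:
  assumes s: "continuous_on {0..} s" and h: "loc_bounded h"
    and s_eq: "\<And>t. t \<ge> 0 \<Longrightarrow> s t = ip \<phi> z0 + integral {0..t} (\<lambda>r. conjugate \<mu> * s r + h r * B 1 \<phi>)"
  obtains z where "mild_trajectory scl ip D A B DL L S z0 h z" "\<And>t. t \<ge> 0 \<Longrightarrow> ip \<phi> (z t) = s t"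
proof -
  obtain z where z: "mild_trajectory scl ip D A B DL L S z0 h z"
    and z_eq: "\<And>t. t \<ge> 0 \<Longrightarrow> ip \<phi> (z t) = ip \<phi> z0 + integral {0..t} (\<lambda>s. conjugate \<mu> * ip \<phi> (z s) + h s * B 1 \<phi>)"
    by (rule closed_loop_trajectory[OF h, where ?z0.0 = z0]) (assumption | rule that)+
  have zc: "continuous_on {0..} (\<lambda>r. ip \<phi> (z r))"
    using z by (intro bounded_linear.continuous_on[OF bounded_linear_ip]) (simp add: mild_trajectory_def)
  have diff_eq: "ip \<phi> (z r) - s r = conjugate \<mu> * integral {0..r} (\<lambda>r. ip \<phi> (z r) - s r)" if r: "r \<ge> 0" for r
  proof -
    have i: "(\<lambda>r. conjugate \<mu> * u r + h r * B 1 \<phi>) integrable_on {0..r}" if "continuous_on {0..} u" for u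
      by (intro loc_bounded_combine[OF h] continuous_intros continuous_on_subset[OF that]) auto
    have "ip \<phi> (z r) - s r
        = integral {0..r} (\<lambda>r. (conjugate \<mu> * ip \<phi> (z r) + h r * B 1 \<phi>) - (conjugate \<mu> * s r + h r * B 1 \<phi>))"
      unfolding integral_diff[OF i[OF zc] i[OF s]] using z_eq[OF r] s_eq[OF r] by simp
    also have "\<dots> = integral {0..r} (\<lambda>r. conjugate \<mu> * (ip \<phi> (z r) - s r))"
      by (rule integral_cong) (simp add: algebra_simps)
    finally show ?thesis by simp
  qed
  have "ip \<phi> (z t) - s t = 0" if "t \<ge> 0" for t
    by (rule linear_integral_equation_zero[OF continuous_on_diff[OF zc s] diff_eq that])
  then show ?thesis using that z by simp
qed

end


section \<open>Differential equations with a relay\<close>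

text \<open>
  The method of steps: since \<open>\<Psi> x t\<close> depends only on \<open>x\<close> up to \<open>t - \<delta>\<close>, the \<open>n\<close>-th iterate is
  exact up to time \<open>n \<delta>\<close>, and the solution is found there.
\<close>

lemma delay_fixpoint:
  fixes \<Psi> :: "(real \<Rightarrow> 'a::topological_space) \<Rightarrow> real \<Rightarrow> 'a"
  assumes \<delta>: "\<delta> > 0"
    and causal: "\<And>x y t. (\<And>s. s \<le> t - \<delta> \<Longrightarrow> x s = y s) \<Longrightarrow> \<Psi> x t = \<Psi> y t"
    and init: "\<And>x t. t \<le> 0 \<Longrightarrow> \<Psi> x t = x0"
    and cont: "\<And>x. continuous_on UNIV x \<Longrightarrow> continuous_on UNIV (\<Psi> x)"
  obtains x where "\<And>t. x t = \<Psi> x t" "continuous_on UNIV x"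
proof -
  define X where "X n = (\<Psi> ^^ n) (\<lambda>_. x0)" for n
  have X_Suc: "X (Suc n) = \<Psi> (X n)" for n by (simp add: X_def)
  have step: "X (Suc n) t = X n t" if "t \<le> real n * \<delta>" for n t
    using that
  proof (induction n arbitrary: t)
    case 0
    then show ?case by (simp add: X_def init)
  next
    case (Suc n)
    show ?case unfolding X_Suc[of "Suc n"] unfolding X_Suc[of n]
      by (rule causal) (use Suc in \<open>auto simp: X_Suc[symmetric] algebra_simps\<close>)
  qed
  have later: "X (n + m) t = X n t" if "t \<le> real n * \<delta>" for n m t
  proof (induction m)
    case (Suc m)
    have "t \<le> real (n + m) * \<delta>"
      using that \<delta> by (simp add: distrib_right add_increasing2)
    then show ?case using step[of t "n + m"] Suc by simp
  qed simp
  define x where "x t = X (nat \<lceil>t / \<delta>\<rceil>) t" for t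
  have x_eq: "x t = X n t" if t: "t \<le> real n * \<delta>" for n t
  proof -
    have "nat \<lceil>t / \<delta>\<rceil> \<le> n" using t \<delta> by (simp add: ceiling_le_iff divide_le_eq)
    moreover have "t \<le> real (nat \<lceil>t / \<delta>\<rceil>) * \<delta>"
      using \<delta> real_nat_ceiling_ge[of "t / \<delta>"] by (simp add: divide_le_eq)
    ultimately show ?thesis using later[of t "nat \<lceil>t / \<delta>\<rceil>" "n - nat \<lceil>t / \<delta>\<rceil>"] by (simp add: x_def)
  qed
  have ex_n: "\<exists>n::nat. t < real n * \<delta>" for t using reals_Archimedean3[OF \<delta>] by blast
  show ?thesis
  proof (rule that[of x])
    fix t
    obtain n where n: "t < real n * \<delta>" using ex_n by blast
    have "\<Psi> x t = \<Psi> (X n) t" by (rule causal) (use n \<delta> in \<open>auto intro!: x_eq\<close>)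
    also have "\<dots> = X (Suc n) t" by (simp add: X_Suc)
    also have "\<dots> = x t" using step[of t n] x_eq[of t n] n by simp
    finally show "x t = \<Psi> x t" by simp
  next
    have Xc: "continuous_on UNIV (X n)" for n
      by (induction n) (simp_all add: X_Suc cont, simp add: X_def)
    have "isCont x t" for t
    proof -
      obtain n where n: "t < real n * \<delta>" using ex_n by blast
      have "continuous_on {..<real n * \<delta>} x"
        by (rule continuous_on_eq[OF continuous_on_subset[OF Xc[of n] subset_UNIV]])
           (rule x_eq[symmetric], simp)
      then show ?thesis using n by (simp add: continuous_on_eq_continuous_at)
    qed
    then show "continuous_on UNIV x" by (simp add: continuous_on_eq_continuous_within)
  qed
qed

text \<open>
  Integrals over \<open>[0, a]\<close> with \<open>a < 0\<close> are zero, so the indefinite integral is constant on the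
  negative axis and the estimate holds on the whole line. This spares a separate treatment of
  delayed arguments.
\<close>

lemma indefinite_integral_increment:
  fixes u :: "real \<Rightarrow> 'k::real_or_complex"
  assumes u: "loc_bounded u" and K: "\<And>s. 0 \<le> s \<Longrightarrow> s \<le> N \<Longrightarrow> norm (u s) \<le> K" "K \<ge> 0"
    and ab: "a \<le> b" "b \<le> N"
  shows "norm (integral {0..b} u - integral {0..a} u) \<le> K * (b - a)"
proof (cases "b \<le> 0")
  case True
  then have "integral {0..b} u = 0" "integral {0..a} u = 0" using ab
    by (cases "b = 0"; cases "a = 0"; simp)+
  then show ?thesis using K(2) ab by simp
next
  case False
  define a' where "a' = max 0 a"
  have a': "0 \<le> a'" "a' \<le> b" "a \<le> a'" using False ab by (auto simp: a'_def)
  have ua: "integral {0..a} u = integral {0..a'} u" by (cases "a < 0") (auto simp: a'_def)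
  have int: "u integrable_on {c..b}" if "c \<ge> 0" for c
    by (rule loc_bounded_integrable_on[OF u that])
  have "integral {0..a'} u + integral {a'..b} u = integral {0..b} u"
    by (rule integral_combine_interval[OF a'(1,2) int]) simp
  then have "integral {0..b} u - integral {0..a} u = integral {a'..b} u"
    unfolding ua by (metis add_diff_cancel_left')
  also have "norm \<dots> \<le> K * (b - a')"
    by (rule norm_integral_le[OF int[OF a'(1)] a'(2)]) (use K a' ab in auto)
  also have "\<dots> \<le> K * (b - a)" using a' K(2) by (intro mult_left_mono) auto
  finally show ?thesis .
qed

lemma continuous_indefinite_integral:
  fixes u :: "real \<Rightarrow> 'k::real_or_complex"
  assumes u: "loc_bounded u"
  shows "continuous_on UNIV (\<lambda>t. integral {0..t} u)"
  unfolding continuous_on_iff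
proof (intro ballI allI impI)
  fix t e :: real assume e: "e > 0"
  obtain K where K: "K \<ge> 0" "\<And>s. 0 \<le> s \<Longrightarrow> s \<le> t + 1 \<Longrightarrow> norm (u s) \<le> K" using loc_boundedE[OF u] by metis
  define d where "d = min 1 (e / (K + 1))"
  have d: "d > 0" "d \<le> 1" "K * d < e"
  proof -
    have K1: "K + 1 > 0" using K(1) by simp
    then show "d > 0" "d \<le> 1" using e by (auto simp: d_def)
    then have "K * d < (K + 1) * d" by simp
    also have "\<dots> \<le> (K + 1) * (e / (K + 1))" using K1 by (intro mult_left_mono) (auto simp: d_def)
    finally show "K * d < e" using K1 by simp
  qed
  have "dist (integral {0..s} u) (integral {0..t} u) < e" if s: "dist s t < d" for s
  proof -
    have "norm (integral {0..max s t} u - integral {0..min s t} u) \<le> K * (max s t - min s t)"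
      by (rule indefinite_integral_increment[OF u K(2) K(1)]) (use s d in \<open>auto simp: dist_real_def\<close>)
    also have "\<dots> \<le> K * d" using s K(1) by (intro mult_left_mono) (auto simp: dist_real_def)
    finally have "norm (integral {0..max s t} u - integral {0..min s t} u) < e" using d by simp
    then show ?thesis by (cases "s \<le> t") (auto simp: dist_norm norm_minus_commute)
  qed
  then show "\<exists>d>0. \<forall>s\<in>UNIV. dist s t < d \<longrightarrow> dist (integral {0..s} u) (integral {0..t} u) < e"
    using d(1) by blast
qed

lemma loc_bounded_cmult:
  fixes u :: "real \<Rightarrow> 'k::real_or_complex"
  assumes "loc_bounded u"
  shows "loc_bounded (\<lambda>s. c * u s)"
  unfolding loc_bounded_def
proof (intro conjI allI)
  show "(\<lambda>s. c * u s) \<in> borel_measurable lebesgue"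
    using assms unfolding loc_bounded_def by (intro borel_measurable_times) auto
  fix N
  obtain K where K: "\<And>t. 0 \<le> t \<Longrightarrow> t \<le> N \<Longrightarrow> norm (u t) \<le> K" using loc_boundedE[OF assms] by metis
  show "\<exists>K. \<forall>t\<in>{0..N}. norm (c * u t) \<le> K"
    by (intro exI[of _ "norm c * K"]) (auto simp: norm_mult intro!: mult_left_mono K)
qed

lemma norm_sgn_le: "norm (sgn (x::'k::real_normed_vector)) \<le> 1"
  by (simp add: norm_sgn)

lemma loc_bounded_sgn:
  fixes u :: "real \<Rightarrow> 'k::euclidean_space"
  assumes "continuous_on UNIV u"
  shows "loc_bounded (\<lambda>s. sgn (u s))"
  unfolding loc_bounded_def
proof (intro conjI allI)
  have "u \<in> borel_measurable lebesgue"
    using loc_bounded_if_continuous[OF assms] by (simp add: loc_bounded_def)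
  then show "(\<lambda>s. sgn (u s)) \<in> borel_measurable lebesgue"
    by (rule measurable_compose[OF _ borel_measurable_sgn])
  show "\<exists>K. \<forall>t\<in>{0..N}. norm (sgn (u t)) \<le> K" for N by (intro exI[of _ 1]) (simp add: norm_sgn_le)
qed

text \<open>
  A diagonal subsequence converges at all rational times; local equi-Lipschitz continuity carries
  convergence to the other times. Dividing by \<open>W t + 1\<close> normalises the bound that depends on \<open>t\<close>.
\<close>

lemma convergent_subsequence_locally_lipschitz:
  fixes u :: "nat \<Rightarrow> real \<Rightarrow> 'k::euclidean_space"
  assumes bd: "\<And>n t. norm (u n t) \<le> W t"
    and lip: "\<And>N. \<exists>\<Lambda>\<ge>0. \<forall>n a b. a \<le> b \<longrightarrow> b \<le> N \<longrightarrow> norm (u n b - u n a) \<le> \<Lambda> * (b - a)"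
  obtains k where "strict_mono (k :: nat \<Rightarrow> nat)" "\<And>t. convergent (\<lambda>n. u (k n) t)"
proof -
  have W: "W t \<ge> 0" for t using bd order_trans norm_ge_zero by blast
  have "norm (u n t /\<^sub>R (W t + 1)) \<le> 1" if "t \<in> \<rat>" for n t
    using bd[of n t] W[of t] by (simp add: field_simps)
  then obtain k where k: "strict_mono (k::nat\<Rightarrow>nat)"
    and lim: "\<And>t. t \<in> \<rat> \<Longrightarrow> \<exists>l. (\<lambda>n. u (k n) t /\<^sub>R (W t + 1)) \<longlonglongrightarrow> l"
    using function_convergent_subsequence[OF countable_rat, of "\<lambda>n t. u n t /\<^sub>R (W t + 1)" 1] by blast
  have conv_rat: "convergent (\<lambda>n. u (k n) t)" if t: "t \<in> \<rat>" for t
  proof -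
    obtain l where "(\<lambda>n. u (k n) t /\<^sub>R (W t + 1)) \<longlonglongrightarrow> l" using lim[OF t] by blast
    then have "(\<lambda>n. (W t + 1) *\<^sub>R (u (k n) t /\<^sub>R (W t + 1))) \<longlonglongrightarrow> (W t + 1) *\<^sub>R l"
      by (intro tendsto_intros)
    moreover have "W t + 1 \<noteq> 0" using W[of t] by linarith
    ultimately show ?thesis by (auto simp: convergent_def)
  qed
  have "convergent (\<lambda>n. u (k n) t)" for t
  proof -
    have "Cauchy (\<lambda>n. u (k n) t)"
    proof (rule metric_CauchyI)
      fix e :: real assume e: "e > 0"
      obtain \<Lambda> where \<Lambda>: "\<Lambda> \<ge> 0" "\<And>n a b. a \<le> b \<Longrightarrow> b \<le> t \<Longrightarrow> norm (u n b - u n a) \<le> \<Lambda> * (b - a)"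
        using lip[of t] by blast
      define \<eta> where "\<eta> = e / 3 / (\<Lambda> + 1)"
      have \<eta>: "\<eta> > 0" "\<Lambda> * \<eta> < e / 3"
      proof -
        have L1: "\<Lambda> + 1 > 0" using \<Lambda>(1) by simp
        then show "\<eta> > 0" using e by (simp add: \<eta>_def)
        then have "\<Lambda> * \<eta> < (\<Lambda> + 1) * \<eta>" by simp
        also have "\<dots> = e / 3"
        proof -
          have "(\<Lambda> + 1) * (y / (\<Lambda> + 1)) = y" for y
            by (subst times_divide_eq_right, rule nonzero_mult_div_cancel_left) (use L1 in simp)
          then show ?thesis unfolding \<eta>_def .
        qed
        finally show "\<Lambda> * \<eta> < e / 3" .
      qed
      obtain q where q: "q \<in> \<rat>" "t - \<eta> < q" "q < t" using Rats_dense_in_real[of "t - \<eta>" t] \<eta> by auto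
      have near: "norm (u n t - u n q) < e / 3" for n
      proof -
        have "norm (u n t - u n q) \<le> \<Lambda> * (t - q)" using \<Lambda>(2)[of q t n] q by simp
        also have "\<dots> \<le> \<Lambda> * \<eta>" using q \<Lambda>(1) by (intro mult_left_mono) auto
        finally show ?thesis using \<eta>(2) by simp
      qed
      have "Cauchy (\<lambda>n. u (k n) q)" using conv_rat[OF q(1)] by (rule convergent_Cauchy)
      then obtain M where M: "\<And>m n. m \<ge> M \<Longrightarrow> n \<ge> M \<Longrightarrow> norm (u (k m) q - u (k n) q) < e / 3"
        using e unfolding Cauchy_def dist_norm by (metis divide_pos_pos zero_less_numeral)
      have "dist (u (k m) t) (u (k n) t) < e" if "m \<ge> M" "n \<ge> M" for m n
      proof -
        have tri: "norm (a + b - c) \<le> norm a + norm b + norm c" for a b c :: 'k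
          using norm_triangle_ineq4[of "a + b" c] norm_triangle_ineq[of a b] by linarith
        have eq: "u (k m) t - u (k n) t = (u (k m) t - u (k m) q) + (u (k m) q - u (k n) q) - (u (k n) t - u (k n) q)"
          by simp
        have "norm (u (k m) t - u (k n) t) \<le> norm (u (k m) t - u (k m) q) + norm (u (k m) q - u (k n) q)
            + norm (u (k n) t - u (k n) q)"
          by (subst eq) (rule tri)
        then show ?thesis using near[of "k m"] near[of "k n"] M[OF that] by (simp add: dist_norm)
      qed
      then show "\<exists>M. \<forall>m\<ge>M. \<forall>n\<ge>M. dist (u (k m) t) (u (k n) t) < e" by blast
    qed
    then show ?thesis by (rule Cauchy_convergent)
  qed
  then show ?thesis using that k by blast
qed

text \<open>
  The induction step of a Gronwall estimate: integrating the derivative of \<open>A exp (B t)\<close> returns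
  that function.
\<close>

lemma exponential_bound:
  fixes g :: "real \<Rightarrow> 'k::euclidean_space"
  assumes g: "g integrable_on {0..t}" and t: "t \<ge> 0" and B: "B > 0"
    and le: "\<And>r. r \<in> {0..t} \<Longrightarrow> norm (g r) \<le> A * B * exp (B * r)"
  shows "norm (integral {0..t} g) \<le> A * exp (B * t) - A"
proof -
  have "((\<lambda>r. A * B * exp (B * r)) has_integral A * exp (B * t) - A * exp (B * 0)) {0..t}"
    by (rule fundamental_theorem_of_calculus[OF t])
       (auto intro!: derivative_eq_intros simp flip: has_real_derivative_iff_has_vector_derivative)
  then have hi: "((\<lambda>r. A * B * exp (B * r)) has_integral A * exp (B * t) - A) {0..t}" by simp
  have i: "integral {0..t} (\<lambda>r. A * B * exp (B * r)) = A * exp (B * t) - A"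
    by (rule integral_unique[OF hi])
  have i2: "(\<lambda>r. A * B * exp (B * r)) integrable_on {0..t}"
    using hi by blast
  show ?thesis using integral_norm_bound_integral[OF g i2 le] unfolding i by simp
qed

text \<open>
  With a delayed argument in \<open>f\<close> and in the sign, the right-hand side at time \<open>t\<close> is determined by
  the past, and discontinuity of the sign is harmless.
\<close>

lemma delayed_relay_equation:
  fixes f :: "'k::real_or_complex \<Rightarrow> 'k" and p :: "real \<Rightarrow> 'k" and x0 c e :: 'k
  assumes f: "continuous_on UNIV f" and p: "loc_bounded p" and \<delta>: "\<delta> > 0"
  obtains x G where "continuous_on UNIV x" "continuous_on UNIV G"
    "\<And>t. G t = integral {0..t} (\<lambda>r. sgn (x (r - \<delta>)))"
    "\<And>t. x t = x0 + integral {0..t} (\<lambda>r. f (x (r - \<delta>)) + p r + c * G r) + e * G t"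
proof -
  define \<gamma> where "\<gamma> x t = integral {0..t} (\<lambda>r. sgn (x (r - \<delta>) :: 'k))" for x t
  define \<Psi> where "\<Psi> x t = x0 + integral {0..t} (\<lambda>r. f (x (r - \<delta>)) + p r + c * \<gamma> x r) + e * \<gamma> x t" for x t
  have shift: "continuous_on UNIV (\<lambda>r. x (r - \<delta>))" if "continuous_on UNIV x" for x :: "real \<Rightarrow> 'k"
    by (rule continuous_on_compose2[OF that]) (auto intro!: continuous_intros)
  have \<gamma>c: "continuous_on UNIV (\<gamma> x)" if "continuous_on UNIV x" for x
    unfolding \<gamma>_def by (intro continuous_indefinite_integral loc_bounded_sgn shift that)
  have \<gamma>_causal: "\<gamma> x r = \<gamma> y r" if "\<And>s. s \<le> t - \<delta> \<Longrightarrow> x s = y s" "r \<le> t" for x y r t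
    unfolding \<gamma>_def by (rule integral_cong) (use that in auto)
  obtain x where x: "\<And>t. x t = \<Psi> x t" "continuous_on UNIV x"
  proof (rule delay_fixpoint[OF \<delta>, of \<Psi> x0])
    fix x y :: "real \<Rightarrow> 'k" and t assume eq: "\<And>s. s \<le> t - \<delta> \<Longrightarrow> x s = y s"
    have "integral {0..t} (\<lambda>r. f (x (r - \<delta>)) + p r + c * \<gamma> x r) = integral {0..t} (\<lambda>r. f (y (r - \<delta>)) + p r + c * \<gamma> y r)"
    proof (rule integral_cong)
      fix r assume "r \<in> {0..t}"
      then show "f (x (r - \<delta>)) + p r + c * \<gamma> x r = f (y (r - \<delta>)) + p r + c * \<gamma> y r"
        using eq[of "r - \<delta>"] \<gamma>_causal[OF eq, of r] by simp
    qed
    then show "\<Psi> x t = \<Psi> y t" using \<gamma>_causal[OF eq, of t] by (simp add: \<Psi>_def)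
  next
    show "\<Psi> x t = x0" if "t \<le> 0" for x t
      using that by (cases "t = 0") (simp_all add: \<Psi>_def \<gamma>_def)
  next
    fix x :: "real \<Rightarrow> 'k" assume xc: "continuous_on UNIV x"
    have "loc_bounded (\<lambda>r. f (x (r - \<delta>)) + p r + c * \<gamma> x r)"
      by (intro loc_bounded_add p loc_bounded_if_continuous continuous_intros \<gamma>c xc
          continuous_on_compose2[OF f shift[OF xc]]) auto
    then show "continuous_on UNIV (\<Psi> x)"
      unfolding \<Psi>_def by (intro continuous_intros continuous_indefinite_integral \<gamma>c xc)
  qed (rule that)
  have x_eq: "x t = x0 + integral {0..t} (\<lambda>r. f (x (r - \<delta>)) + p r + c * \<gamma> x r) + e * \<gamma> x t" for t
    using x(1)[of t] unfolding \<Psi>_def .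
  show ?thesis by (rule that[OF x(2) \<gamma>c[OF x(2)] \<gamma>_def x_eq])
qed

text \<open>
  The equation covers both control laws. In sliding mode control the relay acts directly (\<open>e \<noteq>
  0\<close>), in super-twisting control through its integral (\<open>c \<noteq> 0\<close>). As the sign is discontinuous, the
  limit of the delayed solutions need not satisfy an equation with \<open>sgn (x r)\<close> at zeros of \<open>x\<close>.
  Hence the integrated sign is carried along as a function \<open>G\<close> of its own: it converges as well,
  being Lipschitz with constant one, and where \<open>x\<close> has no zeros the sign is continuous along the
  solutions, so dominated convergence identifies the derivative of \<open>G\<close>.
\<close>

theorem relay_equation_solvable:
  fixes f :: "'k::real_or_complex \<Rightarrow> 'k" and p :: "real \<Rightarrow> 'k" and x0 c e :: 'k
  assumes f: "continuous_on UNIV f" and growth: "\<And>x. norm (f x) \<le> M * (1 + norm x)"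
    and p: "loc_bounded p" and p_growth: "\<And>t. t \<ge> 0 \<Longrightarrow> norm (p t) \<le> P * (1 + t)"
  obtains x G where "continuous_on UNIV x" "\<And>a b. norm (G b - G a) \<le> \<bar>b - a\<bar>" "G 0 = 0"
    "\<And>t. t \<ge> 0 \<Longrightarrow> x t = x0 + integral {0..t} (\<lambda>r. f (x r) + p r + c * G r) + e * G t"
    "\<And>a b. 0 \<le> a \<Longrightarrow> a \<le> b \<Longrightarrow> \<forall>r\<in>{a<..<b}. x r \<noteq> 0 \<Longrightarrow>
      G b - G a = integral {a..b} (\<lambda>r. sgn (x r))"
proof -
  have M0: "M \<ge> 0" using order_trans[OF norm_ge_zero growth[of 0]] by simp
  have P0: "P \<ge> 0" using order_trans[OF norm_ge_zero p_growth[of 0]] by simp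
  define \<delta> where "\<delta> n = 1 / real (Suc n)" for n
  have \<delta>: "\<delta> n > 0" for n by (simp add: \<delta>_def)
  have \<delta>_lim: "\<delta> \<longlonglongrightarrow> 0" unfolding \<delta>_def using LIMSEQ_inverse_real_of_nat by (simp add: inverse_eq_divide)
  define Q where "Q n x G \<longleftrightarrow> continuous_on UNIV x \<and> continuous_on UNIV G \<and>
    (\<forall>t. G t = integral {0..t} (\<lambda>r. sgn (x (r - \<delta> n)))) \<and>
    (\<forall>t. x t = x0 + integral {0..t} (\<lambda>r. f (x (r - \<delta> n)) + p r + c * G r) + e * G t)"
    for n :: nat and x G :: "real \<Rightarrow> 'k"
  have "\<exists>x G. Q n x G" for n
    unfolding Q_def by (rule delayed_relay_equation[OF f p \<delta>[of n], of x0 c e]) blast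
  then obtain X \<Gamma> where "\<And>n. Q n (X n) (\<Gamma> n)" by metis
  then have Xc: "\<And>n. continuous_on UNIV (X n)" and \<Gamma>c: "\<And>n. continuous_on UNIV (\<Gamma> n)"
    and \<Gamma>: "\<And>n t. \<Gamma> n t = integral {0..t} (\<lambda>r. sgn (X n (r - \<delta> n)))"
    and X: "\<And>n t. X n t = x0 + integral {0..t} (\<lambda>r. f (X n (r - \<delta> n)) + p r + c * \<Gamma> n r) + e * \<Gamma> n t"
    unfolding Q_def by blast+
  have shift: "continuous_on UNIV (\<lambda>r. X n (r - \<delta> n))" for n
    by (rule continuous_on_compose2[OF Xc]) (auto intro!: continuous_intros)
  have sgn_lb: "loc_bounded (\<lambda>r. sgn (X n (r - \<delta> n)))" for n by (rule loc_bounded_sgn[OF shift])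
  have \<Gamma>_lip: "norm (\<Gamma> n b - \<Gamma> n a) \<le> 1 * (b - a)" if "a \<le> b" for n a b
    unfolding \<Gamma> by (rule indefinite_integral_increment[OF sgn_lb, where N = b]) (use that in \<open>auto simp: norm_sgn_le\<close>)
  have \<Gamma>_0: "\<Gamma> n t = 0" if "t \<le> 0" for n t using that by (cases "t = 0") (simp_all add: \<Gamma>)
  have \<Gamma>_bd: "norm (\<Gamma> n t) \<le> \<bar>t\<bar>" for n t
    using \<Gamma>_lip[of 0 t n] \<Gamma>_0[of 0 n] \<Gamma>_0[of t n] by (cases "t \<ge> 0") auto
  have drift_lb: "loc_bounded (\<lambda>r. f (X n (r - \<delta> n)) + p r + c * \<Gamma> n r)" for n
    by (intro loc_bounded_add p loc_bounded_if_continuous continuous_intros \<Gamma>c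
        continuous_on_compose2[OF f shift]) auto
  have X_0: "X n t = x0" if "t \<le> 0" for n t
  proof -
    have "integral {0..t} g = 0" for g :: "real \<Rightarrow> 'k"
      by (cases "t < 0") (use that in auto)
    then show ?thesis unfolding X[of n t] \<Gamma>_0[OF that] by simp
  qed
  \<comment> \<open>With \<open>A \<ge> max 1 |x0|\<close> and \<open>B\<close> larger than the sum of all growth constants, the
    bound \<open>A exp (B t)\<close> reproduces itself under the integral; it does not depend on
    the delay.\<close>
  define A where "A = norm x0 + 1"
  define B where "B = 2 * M + P + norm c + norm e + 1"
  have AB: "A \<ge> 1" "norm x0 \<le> A" "B \<ge> 1" using M0 P0 by (simp_all add: A_def B_def)
  have exp_ge: "1 + r \<le> exp (B * r)" "1 \<le> exp (B * r)" if "r \<ge> 0" for r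
  proof -
    have "r \<le> B * r" using AB that by (simp add: mult_le_cancel_right1)
    then show "1 + r \<le> exp (B * r)" using exp_ge_add_one_self[of "B * r"] by linarith
    then show "1 \<le> exp (B * r)" using that by linarith
  qed
  have X_bd: "norm (X n t) \<le> A * exp (B * max 0 t)" for n t
  proof -
    \<comment> \<open>Induction over the steps of length \<open>\<delta> n\<close>, as the right-hand side only sees \<open>t -
      \<delta> n\<close>.\<close>
    have "\<forall>t \<le> real k * \<delta> n. norm (X n t) \<le> A * exp (B * max 0 t)" for k
    proof (induction k)
      case 0
      then show ?case using X_0 AB by simp
    next
      case (Suc k)
      show ?case
      proof (intro allI impI)
        fix t assume tk: "t \<le> real (Suc k) * \<delta> n"
        show "norm (X n t) \<le> A * exp (B * max 0 t)"
        proof (cases "t \<le> 0")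
          case True
          then show ?thesis using X_0[OF True] AB by simp
        next
          case False
          let ?g = "\<lambda>r. (f (X n (r - \<delta> n)) + p r + c * \<Gamma> n r) + e * sgn (X n (r - \<delta> n))"
          have i1: "(\<lambda>r. f (X n (r - \<delta> n)) + p r + c * \<Gamma> n r) integrable_on {0..t}"
            by (rule loc_bounded_integrable_on[OF drift_lb]) simp
          have i2: "(\<lambda>r. e * sgn (X n (r - \<delta> n))) integrable_on {0..t}"
            by (rule loc_bounded_integrable_on[OF loc_bounded_cmult[OF sgn_lb]]) simp
          have "X n t = x0 + integral {0..t} ?g"
            unfolding X[of n t] integral_add[OF i1 i2] by (simp add: \<Gamma>[of n t])
          moreover have "norm (integral {0..t} ?g) \<le> A * exp (B * t) - A"
          proof (rule exponential_bound)
            show "?g integrable_on {0..t}" by (rule integrable_add[OF i1 i2])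
            fix r assume r: "r \<in> {0..t}"
            let ?E = "A * exp (B * r)"
            have E1: "1 \<le> ?E" "1 + r \<le> ?E"
            proof -
              have "exp (B * r) \<le> ?E" using AB by simp
              moreover have "0 \<le> r" using r by simp
              ultimately show "1 \<le> ?E" "1 + r \<le> ?E" using exp_ge[of r] by linarith+
            qed
            have "norm (X n (r - \<delta> n)) \<le> A * exp (B * max 0 (r - \<delta> n))"
              using Suc r tk by (auto simp: algebra_simps)
            also have "\<dots> \<le> ?E" using AB r \<delta>[of n] by (intro mult_left_mono) auto
            finally have "M * (1 + norm (X n (r - \<delta> n))) \<le> M * (2 * ?E)"
              using E1 M0 by (intro mult_left_mono) auto
            then have 1: "norm (f (X n (r - \<delta> n))) \<le> 2 * M * ?E" using growth[of "X n (r - \<delta> n)"] by linarith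
            have "norm (p r) \<le> P * (1 + r)" using p_growth r by simp
            also have "\<dots> \<le> P * ?E" by (intro mult_left_mono E1 P0)
            finally have 2: "norm (p r) \<le> P * ?E" .
            have "norm (c * \<Gamma> n r) \<le> norm c * ?E"
              unfolding norm_mult using \<Gamma>_bd[of n r] E1 r by (intro mult_left_mono) auto
            moreover have "norm (e * sgn (X n (r - \<delta> n))) \<le> norm e * ?E"
              unfolding norm_mult using norm_sgn_le[of "X n (r - \<delta> n)"] E1 by (intro mult_left_mono) auto
            moreover have "norm (?g r) \<le> norm (f (X n (r - \<delta> n))) + norm (p r) + norm (c * \<Gamma> n r) + norm (e * sgn (X n (r - \<delta> n)))"
              by (intro norm_triangle_mono order_refl)
            ultimately have "norm (?g r) \<le> 2 * M * ?E + P * ?E + norm c * ?E + norm e * ?E"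
              using 1 2 by linarith
            also have "\<dots> \<le> B * ?E" using E1 by (simp add: B_def algebra_simps)
            finally show "norm (?g r) \<le> A * B * exp (B * r)" by (simp add: mult_ac)
          qed (use False AB in auto)
          ultimately have "norm (X n t) \<le> norm x0 + (A * exp (B * t) - A)"
            using norm_triangle_ineq[of x0 "integral {0..t} ?g"] by simp
          then show ?thesis using False AB by simp
        qed
      qed
    qed
    moreover obtain k :: nat where "t < real k * \<delta> n" using reals_Archimedean3[OF \<delta>[of n]] by blast
    ultimately show ?thesis by (meson less_imp_le)
  qed
  have X_lip: "\<exists>\<Lambda>\<ge>0. \<forall>n a b. a \<le> b \<longrightarrow> b \<le> N \<longrightarrow> norm (X n b - X n a) \<le> \<Lambda> * (b - a)" for N
  proof -
    define R where "R = A * exp (B * max 0 N)"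
    define \<Lambda>1 where "\<Lambda>1 = M * (1 + R) + P * (1 + max 0 N) + norm c * max 0 N"
    have R0: "R \<ge> 0" using AB by (simp add: R_def)
    have \<Lambda>1: "\<Lambda>1 \<ge> 0" using M0 P0 R0 by (simp add: \<Lambda>1_def)
    have "norm (X n b - X n a) \<le> (\<Lambda>1 + norm e) * (b - a)" if ab: "a \<le> b" "b \<le> N" for n a b
    proof -
      let ?g = "\<lambda>r. f (X n (r - \<delta> n)) + p r + c * \<Gamma> n r"
      have "norm (integral {0..b} ?g - integral {0..a} ?g) \<le> \<Lambda>1 * (b - a)"
      proof (rule indefinite_integral_increment[OF drift_lb _ \<Lambda>1 ab])
        fix r assume r: "0 \<le> r" "r \<le> N"
        have "norm (X n (r - \<delta> n)) \<le> A * exp (B * max 0 (r - \<delta> n))" by (rule X_bd)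
        also have "\<dots> \<le> R" unfolding R_def using AB r \<delta>[of n] by (intro mult_left_mono) auto
        finally have "M * (1 + norm (X n (r - \<delta> n))) \<le> M * (1 + R)" using M0 by (intro mult_left_mono) auto
        then have 1: "norm (f (X n (r - \<delta> n))) \<le> M * (1 + R)" by (rule order_trans[OF growth])
        have "P * (1 + r) \<le> P * (1 + max 0 N)" using r P0 by (intro mult_left_mono) auto
        then have 2: "norm (p r) \<le> P * (1 + max 0 N)" by (rule order_trans[OF p_growth[OF r(1)]])
        have 3: "norm (c * \<Gamma> n r) \<le> norm c * max 0 N"
          unfolding norm_mult using \<Gamma>_bd[of n r] r by (intro mult_left_mono) auto
        show "norm (?g r) \<le> \<Lambda>1" unfolding \<Lambda>1_def by (intro norm_triangle_mono 1 2 3)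
      qed
      moreover have "norm (e * \<Gamma> n b - e * \<Gamma> n a) \<le> norm e * (b - a)"
        unfolding right_diff_distrib[symmetric] norm_mult using \<Gamma>_lip[OF ab(1), of n] by (intro mult_left_mono) auto
      moreover have "X n b - X n a = (integral {0..b} ?g - integral {0..a} ?g) + (e * \<Gamma> n b - e * \<Gamma> n a)"
        unfolding X[of n b] X[of n a] by simp
      ultimately show ?thesis
        using norm_triangle_ineq[of "integral {0..b} ?g - integral {0..a} ?g" "e * \<Gamma> n b - e * \<Gamma> n a"]
        by (simp add: distrib_right)
    qed
    then show ?thesis using \<Lambda>1 by (intro exI[of _ "\<Lambda>1 + norm e"]) auto
  qed
  obtain k1 where k1: "strict_mono (k1::nat\<Rightarrow>nat)" "\<And>t. convergent (\<lambda>n. X (k1 n) t)"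
    using convergent_subsequence_locally_lipschitz[OF X_bd X_lip] by metis
  obtain k2 where k2: "strict_mono (k2::nat\<Rightarrow>nat)" "\<And>t. convergent (\<lambda>n. \<Gamma> (k1 (k2 n)) t)"
    using convergent_subsequence_locally_lipschitz[of "\<lambda>n. \<Gamma> (k1 n)" "\<lambda>t. \<bar>t\<bar>"] \<Gamma>_bd \<Gamma>_lip zero_le_one by metis
  define k where "k n = k1 (k2 n)" for n
  have k: "strict_mono k" using k1(1) k2(1) by (simp add: k_def strict_mono_def)
  define x where "x t = lim (\<lambda>n. X (k n) t)" for t
  define G where "G t = lim (\<lambda>n. \<Gamma> (k n) t)" for t
  have x: "(\<lambda>n. X (k n) t) \<longlonglongrightarrow> x t" for t
  proof -
    have "convergent ((\<lambda>n. X (k1 n) t) \<circ> k2)" by (rule convergent_subseq_convergent[OF k1(2) k2(1)])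
    then show ?thesis by (simp add: x_def k_def o_def convergent_LIMSEQ_iff)
  qed
  have G: "(\<lambda>n. \<Gamma> (k n) t) \<longlonglongrightarrow> G t" for t
    using k2(2)[of t] by (simp add: G_def k_def convergent_LIMSEQ_iff)
  have x_lip: "\<exists>\<Lambda>\<ge>0. \<forall>a b. a \<le> b \<longrightarrow> b \<le> N \<longrightarrow> norm (x b - x a) \<le> \<Lambda> * (b - a)" for N
  proof -
    obtain \<Lambda> where \<Lambda>: "\<Lambda> \<ge> 0" "\<And>n a b. a \<le> b \<Longrightarrow> b \<le> N \<Longrightarrow> norm (X n b - X n a) \<le> \<Lambda> * (b - a)"
      using X_lip[of N] by blast
    have "norm (x b - x a) \<le> \<Lambda> * (b - a)" if "a \<le> b" "b \<le> N" for a b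
      by (rule LIMSEQ_le_const2[OF tendsto_norm[OF tendsto_diff[OF x x]]]) (use \<Lambda>(2)[OF that] in blast)
    then show ?thesis using \<Lambda>(1) by blast
  qed
  have xc: "continuous_on UNIV x"
  proof -
    have "isCont x t" for t
    proof -
      obtain \<Lambda> where \<Lambda>: "\<Lambda> \<ge> 0" "\<And>a b. a \<le> b \<Longrightarrow> b \<le> t + 1 \<Longrightarrow> norm (x b - x a) \<le> \<Lambda> * (b - a)"
        using x_lip[of "t + 1"] by blast
      have "\<Lambda>-lipschitz_on {..<t + 1} x"
      proof (rule lipschitz_onI[OF _ \<Lambda>(1)])
        show "dist (x a) (x b) \<le> \<Lambda> * dist a b" if "a \<in> {..<t + 1}" "b \<in> {..<t + 1}" for a b
          using \<Lambda>(2)[of a b] \<Lambda>(2)[of b a] that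
          by (cases "a \<le> b") (auto simp: dist_norm norm_minus_commute)
      qed
      then have "continuous_on {..<t + 1} x" by (rule lipschitz_on_continuous_on)
      then show ?thesis by (simp add: continuous_on_eq_continuous_at)
    qed
    then show ?thesis by (simp add: continuous_on_eq_continuous_within)
  qed
  have G_lip: "norm (G b - G a) \<le> \<bar>b - a\<bar>" for a b
  proof (rule LIMSEQ_le_const2[OF tendsto_norm[OF tendsto_diff[OF G G]]], intro exI allI impI)
    show "norm (\<Gamma> (k n) b - \<Gamma> (k n) a) \<le> \<bar>b - a\<bar>" for n
      using \<Gamma>_lip[of a b "k n"] \<Gamma>_lip[of b a "k n"] by (cases "a \<le> b") (auto simp: norm_minus_commute)
  qed
  have G0: "G 0 = 0" using G[of 0] \<Gamma>_0 by (simp add: LIMSEQ_unique[OF _ tendsto_const])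
  have x_delay: "(\<lambda>n. X (k n) (r - \<delta> (k n))) \<longlonglongrightarrow> x r" for r
  proof -
    obtain \<Lambda> where \<Lambda>: "\<Lambda> \<ge> 0" "\<And>n a b. a \<le> b \<Longrightarrow> b \<le> r \<Longrightarrow> norm (X n b - X n a) \<le> \<Lambda> * (b - a)"
      using X_lip[of r] by blast
    have "(\<lambda>n. \<delta> (k n)) \<longlonglongrightarrow> 0" using LIMSEQ_subseq_LIMSEQ[OF \<delta>_lim k] by (simp add: o_def)
    from tendsto_mult_left[OF this, of \<Lambda>] have null: "(\<lambda>n. \<Lambda> * \<delta> (k n)) \<longlonglongrightarrow> 0" by simp
    have "norm (X (k n) r - X (k n) (r - \<delta> (k n))) \<le> \<Lambda> * \<delta> (k n)" for n
      using \<Lambda>(2)[of "r - \<delta> (k n)" r "k n"] \<delta>[of "k n"] by simp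
    then have "(\<lambda>n. X (k n) r - X (k n) (r - \<delta> (k n))) \<longlonglongrightarrow> 0"
      by (intro Lim_null_comparison[OF always_eventually null] allI)
    from tendsto_diff[OF x[of r] this] show ?thesis by simp
  qed
  have "x t = x0 + integral {0..t} (\<lambda>r. f (x r) + p r + c * G r) + e * G t" if t: "t \<ge> 0" for t
  proof -
    define R where "R = A * exp (B * t)"
    have "(\<lambda>n. integral {0..t} (\<lambda>r. f (X (k n) (r - \<delta> (k n))) + p r + c * \<Gamma> (k n) r))
        \<longlonglongrightarrow> integral {0..t} (\<lambda>r. f (x r) + p r + c * G r)"
    proof (rule dominated_convergence(2)[where h = "\<lambda>_. M * (1 + R) + P * (1 + t) + norm c * t"])
      show "(\<lambda>r. f (X (k n) (r - \<delta> (k n))) + p r + c * \<Gamma> (k n) r) integrable_on {0..t}" for n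
        by (rule loc_bounded_integrable_on[OF drift_lb]) simp
      show "(\<lambda>_. M * (1 + R) + P * (1 + t) + norm c * t) integrable_on {0..t}" by (rule integrable_const_ivl)
      fix r assume r: "r \<in> {0..t}"
      show "norm (f (X (k n) (r - \<delta> (k n))) + p r + c * \<Gamma> (k n) r) \<le> M * (1 + R) + P * (1 + t) + norm c * t" for n
      proof (intro norm_triangle_mono)
        have "norm (X (k n) (r - \<delta> (k n))) \<le> A * exp (B * max 0 (r - \<delta> (k n)))" by (rule X_bd)
        also have "\<dots> \<le> R" unfolding R_def using AB r \<delta>[of "k n"] t by (intro mult_left_mono) auto
        finally have "M * (1 + norm (X (k n) (r - \<delta> (k n)))) \<le> M * (1 + R)" using M0 by (intro mult_left_mono) auto
        then show "norm (f (X (k n) (r - \<delta> (k n)))) \<le> M * (1 + R)" by (rule order_trans[OF growth])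
        have "P * (1 + r) \<le> P * (1 + t)" using r P0 by (intro mult_left_mono) auto
        moreover have "norm (p r) \<le> P * (1 + r)" using p_growth r by simp
        ultimately show "norm (p r) \<le> P * (1 + t)" by linarith
        show "norm (c * \<Gamma> (k n) r) \<le> norm c * t"
          unfolding norm_mult using \<Gamma>_bd[of "k n" r] r by (intro mult_left_mono) auto
      qed
      have "isCont f (x r)" using f by (simp add: continuous_on_eq_continuous_at)
      then show "(\<lambda>n. f (X (k n) (r - \<delta> (k n))) + p r + c * \<Gamma> (k n) r) \<longlonglongrightarrow> f (x r) + p r + c * G r"
        by (intro tendsto_intros G isCont_tendsto_compose[OF _ x_delay])
    qed
    then have "(\<lambda>n. X (k n) t) \<longlonglongrightarrow> x0 + integral {0..t} (\<lambda>r. f (x r) + p r + c * G r) + e * G t"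
      unfolding X[of _ t] by (intro tendsto_intros G)
    then show ?thesis by (rule LIMSEQ_unique[OF x])
  qed
  moreover have "G b - G a = integral {a..b} (\<lambda>r. sgn (x r))"
    if ab: "0 \<le> a" "a \<le> b" and nz: "\<forall>r\<in>{a<..<b}. x r \<noteq> 0" for a b
  proof -
    have int: "(\<lambda>r. sgn (X n (r - \<delta> n))) integrable_on {c..b}" if "c \<ge> 0" for n c
      by (rule loc_bounded_integrable_on[OF sgn_lb that])
    have diff: "\<Gamma> n b - \<Gamma> n a = integral {a<..<b} (\<lambda>r. sgn (X n (r - \<delta> n)))" for n
    proof -
      have "\<Gamma> n a + integral {a..b} (\<lambda>r. sgn (X n (r - \<delta> n))) = \<Gamma> n b"
        unfolding \<Gamma> by (rule integral_combine_interval[OF ab int]) simp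
      then have "\<Gamma> n b - \<Gamma> n a = integral {a..b} (\<lambda>r. sgn (X n (r - \<delta> n)))"
        by (metis add_diff_cancel_left')
      then show ?thesis by (simp only: integral_open_interval_real)
    qed
    have "(\<lambda>n. integral {a<..<b} (\<lambda>r. sgn (X (k n) (r - \<delta> (k n))))) \<longlonglongrightarrow> integral {a<..<b} (\<lambda>r. sgn (x r))"
    proof (rule dominated_convergence(2)[where h = "\<lambda>_. 1"])
      show "(\<lambda>r. sgn (X (k n) (r - \<delta> (k n)))) integrable_on {a<..<b}" for n
        using int[OF ab(1), of "k n"] by (simp add: integrable_on_open_interval_real)
      show "(\<lambda>_. 1::real) integrable_on {a<..<b}"
        by (simp only: integrable_on_open_interval_real integrable_const_ivl)
      fix r assume r: "r \<in> {a<..<b}"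
      show "norm (sgn (X (k n) (r - \<delta> (k n)))) \<le> 1" for n by (rule norm_sgn_le)
      show "(\<lambda>n. sgn (X (k n) (r - \<delta> (k n)))) \<longlonglongrightarrow> sgn (x r)"
        by (rule tendsto_sgn[OF x_delay]) (use nz r in auto)
    qed
    moreover have "(\<lambda>n. \<Gamma> (k n) b - \<Gamma> (k n) a) \<longlonglongrightarrow> G b - G a" by (intro tendsto_diff G)
    ultimately have "G b - G a = integral {a<..<b} (\<lambda>r. sgn (x r))"
      unfolding diff by (rule LIMSEQ_unique[rotated])
    then show ?thesis by (simp add: integral_open_interval_real)
  qed
  ultimately show ?thesis using that xc G_lip G0 by blast
qed


section \<open>Sliding mode control\<close>

lemma sgn_in_set_sign: "x \<noteq> 0 \<Longrightarrow> sgn x \<in> set_sign x"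
  by (simp add: set_sign_def sgn_div_norm)

lemma first_time_in_closed_set:
  fixes Z :: "real set"
  assumes "closed Z" "t1 \<in> Z" "t1 \<ge> 0"
  obtains t0 where "t0 \<ge> 0" "t0 \<in> Z" "\<And>r. 0 \<le> r \<Longrightarrow> r < t0 \<Longrightarrow> r \<notin> Z"
proof -
  let ?Z = "Z \<inter> {0..}"
  have bdd: "bdd_below ?Z" by (rule bdd_belowI[of _ 0]) simp
  have "Inf ?Z \<in> ?Z"
    by (rule closed_contains_Inf) (use assms bdd in auto)
  moreover have "Inf ?Z \<le> r" if "0 \<le> r" "r \<in> Z" for r
    by (rule cInf_lower[OF _ bdd]) (use that in auto)
  ultimately show ?thesis by (intro that[of "Inf ?Z"]) (auto simp: not_le[symmetric])
qed

text \<open>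
  Once a path has reached a state at which it can rest, it may stay there.
\<close>

lemma stopped_integral_equation:
  fixes F :: "real \<Rightarrow> 'k::euclidean_space"
  assumes t0: "t0 \<ge> 0" and F: "F integrable_on {0..t}"
    and before: "\<And>t. t \<ge> 0 \<Longrightarrow> t \<le> t0 \<Longrightarrow> \<sigma> t = x0 + integral {0..t} F"
    and after: "\<And>t. t \<ge> t0 \<Longrightarrow> \<sigma> t = \<sigma> t0" "\<And>r. r \<ge> t0 \<Longrightarrow> F r = 0"
    and t: "t \<ge> 0"
  shows "\<sigma> t = x0 + integral {0..t} F"
proof (cases "t \<le> t0")
  case False
  have "integral {t0..t} F = integral {t0..t} (\<lambda>_. 0)"
    by (rule integral_cong) (use after(2) in simp)
  moreover have "integral {0..t0} F + integral {t0..t} F = integral {0..t} F"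
    by (rule integral_combine_interval) (use False t0 F in auto)
  ultimately have "x0 + integral {0..t} F = \<sigma> t0" using before[of t0] t0 by simp
  then show ?thesis using False after(1)[of t] by simp
qed (use before t in blast)

text \<open>
  Up to the first zero of the relay solution, the sign is the ordinary one. From then on \<open>\<sigma> = 0\<close>
  is kept by the selection \<open>s = - q / \<kappa>\<close>, which lies in the unit ball because \<open>q\<close> is dominated by
  \<open>\<kappa>\<close>.
\<close>

lemma sliding_mode_scalar:
  fixes a \<kappa> s0 :: "'k::real_or_complex"
  assumes q: "loc_bounded q" and q_le: "\<And>t. t \<ge> 0 \<Longrightarrow> norm (q t) \<le> norm \<kappa>" and \<kappa>: "\<kappa> \<noteq> 0"
  obtains \<sigma> s where "continuous_on UNIV \<sigma>" "loc_bounded s" "\<And>t. t \<ge> 0 \<Longrightarrow> s t \<in> set_sign (\<sigma> t)"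
    "\<And>t. t \<ge> 0 \<Longrightarrow> \<sigma> t = s0 + integral {0..t} (\<lambda>r. a * \<sigma> r + q r + \<kappa> * s r)"
proof -
  have 1: "norm (a * x) \<le> norm a * (1 + norm x)" for x
    by (simp add: norm_mult algebra_simps)
  have 2: "norm (q t) \<le> norm \<kappa> * (1 + t)" if "t \<ge> 0" for t
    using q_le[OF that] mult_left_mono[of 1 "1 + t" "norm \<kappa>"] that by simp
  have 0: "continuous_on UNIV ((*) a)" by (intro continuous_intros)
  obtain x G where x: "continuous_on UNIV x" and G0: "G 0 = 0"
    and x_eq: "\<And>t. t \<ge> 0 \<Longrightarrow> x t = s0 + integral {0..t} (\<lambda>r. a * x r + q r + 0 * G r) + \<kappa> * G t"
    and G: "\<And>a b. 0 \<le> a \<Longrightarrow> a \<le> b \<Longrightarrow> \<forall>r\<in>{a<..<b}. x r \<noteq> 0 \<Longrightarrow>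
      G b - G a = integral {a..b} (\<lambda>r. sgn (x r))"
  proof (rule relay_equation_solvable[OF 0 1 q, where P = "norm \<kappa>" and ?x0.0 = s0 and c = 0 and e = \<kappa>])
    show "norm (q t) \<le> norm \<kappa> * (1 + t)" if "t \<ge> 0" for t by (rule 2[OF that])
  qed (rule that)
  have int: "u integrable_on {c..t}" if "loc_bounded u" "c \<ge> 0" for u :: "real \<Rightarrow> 'k" and c t
    by (rule loc_bounded_integrable_on[OF that])
  have lb: "loc_bounded (\<lambda>r. a * u r + q r)" if "continuous_on UNIV u" for u
    by (intro loc_bounded_add q loc_bounded_if_continuous continuous_intros that)
  have sgn_lb: "loc_bounded (\<lambda>r. sgn (x r))" by (rule loc_bounded_sgn[OF x])
  have early: "x t = s0 + integral {0..t} (\<lambda>r. a * x r + q r + \<kappa> * sgn (x r))"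
    if t: "t \<ge> 0" and nz: "\<And>r. 0 < r \<Longrightarrow> r < t \<Longrightarrow> x r \<noteq> 0" for t
  proof -
    have "integral {0..t} (\<lambda>r. a * x r + q r + \<kappa> * sgn (x r))
        = integral {0..t} (\<lambda>r. a * x r + q r) + \<kappa> * integral {0..t} (\<lambda>r. sgn (x r))"
      by (subst integral_add[OF int[OF lb[OF x]] int[OF loc_bounded_cmult[OF sgn_lb]]]) auto
    moreover have "G t = integral {0..t} (\<lambda>r. sgn (x r))" using G[OF order_refl t] nz G0 by simp
    ultimately show ?thesis using x_eq[OF t] by simp
  qed
  show ?thesis
  proof (cases "\<exists>t1\<ge>0. x t1 = 0")
    case False
    then have nz: "x t \<noteq> 0" if "t \<ge> 0" for t using that by blast
    show ?thesis
    proof (rule that[OF x sgn_lb])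
      show "sgn (x t) \<in> set_sign (x t)" if "t \<ge> 0" for t by (rule sgn_in_set_sign[OF nz[OF that]])
      show "x t = s0 + integral {0..t} (\<lambda>r. a * x r + q r + \<kappa> * sgn (x r))" if "t \<ge> 0" for t
        by (rule early[OF that nz]) simp
    qed
  next
    case True
    then obtain t1 where t1: "t1 \<ge> 0" "x t1 = 0" by blast
    have "closed {t. x t = 0}"
      using closed_Collect_eq[OF x continuous_on_const] .
    then obtain t0 where t0: "t0 \<ge> 0" "x t0 = 0" "\<And>r. 0 \<le> r \<Longrightarrow> r < t0 \<Longrightarrow> x r \<noteq> 0"
      using first_time_in_closed_set[of "{t. x t = 0}" t1] t1 by auto
    define \<sigma> where "\<sigma> t = x (min t t0)" for t
    define s where "s t = (if t < t0 then sgn (x t) else - q t / \<kappa>)" for t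
    have \<sigma>c: "continuous_on UNIV \<sigma>"
      unfolding \<sigma>_def by (rule continuous_on_compose2[OF x]) (auto intro!: continuous_intros)
    have s_le: "norm (s t) \<le> 1" if "t \<ge> 0" for t
      using q_le[OF that] \<kappa> by (simp add: s_def norm_sgn_le norm_divide divide_le_eq_1)
    have s_lb: "loc_bounded s"
      unfolding loc_bounded_def
    proof (intro conjI allI)
      have "q \<in> borel_measurable lebesgue" "(\<lambda>r. sgn (x r)) \<in> borel_measurable lebesgue"
        using q sgn_lb by (auto simp: loc_bounded_def)
      then show "s \<in> borel_measurable lebesgue"
        unfolding s_def by (intro measurable_If borel_measurable_divide borel_measurable_uminus) auto
      show "\<exists>K. \<forall>t\<in>{0..N}. norm (s t) \<le> K" for N using s_le by (intro exI[of _ 1]) auto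
    qed
    have "s t \<in> set_sign (\<sigma> t)" if "t \<ge> 0" for t
      using t0 that s_le[OF that] by (auto simp: s_def \<sigma>_def set_sign_def sgn_div_norm)
    moreover have "\<sigma> t = s0 + integral {0..t} (\<lambda>r. a * \<sigma> r + q r + \<kappa> * s r)" if t: "t \<ge> 0" for t
    proof -
      let ?F = "\<lambda>r. a * \<sigma> r + q r + \<kappa> * s r"
      have F: "?F integrable_on {c..t}" if "c \<ge> 0" for c t
        by (rule int[OF loc_bounded_add[OF lb[OF \<sigma>c] loc_bounded_cmult[OF s_lb]] that])
      have before: "\<sigma> t = s0 + integral {0..t} ?F" if t: "t \<ge> 0" "t \<le> t0" for t
      proof -
        have "integral {0..t} (\<lambda>r. a * x r + q r + \<kappa> * sgn (x r)) = integral {0..t} ?F"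
          by (rule integral_spike[of "{t0}"]) (use t in \<open>auto simp: \<sigma>_def s_def\<close>)
        moreover have "x t = s0 + integral {0..t} (\<lambda>r. a * x r + q r + \<kappa> * sgn (x r))"
          by (rule early[OF t(1)]) (use t t0 in auto)
        ultimately show ?thesis using t by (simp add: \<sigma>_def)
      qed
      show ?thesis
        by (rule stopped_integral_equation[OF t0(1) F[OF order_refl] before _ _ t])
           (use t0(2) \<kappa> in \<open>simp_all add: \<sigma>_def s_def\<close>)
    qed
    ultimately show ?thesis using that[OF \<sigma>c s_lb] by blast
  qed
qed

context feedback_system
begin

lemma B1_\<phi>: "B 1 \<phi> = conjugate (control_adj B \<phi>)"
  using control_adj_eq[OF \<phi>_in_V] by simp

lemma control_adj_\<phi>_nonzero: "control_adj B \<phi> \<noteq> 0"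
  using B_eigenvector_nonzero B1_\<phi> by auto

text \<open>
  The input enters the equation of the output with the factor \<open>B 1 \<phi> = cnj b\<close>, while the control
  law divides by \<open>b\<close>; therefore the feedback replaces the drift \<open>cnj \<mu>\<close> by \<open>cnj \<mu> - (cnj b / b)
  \<mu>\<close>, and the relay acts with the complex gain \<open>\<kappa>\<close> of modulus \<open>K\<close>.
\<close>

theorem sliding_mode_solution:
  assumes d: "set_borel_measurable lebesgue {0..} d" and Kd: "Kd > 0"
    and d_le: "\<And>t. t \<ge> 0 \<Longrightarrow> norm (d t) \<le> Kd"
    and K: "K > 0" "K / norm (control_adj B \<phi>) > Kd"
  shows "\<exists>z. SM_mild_solution scl ip D A B DL L S \<phi> \<mu> K d z0 z"
proof -
  define b where "b = control_adj B \<phi>"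
  have b: "b \<noteq> 0" "B 1 \<phi> = conjugate b" using control_adj_\<phi>_nonzero B1_\<phi> by (simp_all add: b_def)
  define d' where "d' t = indicator {0..} t *\<^sub>R d t" for t :: real
  have d': "d' t = d t" if "t \<ge> 0" for t using that by (simp add: d'_def)
  have d'_lb: "loc_bounded d'"
    unfolding loc_bounded_def
  proof (intro conjI allI)
    show "d' \<in> borel_measurable lebesgue"
      using d unfolding d'_def[abs_def] set_borel_measurable_def .
    show "\<exists>K. \<forall>t\<in>{0..N}. norm (d' t) \<le> K" for N
      using d_le d' by (intro exI[of _ Kd]) simp
  qed
  define \<kappa> where "\<kappa> = - (conjugate b / b * of_real K)"
  have n\<kappa>: "norm \<kappa> = K" using b K by (simp add: \<kappa>_def norm_mult norm_divide)
  have Kb: "Kd * norm b < K" using K b by (simp add: b_def pos_less_divide_eq)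
  define q where "q t = conjugate b * d' t" for t
  have q_lb: "loc_bounded q" unfolding q_def by (rule loc_bounded_cmult[OF d'_lb])
  have q_le: "norm (q t) \<le> norm \<kappa>" if "t \<ge> 0" for t
  proof -
    have "norm (q t) = norm b * norm (d t)" using d'[OF that] by (simp add: q_def norm_mult)
    also have "\<dots> \<le> norm b * Kd" using d_le[OF that] by (intro mult_left_mono) auto
    finally show ?thesis using Kb n\<kappa> by (simp add: mult.commute)
  qed
  have \<kappa>0: "\<kappa> \<noteq> 0" using n\<kappa> K(1) by auto
  obtain \<sigma> s where \<sigma>: "continuous_on UNIV \<sigma>" and s: "loc_bounded s" "\<And>t. t \<ge> 0 \<Longrightarrow> s t \<in> set_sign (\<sigma> t)"
    and \<sigma>_eq: "\<And>t. t \<ge> 0 \<Longrightarrow>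
      \<sigma> t = ip \<phi> z0 + integral {0..t} (\<lambda>r. (conjugate \<mu> - conjugate b / b * \<mu>) * \<sigma> r + q r + \<kappa> * s r)"
  proof (rule sliding_mode_scalar[OF q_lb, where \<kappa> = \<kappa> and ?s0.0 = "ip \<phi> z0" and a = "conjugate \<mu> - conjugate b / b * \<mu>"])
    show "norm (q t) \<le> norm \<kappa>" if "t \<ge> 0" for t by (rule q_le[OF that])
    show "\<kappa> \<noteq> 0" by (rule \<kappa>0)
  qed (rule that)
  define h where "h t = - (1 / b) * \<mu> * \<sigma> t + (- (1 / b) * of_real K) * s t + d' t" for t
  have h_lb: "loc_bounded h"
    unfolding h_def
    by (intro loc_bounded_add d'_lb loc_bounded_cmult[OF s(1)] loc_bounded_if_continuous continuous_intros \<sigma>)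
  have drift: "(conjugate \<mu> - conjugate b / b * \<mu>) * \<sigma> r + q r + \<kappa> * s r = conjugate \<mu> * \<sigma> r + h r * B 1 \<phi>" for r
    unfolding h_def q_def \<kappa>_def b(2) using b(1) by (simp add: field_simps)
  obtain z where traj: "mild_trajectory scl ip D A B DL L S z0 h z" and z\<sigma>: "\<And>t. t \<ge> 0 \<Longrightarrow> ip \<phi> (z t) = \<sigma> t"
  proof (rule closed_loop_with_output[OF _ h_lb, of \<sigma> z0])
    show "continuous_on {0..} \<sigma>" by (rule continuous_on_subset[OF \<sigma>]) simp
    show "\<sigma> t = ip \<phi> z0 + integral {0..t} (\<lambda>r. conjugate \<mu> * \<sigma> r + h r * B 1 \<phi>)" if "t \<ge> 0" for t
      using \<sigma>_eq[OF that] unfolding drift .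
  qed (rule that)
  have "h t \<in> {- (1 / b) * (\<mu> * \<sigma> t + of_real K * s) + d t | s. s \<in> set_sign (\<sigma> t)}" if t: "t \<ge> 0" for t
  proof -
    have "h t = - (1 / b) * (\<mu> * \<sigma> t + of_real K * s t) + d t"
      using d'[OF t] by (simp add: h_def algebra_simps)
    then show ?thesis using s(2)[OF t] by blast
  qed
  then have incl: "AE t in lebesgue. t \<ge> 0 \<longrightarrow> (let \<sigma> = ip \<phi> (z t) in
      h t \<in> {- (1 / control_adj B \<phi>) * (\<mu> * \<sigma> + of_real K * s) + d t | s. s \<in> set_sign \<sigma>})"
    using z\<sigma> by (intro AE_I2) (simp add: Let_def b_def)
  have "L2_loc h"
    unfolding L2_loc_def
  proof (intro conjI allI impI)
    have "h \<in> borel_measurable lebesgue" using h_lb by (simp add: loc_bounded_def)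
    then show "set_borel_measurable lebesgue {0..} h"
      unfolding set_borel_measurable_def by (intro borel_measurable_scaleR borel_measurable_indicator) auto
    show "set_integrable lebesgue {0..t} (\<lambda>s. (norm (h s))\<^sup>2)" for t
      by (rule loc_bounded_integrable[OF loc_bounded_norm_sq[OF h_lb]]) simp
  qed
  then show ?thesis using traj incl unfolding SM_mild_solution_def by blast
qed

lemma mild_trajectory_cong:
  assumes "mild_trajectory scl ip D A B DL L S z0 h z" "\<And>t. t \<ge> 0 \<Longrightarrow> h t = v t"
  shows "mild_trajectory scl ip D A B DL L S z0 v z"
proof -
  have "input_map ip S B h t \<psi> = input_map ip S B v t \<psi>" for t \<psi>
    unfolding input_map_def by (rule set_lebesgue_integral_cong) (use assms(2) in auto)
  then show ?thesis using assms(1) unfolding mild_trajectory_def by simp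
qed

end


section \<open>Super-twisting control\<close>

text \<open>
  An isolated point is determined by two rational numbers that separate it from the others.
\<close>

lemma countable_if_isolated:
  fixes Z :: "real set"
  assumes "\<And>t. t \<in> Z \<Longrightarrow> \<exists>\<eta>>0. \<forall>s\<in>Z. \<bar>s - t\<bar> < \<eta> \<longrightarrow> s = t"
  shows "countable Z"
proof -
  have "\<exists>p q. p \<in> \<rat> \<and> q \<in> \<rat> \<and> p < t \<and> t < q \<and> (\<forall>s\<in>Z. p < s \<longrightarrow> s < q \<longrightarrow> s = t)" if t: "t \<in> Z" for t
  proof -
    obtain \<eta> where \<eta>: "\<eta> > 0" "\<And>s. s \<in> Z \<Longrightarrow> \<bar>s - t\<bar> < \<eta> \<Longrightarrow> s = t" using assms[OF t] by blast
    obtain p where p: "p \<in> \<rat>" "t - \<eta> < p" "p < t" using Rats_dense_in_real[of "t - \<eta>" t] \<eta>(1) by auto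
    obtain q where q: "q \<in> \<rat>" "t < q" "q < t + \<eta>" using Rats_dense_in_real[of t "t + \<eta>"] \<eta>(1) by auto
    have "\<forall>s\<in>Z. p < s \<longrightarrow> s < q \<longrightarrow> s = t" using p q \<eta>(2) by (auto simp: abs_less_iff)
    then show ?thesis using p q by blast
  qed
  then obtain p q where pq: "\<And>t. t \<in> Z \<Longrightarrow> p t \<in> \<rat> \<and> q t \<in> \<rat> \<and> p t < t \<and> t < q t \<and> (\<forall>s\<in>Z. p t < s \<longrightarrow> s < q t \<longrightarrow> s = t)"
    by metis
  have "inj_on (\<lambda>t. (p t, q t)) Z"
  proof (rule inj_onI)
    fix s t assume st: "s \<in> Z" "t \<in> Z" "(p s, q s) = (p t, q t)"
    then have eq: "p t = p s" "q t = q s" by simp_all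
    have "p t < s" "s < q t" unfolding eq using pq[OF st(1)] by blast+
    then show "s = t" using pq[OF st(2)] st(1) by blast
  qed
  moreover have "countable ((\<lambda>t. (p t, q t)) ` Z)"
    by (rule countable_subset[of _ "\<rat> \<times> \<rat>"]) (use pq countable_rat in auto)
  ultimately show ?thesis by (rule countable_image_inj_on[rotated])
qed

lemma abs_continuous_on_if_lipschitz:
  assumes "\<Lambda>-lipschitz_on X f"
  shows "abs_continuous_on X f"
  unfolding abs_continuous_on_def
proof (intro allI impI)
  fix \<epsilon> :: real assume \<epsilon>: "\<epsilon> > 0"
  have \<Lambda>: "\<Lambda> \<ge> 0" by (rule lipschitz_on_nonneg[OF assms])
  have "(\<Sum>i<n. \<bar>f (b i) - f (a i)\<bar>) < \<epsilon>"
    if ab: "\<forall>i<n. a i \<le> b i \<and> {a i..b i} \<subseteq> X" and small: "(\<Sum>i<n. b i - a i) < \<epsilon> / (\<Lambda> + 1)"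
    for n and a b :: "nat \<Rightarrow> real"
  proof -
    have "(\<Sum>i<n. \<bar>f (b i) - f (a i)\<bar>) \<le> (\<Sum>i<n. \<Lambda> * (b i - a i))"
    proof (rule sum_mono)
      fix i assume "i \<in> {..<n}"
      then have i: "a i \<le> b i" "{a i..b i} \<subseteq> X" using ab by auto
      then have "a i \<in> X" "b i \<in> X" by auto
      then show "\<bar>f (b i) - f (a i)\<bar> \<le> \<Lambda> * (b i - a i)"
        using lipschitz_onD[OF assms, of "b i" "a i"] i(1) by (simp add: dist_real_def)
    qed
    also have "\<dots> = \<Lambda> * (\<Sum>i<n. b i - a i)" by (simp add: sum_distrib_left)
    also have "\<dots> \<le> (\<Lambda> + 1) * (\<Sum>i<n. b i - a i)"
      using ab by (intro mult_right_mono sum_nonneg) auto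
    also have "\<dots> < (\<Lambda> + 1) * (\<epsilon> / (\<Lambda> + 1))" using small \<Lambda> by (intro mult_strict_left_mono) auto
    finally show ?thesis using \<Lambda> by simp
  qed
  moreover have "\<epsilon> / (\<Lambda> + 1) > 0" using \<epsilon> \<Lambda> by simp
  ultimately show "\<exists>\<delta>>0. \<forall>n (a :: nat \<Rightarrow> real) b.
        (\<forall>i<n. a i \<le> b i \<and> {a i..b i} \<subseteq> X) \<and> disjoint_family_on (\<lambda>i. {a i<..<b i}) {..<n}
          \<and> (\<Sum>i<n. b i - a i) < \<delta> \<longrightarrow> (\<Sum>i<n. \<bar>f (b i) - f (a i)\<bar>) < \<epsilon>"
    by blast
qed

lemma abs_sqrt_le: "\<bar>sqrt x\<bar> \<le> 1 + \<bar>x\<bar>"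
proof -
  have "\<bar>sqrt x\<bar> = sqrt \<bar>x\<bar>" by (simp add: real_sqrt_abs2 abs_if real_sqrt_minus)
  also have "\<dots> \<le> sqrt ((1 + \<bar>x\<bar>)\<^sup>2)" by (intro real_sqrt_le_mono) (simp add: power2_sum)
  finally show ?thesis by simp
qed

text \<open>
  The function \<open>sqrt\<close> is odd, so \<open>\<alpha> sqrt (\<sigma> r)\<close> is the term \<open>\<alpha> |\<sigma>|\<^sup>1\<^sup>/\<^sup>2 sgn \<sigma>\<close> of the control
  law. In terms of \<open>W = w0 + b (d - d 0) - \<beta> G\<close> the relay solution satisfies \<open>x' = W - \<alpha> sqrt x\<close>,
  and \<open>W' = b d' - \<beta> sgn x\<close> at almost every time with \<open>x \<noteq> 0\<close>. At a zero of \<open>x\<close> with \<open>W \<noteq> 0\<close> the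
  derivative of \<open>x\<close> does not vanish; such zeros are isolated, hence countable. At the first common
  zero of \<open>x\<close> and \<open>W\<close> both are stopped: \<open>w' = 0\<close> is allowed there, since the element \<open>b d' / \<beta>\<close> of
  \<open>[-1, 1]\<close> balances the disturbance.
\<close>

lemma super_twisting_scalar:
  fixes \<alpha> \<beta> b x0 w0 C :: real and d :: "real \<Rightarrow> real"
  assumes \<beta>: "\<beta> > \<bar>b\<bar> * C" "\<beta> > 0" and d: "M-lipschitz_on {0..} d"
    and ae: "AE t in lebesgue. t \<ge> 0 \<longrightarrow> d differentiable (at t) \<and> \<bar>deriv d t\<bar> \<le> C"
  obtains \<sigma> w \<Lambda> where "continuous_on UNIV \<sigma>" "continuous_on UNIV w" "\<Lambda>-lipschitz_on {0..} w" "w 0 = w0"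
    "\<And>t. t \<ge> 0 \<Longrightarrow> \<sigma> t = x0 + integral {0..t} (\<lambda>r. w r - \<alpha> * sqrt (\<sigma> r))"
    "AE t in lebesgue. t \<ge> 0 \<longrightarrow> w differentiable (at t)
      \<and> deriv w t \<in> {b * deriv d t - \<beta> * s | s. s \<in> set_sign (\<sigma> t)}"
proof -
  have M: "M \<ge> 0" by (rule lipschitz_on_nonneg[OF d])
  \<comment> \<open>Clamping extends the disturbance to a Lipschitz function on the line.\<close>
  define p where "p r = w0 + b * (d (max 0 r) - d 0)" for r
  have d_lip: "\<bar>d (max 0 r) - d (max 0 s)\<bar> \<le> M * \<bar>r - s\<bar>" for r s
  proof -
    have "\<bar>d (max 0 r) - d (max 0 s)\<bar> \<le> M * \<bar>max 0 r - max 0 s\<bar>"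
      using lipschitz_onD[OF d, of "max 0 r" "max 0 s"] by (simp add: dist_real_def)
    also have "\<dots> \<le> M * \<bar>r - s\<bar>" using M by (intro mult_left_mono) auto
    finally show ?thesis .
  qed
  have p_lip: "\<bar>p r - p s\<bar> \<le> \<bar>b\<bar> * M * \<bar>r - s\<bar>" for r s
  proof -
    have "\<bar>p r - p s\<bar> = \<bar>b\<bar> * \<bar>d (max 0 r) - d (max 0 s)\<bar>" by (simp add: p_def abs_mult[symmetric] algebra_simps)
    also have "\<dots> \<le> \<bar>b\<bar> * (M * \<bar>r - s\<bar>)" by (intro mult_left_mono d_lip) auto
    finally show ?thesis by simp
  qed
  have "(\<bar>b\<bar> * M)-lipschitz_on UNIV p"
    by (rule lipschitz_onI) (use p_lip M in \<open>auto simp: dist_real_def\<close>)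
  then have pc: "continuous_on UNIV p" by (rule lipschitz_on_continuous_on)
  have p_le: "norm (p t) \<le> (\<bar>w0\<bar> + \<bar>b\<bar> * M) * (1 + t)" if "t \<ge> 0" for t
  proof -
    have "p 0 = w0" by (simp add: p_def)
    then have "\<bar>p t - w0\<bar> \<le> \<bar>b\<bar> * M * t" using p_lip[of t 0] that by simp
    then have "\<bar>p t\<bar> \<le> \<bar>w0\<bar> + \<bar>b\<bar> * M * t" by linarith
    also have "\<dots> \<le> (\<bar>w0\<bar> + \<bar>b\<bar> * M) * (1 + t)" using that M by (simp add: algebra_simps)
    finally show ?thesis by simp
  qed
  have f: "continuous_on UNIV (\<lambda>x. - \<alpha> * sqrt x)" by (intro continuous_intros)
  have f_le: "norm (- \<alpha> * sqrt x) \<le> \<bar>\<alpha>\<bar> * (1 + norm x)" for x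
    using mult_left_mono[OF abs_sqrt_le[of x], of "\<bar>\<alpha>\<bar>"] by (simp add: abs_mult)
  obtain x G where x: "continuous_on UNIV x" and G_lip: "\<And>a b. norm (G b - G a) \<le> \<bar>b - a\<bar>" and G0: "G 0 = (0::real)"
    and x_eq: "\<And>t. t \<ge> 0 \<Longrightarrow> x t = x0 + integral {0..t} (\<lambda>r. - \<alpha> * sqrt (x r) + p r + (- \<beta>) * G r) + 0 * G t"
    and G: "\<And>a b. 0 \<le> a \<Longrightarrow> a \<le> b \<Longrightarrow> \<forall>r\<in>{a<..<b}. x r \<noteq> 0 \<Longrightarrow>
      G b - G a = integral {a..b} (\<lambda>r. sgn (x r))"
  proof (rule relay_equation_solvable[OF f f_le loc_bounded_if_continuous[OF pc],
        where P = "\<bar>w0\<bar> + \<bar>b\<bar> * M" and ?x0.0 = x0 and c = "- \<beta>" and e = 0])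
    show "norm (p t) \<le> (\<bar>w0\<bar> + \<bar>b\<bar> * M) * (1 + t)" if "t \<ge> 0" for t by (rule p_le[OF that])
  qed (rule that)
  define W where "W r = p r - \<beta> * G r" for r
  have W0: "W 0 = w0" by (simp add: W_def p_def G0)
  define \<Lambda> where "\<Lambda> = \<bar>b\<bar> * M + \<beta>"
  have W_lip: "\<bar>W r - W s\<bar> \<le> \<Lambda> * \<bar>r - s\<bar>" for r s
  proof -
    have "\<bar>W r - W s\<bar> \<le> \<bar>p r - p s\<bar> + \<bar>\<beta> * (G r - G s)\<bar>" by (simp add: W_def algebra_simps)
    also have "\<bar>\<beta> * (G r - G s)\<bar> \<le> \<beta> * \<bar>r - s\<bar>"
      using mult_left_mono[OF G_lip[of r s], of \<beta>] \<beta>(2) by (simp add: abs_mult)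
    finally show ?thesis using p_lip[of r s] by (simp add: \<Lambda>_def algebra_simps)
  qed
  have \<Lambda>0: "\<Lambda> \<ge> 0" using M \<beta>(2) by (simp add: \<Lambda>_def)
  have "\<Lambda>-lipschitz_on UNIV W"
    by (rule lipschitz_onI) (use W_lip \<Lambda>0 in \<open>auto simp: dist_real_def\<close>)
  then have Wc: "continuous_on UNIV W" by (rule lipschitz_on_continuous_on)
  have rhs_c: "continuous_on X (\<lambda>r. W r - \<alpha> * sqrt (x r))" for X
    by (intro continuous_intros continuous_on_subset[OF Wc] continuous_on_subset[OF x]) auto
  have x_eq': "x t = x0 + integral {0..t} (\<lambda>r. W r - \<alpha> * sqrt (x r))" if "t \<ge> 0" for t
    using x_eq[OF that] by (simp add: W_def algebra_simps)
  have dx: "(x has_real_derivative W t - \<alpha> * sqrt (x t)) (at t)" if t: "t > 0" for t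
  proof -
    have "((\<lambda>s. integral {0..s} (\<lambda>r. W r - \<alpha> * sqrt (x r))) has_vector_derivative W t - \<alpha> * sqrt (x t)) (at t within {0..t + 1})"
      by (rule integral_has_vector_derivative[OF rhs_c]) (use t in auto)
    then have "((\<lambda>s. integral {0..s} (\<lambda>r. W r - \<alpha> * sqrt (x r))) has_real_derivative W t - \<alpha> * sqrt (x t)) (at t)"
      using t by (simp add: at_within_Icc_at has_real_derivative_iff_has_vector_derivative)
    then have "((\<lambda>s. x0 + integral {0..s} (\<lambda>r. W r - \<alpha> * sqrt (x r))) has_real_derivative W t - \<alpha> * sqrt (x t)) (at t)"
      by (auto intro!: derivative_eq_intros)
    then show ?thesis
      by (rule has_field_derivative_transform_within_open[where S = "{0<..}"]) (use t x_eq' in auto)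
  qed
  define Z where "Z = {t. t > 0 \<and> x t = 0 \<and> W t \<noteq> 0}"
  have "countable Z"
  proof (rule countable_if_isolated)
    fix t assume t: "t \<in> Z"
    then have "((\<lambda>s. (x s - x t) / (s - t)) \<longlongrightarrow> W t) (at t)" "W t \<noteq> 0"
      using dx[of t] by (auto simp: Z_def has_field_derivative_iff)
    then have "\<forall>\<^sub>F s in at t. (x s - x t) / (s - t) \<noteq> 0" by (rule tendsto_imp_eventually_ne)
    then obtain \<eta> where "\<eta> > 0" "\<And>s. s \<noteq> t \<Longrightarrow> dist s t < \<eta> \<Longrightarrow> (x s - x t) / (s - t) \<noteq> 0"
      unfolding eventually_at by auto
    then show "\<exists>\<eta>>0. \<forall>s\<in>Z. \<bar>s - t\<bar> < \<eta> \<longrightarrow> s = t"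
      using t by (intro exI[of _ \<eta>]) (auto simp: Z_def dist_real_def)
  qed
  then have AE_Z: "AE t in lebesgue. t \<notin> Z"
    by (intro AE_not_in null_sets_completionI countable_imp_null_set_lborel)
  have AE_pt: "AE t in lebesgue. t \<noteq> c" for c :: real
    using AE_not_in[of "{c}" lebesgue] negligible_iff_null_sets[of "{c}"] by simp
  have dW: "(W has_real_derivative b * deriv d t - \<beta> * sgn (x t)) (at t)"
    if t: "t > 0" and xt: "x t \<noteq> 0" and dt: "d differentiable (at t)" for t
  proof -
    have "isCont x t" using x by (simp add: continuous_on_eq_continuous_at)
    then have "\<forall>\<^sub>F s in at t. dist (x s) (x t) < \<bar>x t\<bar>"
      using xt by (intro tendstoD) (auto simp: isCont_def)
    then obtain \<eta> where \<eta>: "\<eta> > 0" "\<And>s. s \<noteq> t \<Longrightarrow> dist s t < \<eta> \<Longrightarrow> dist (x s) (x t) < \<bar>x t\<bar>"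
      unfolding eventually_at by auto
    have sg: "sgn (x s) = sgn (x t)" if "\<bar>s - t\<bar> < \<eta>" for s
      using \<eta>(2)[of s] that xt by (cases "s = t") (auto simp: dist_real_def sgn_if abs_if split: if_splits)
    define l where "l = max (t / 2) (t - \<eta> / 2)"
    have l: "0 \<le> l" "l < t" "t - l < \<eta>" using t \<eta>(1) by (auto simp: l_def)
    have Gs: "G l + (s - l) * sgn (x t) = G s" if s: "s \<in> {l<..<t + \<eta>}" for s
    proof -
      have sg': "sgn (x r) = sgn (x t)" if "l \<le> r" "r \<le> s" for r
        by (rule sg) (use that s l in auto)
      have "G s - G l = integral {l..s} (\<lambda>r. sgn (x r))"
      proof (rule G[OF l(1)])
        show "\<forall>r\<in>{l<..<s}. x r \<noteq> 0"
        proof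
          fix r assume "r \<in> {l<..<s}"
          then have "sgn (x r) = sgn (x t)" by (intro sg') auto
          then show "x r \<noteq> 0" using xt by (metis sgn_zero_iff)
        qed
      qed (use s in simp)
      also have "\<dots> = integral {l..s} (\<lambda>_. sgn (x t))"
        by (rule integral_cong) (use sg' in auto)
      finally show ?thesis using s by simp
    qed
    have "((\<lambda>s. G l + (s - l) * sgn (x t)) has_real_derivative sgn (x t)) (at t)"
      by (auto intro!: derivative_eq_intros)
    then have dG: "(G has_real_derivative sgn (x t)) (at t)"
      by (rule has_field_derivative_transform_within_open[OF _ open_greaterThanLessThan _ Gs])
         (use l \<eta>(1) in simp_all)
    have "(d has_real_derivative deriv d t) (at t)"
      using dt by (simp add: DERIV_deriv_iff_real_differentiable)
    then have "((\<lambda>s. d (max 0 s)) has_real_derivative deriv d t) (at t)"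
      by (rule has_field_derivative_transform_within_open[where S = "{0<..}"]) (use t in auto)
    then show ?thesis
      unfolding W_def p_def by (auto intro!: derivative_eq_intros dG)
  qed
  let ?good = "\<lambda>\<sigma> w t. w differentiable (at t) \<and> deriv w t \<in> {b * deriv d t - \<beta> * s | s. s \<in> set_sign (\<sigma> t)}"
  have goodI: "?good \<sigma> w t"
    if "(w has_real_derivative b * deriv d t - \<beta> * s) (at t)" "s \<in> set_sign (\<sigma> t)" for \<sigma> w :: "real \<Rightarrow> real" and t s
    using that DERIV_imp_deriv[OF that(1)] real_differentiable_def by blast
  show ?thesis
  proof (cases "\<exists>t1\<ge>0. x t1 = 0 \<and> W t1 = 0")
    case False
    have "AE t in lebesgue. t \<ge> 0 \<longrightarrow> ?good x W t"
      using ae AE_Z AE_pt[of 0]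
    proof eventually_elim
      case (elim t)
      show ?case
      proof
        assume "t \<ge> 0"
        then have t: "t > 0" "x t \<noteq> 0" "d differentiable (at t)" using elim False by (auto simp: Z_def)
        show "?good x W t"
          by (rule goodI[where \<sigma> = x and w = W and t = t, OF dW[OF t] sgn_in_set_sign[OF t(2)]])
      qed
    qed
    moreover have "\<Lambda>-lipschitz_on {0..} W" using \<open>\<Lambda>-lipschitz_on UNIV W\<close> by (rule lipschitz_on_subset) simp
    ultimately show ?thesis using that[OF x Wc _ W0 x_eq'] by blast
  next
    case True
    then obtain t1 where t1: "t1 \<ge> 0" "x t1 = 0" "W t1 = 0" by blast
    have closed: "closed {t. x t = 0 \<and> W t = 0}"
      by (intro closed_Collect_conj closed_Collect_eq x Wc continuous_on_const)
    obtain t0 where hit: "t0 \<ge> 0" "t0 \<in> {t. x t = 0 \<and> W t = 0}"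
      and first: "\<And>r. 0 \<le> r \<Longrightarrow> r < t0 \<Longrightarrow> r \<notin> {t. x t = 0 \<and> W t = 0}"
    proof (rule first_time_in_closed_set[OF closed _ t1(1)])
      show "t1 \<in> {t. x t = 0 \<and> W t = 0}" using t1 by simp
    qed (rule that)
    have t0: "t0 \<ge> 0" "x t0 = 0" "W t0 = 0" using hit by auto
    have alive: "W r \<noteq> 0" if "0 \<le> r" "r < t0" "x r = 0" for r
      using first[OF that(1,2)] that(3) by simp
    define \<sigma> where "\<sigma> t = x (min t t0)" for t
    define w where "w t = W (min t t0)" for t
    have \<sigma>c: "continuous_on UNIV \<sigma>"
      unfolding \<sigma>_def by (rule continuous_on_compose2[OF x]) (auto intro!: continuous_intros)
    have wc: "continuous_on UNIV w"
      unfolding w_def by (rule continuous_on_compose2[OF Wc]) (auto intro!: continuous_intros)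
    have "\<bar>w r - w s\<bar> \<le> \<Lambda> * \<bar>r - s\<bar>" for r s
    proof -
      have "\<bar>w r - w s\<bar> \<le> \<Lambda> * \<bar>min r t0 - min s t0\<bar>" unfolding w_def by (rule W_lip)
      also have "\<dots> \<le> \<Lambda> * \<bar>r - s\<bar>" using \<Lambda>0 by (intro mult_left_mono) auto
      finally show ?thesis .
    qed
    then have w_lip: "\<Lambda>-lipschitz_on {0..} w"
      by (intro lipschitz_onI) (auto simp: dist_real_def \<Lambda>0)
    have w0: "w 0 = w0" using t0(1) W0 by (simp add: w_def)
    have before: "\<sigma> t = x0 + integral {0..t} (\<lambda>r. w r - \<alpha> * sqrt (\<sigma> r))" if t: "t \<ge> 0" "t \<le> t0" for t
    proof -
      have "integral {0..t} (\<lambda>r. W r - \<alpha> * sqrt (x r)) = integral {0..t} (\<lambda>r. w r - \<alpha> * sqrt (\<sigma> r))"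
        by (rule integral_cong) (use t in \<open>auto simp: w_def \<sigma>_def\<close>)
      then show ?thesis using x_eq'[OF t(1)] t by (simp add: \<sigma>_def)
    qed
    have \<sigma>_eq: "\<sigma> t = x0 + integral {0..t} (\<lambda>r. w r - \<alpha> * sqrt (\<sigma> r))" if t: "t \<ge> 0" for t
    proof (rule stopped_integral_equation[OF t0(1) _ before _ _ t])
      show "(\<lambda>r. w r - \<alpha> * sqrt (\<sigma> r)) integrable_on {0..t}"
        by (intro integrable_continuous_interval continuous_intros continuous_on_subset[OF wc] continuous_on_subset[OF \<sigma>c]) auto
    qed (use t0 in \<open>simp_all add: \<sigma>_def w_def\<close>)
    have "AE t in lebesgue. t \<ge> 0 \<longrightarrow> ?good \<sigma> w t"
      using ae AE_Z AE_pt[of 0] AE_pt[of t0]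
    proof eventually_elim
      case (elim t)
      show ?case
      proof
        assume "t \<ge> 0"
        then have t: "t > 0" "d differentiable (at t)" "\<bar>deriv d t\<bar> \<le> C" using elim by auto
        show "?good \<sigma> w t"
        proof (cases "t < t0")
          case True
          have xt: "x t \<noteq> 0" using alive[of t] True t elim by (auto simp: Z_def)
          have "(w has_real_derivative b * deriv d t - \<beta> * sgn (x t)) (at t)"
            by (rule has_field_derivative_transform_within_open[OF dW[OF t(1) xt t(2)], where S = "{..<t0}"])
               (use True in \<open>auto simp: w_def\<close>)
          moreover have "sgn (x t) \<in> set_sign (\<sigma> t)" using sgn_in_set_sign[OF xt] True by (simp add: \<sigma>_def)
          ultimately show ?thesis by (rule goodI[where \<sigma> = \<sigma> and w = w and t = t])
        next
          case False
          then have tt: "t > t0" using elim by simp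
          have "(w has_real_derivative 0) (at t)"
            by (rule has_field_derivative_transform_within_open[OF DERIV_const[of 0], where S = "{t0<..}"])
               (use tt t0(3) in \<open>auto simp: w_def\<close>)
          then have "(w has_real_derivative b * deriv d t - \<beta> * (b * deriv d t / \<beta>)) (at t)" using \<beta>(2) by simp
          moreover have "b * deriv d t / \<beta> \<in> set_sign (\<sigma> t)"
          proof -
            have "\<bar>b * deriv d t\<bar> \<le> \<bar>b\<bar> * C" unfolding abs_mult using t(3) by (intro mult_left_mono) auto
            then have "\<bar>b * deriv d t / \<beta>\<bar> \<le> 1" using \<beta> by (simp add: divide_le_eq_1)
            moreover have "\<sigma> t = 0" using tt t0(2) by (simp add: \<sigma>_def)
            ultimately show ?thesis by (simp add: set_sign_def)
          qed
          ultimately show ?thesis by (rule goodI[where \<sigma> = \<sigma> and w = w and t = t])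
        qed
      qed
    qed
    then show ?thesis using that[OF \<sigma>c wc w_lip w0 \<sigma>_eq] by blast
  qed
qed

theorem super_twisting_solution:
  fixes scl :: "real \<Rightarrow> 'h::banach \<Rightarrow> 'h"
  assumes sys: "feedback_system scl ip D A B T \<tau> DL L S \<phi> \<mu>"
    and d: "M-lipschitz_on {0..} d"
    and ae: "AE t in lebesgue. t \<ge> 0 \<longrightarrow> d differentiable (at t) \<and> \<bar>deriv d t\<bar> \<le> C"
    and \<beta>: "\<beta> > 0" "\<beta> > \<bar>control_adj B \<phi>\<bar> * C"
  shows "\<exists>z w. ST_mild_solution scl ip D A B DL L S \<phi> \<mu> \<alpha> \<beta> d z0 w0 z w"
proof -
  interpret feedback_system scl ip D A B T \<tau> DL L S \<phi> \<mu> by (rule sys)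
  define b where "b = control_adj B \<phi>"
  have b: "b \<noteq> 0" "B 1 \<phi> = b" using control_adj_\<phi>_nonzero B1_\<phi> by (simp_all add: b_def)
  obtain \<sigma> w \<Lambda> where \<sigma>: "continuous_on UNIV \<sigma>" and wc: "continuous_on UNIV w" and w_lip: "\<Lambda>-lipschitz_on {0..} w" and w0: "w 0 = w0"
    and \<sigma>_eq: "\<And>t. t \<ge> 0 \<Longrightarrow> \<sigma> t = ip \<phi> z0 + integral {0..t} (\<lambda>r. w r - \<alpha> * sqrt (\<sigma> r))"
    and w_ae: "AE t in lebesgue. t \<ge> 0 \<longrightarrow> w differentiable (at t)
      \<and> deriv w t \<in> {b * deriv d t - \<beta> * s | s. s \<in> set_sign (\<sigma> t)}"
    by (rule super_twisting_scalar[OF \<beta>(2)[folded b_def] \<beta>(1) d ae, where ?x0.0 = "ip \<phi> z0" and \<alpha> = \<alpha> and ?w0.0 = w0])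
       (assumption | rule that)+
  define h where "h t = 1 / b * (- \<mu> * \<sigma> t - \<alpha> * sqrt (\<sigma> t) + w t)" for t
  have h_lb: "loc_bounded h"
    unfolding h_def by (intro loc_bounded_if_continuous continuous_intros \<sigma> wc)
  have drift: "w r - \<alpha> * sqrt (\<sigma> r) = conjugate \<mu> * \<sigma> r + h r * B 1 \<phi>" for r
    unfolding h_def b(2) using b(1) by (simp add: field_simps)
  obtain z where traj: "mild_trajectory scl ip D A B DL L S z0 h z" and z\<sigma>: "\<And>t. t \<ge> 0 \<Longrightarrow> ip \<phi> (z t) = \<sigma> t"
  proof (rule closed_loop_with_output[OF _ h_lb, of \<sigma> z0])
    show "continuous_on {0..} \<sigma>" by (rule continuous_on_subset[OF \<sigma>]) simp
    show "\<sigma> t = ip \<phi> z0 + integral {0..t} (\<lambda>r. conjugate \<mu> * \<sigma> r + h r * B 1 \<phi>)" if "t \<ge> 0" for t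
      using \<sigma>_eq[OF that] unfolding drift .
  qed (rule that)
  have sqrt_sgn: "sqrt \<bar>y\<bar> * sgn y = sqrt y" for y :: real
    by (cases "y \<ge> 0") (auto simp: sgn_if real_sqrt_minus)
  have "mild_trajectory scl ip D A B DL L S z0
      (\<lambda>t. let \<sigma> = ip \<phi> (z t) in 1 / control_adj B \<phi> * (- \<mu> * \<sigma> - \<alpha> * (sqrt \<bar>\<sigma>\<bar> * sgn \<sigma>) + w t)) z"
    by (rule mild_trajectory_cong[OF traj]) (simp add: Let_def z\<sigma> sqrt_sgn h_def b_def)
  moreover have "AE t in lebesgue. t \<ge> 0 \<longrightarrow> w differentiable (at t)
        \<and> deriv w t \<in> {control_adj B \<phi> * deriv d t - \<beta> * s | s. s \<in> set_sign (ip \<phi> (z t))}"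
    using w_ae by eventually_elim (simp add: z\<sigma> b_def)
  ultimately show ?thesis
    unfolding ST_mild_solution_def using abs_continuous_on_if_lipschitz[OF w_lip] w0 by blast
qed

theorem theorem1:
  shows
    "(\<forall>(scl :: real \<Rightarrow> 'h::banach \<Rightarrow> 'h) ip D A B T \<tau> DL L S \<phi> \<mu> d K\<^sub>d K.
        feedback_system scl ip D A B T \<tau> DL L S \<phi> \<mu>
        \<longrightarrow> set_borel_measurable lebesgue {0..} d
        \<longrightarrow> K\<^sub>d > 0 \<longrightarrow> (\<forall>t\<ge>0. norm (d t) \<le> K\<^sub>d)
        \<longrightarrow> K > 0 \<longrightarrow> K / norm (control_adj B \<phi>) > K\<^sub>d
        \<longrightarrow> (\<forall>z0. \<exists>z. SM_mild_solution scl ip D A B DL L S \<phi> \<mu> K d z0 z))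
   \<and>
     (\<forall>(scl :: complex \<Rightarrow> 'g::banach \<Rightarrow> 'g) ip D A B T \<tau> DL L S \<phi> \<mu> d K\<^sub>d K.
        feedback_system scl ip D A B T \<tau> DL L S \<phi> \<mu>
        \<longrightarrow> set_borel_measurable lebesgue {0..} d
        \<longrightarrow> K\<^sub>d > 0 \<longrightarrow> (\<forall>t\<ge>0. norm (d t) \<le> K\<^sub>d)
        \<longrightarrow> K > 0 \<longrightarrow> K / norm (control_adj B \<phi>) > K\<^sub>d
        \<longrightarrow> (\<forall>z0. \<exists>z. SM_mild_solution scl ip D A B DL L S \<phi> \<mu> K d z0 z))
   \<and>
     (\<forall>(scl :: real \<Rightarrow> 'h \<Rightarrow> 'h) ip D A B T \<tau> DL L S \<phi> \<mu> d C \<alpha> \<beta>.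
        feedback_system scl ip D A B T \<tau> DL L S \<phi> \<mu>
        \<longrightarrow> (\<exists>M. M-lipschitz_on {0..} d)
        \<longrightarrow> C > 0 \<longrightarrow> (AE t in lebesgue. t \<ge> 0 \<longrightarrow> d differentiable (at t) \<and> \<bar>deriv d t\<bar> \<le> C)
        \<longrightarrow> \<alpha> > 0 \<longrightarrow> \<beta> > 0
        \<longrightarrow> \<beta> > \<bar>control_adj B \<phi>\<bar> * C \<longrightarrow> \<alpha> > sqrt (\<beta> + \<bar>control_adj B \<phi>\<bar> * C)
        \<longrightarrow> (\<forall>z0 w0. \<exists>z w. ST_mild_solution scl ip D A B DL L S \<phi> \<mu> \<alpha> \<beta> d z0 w0 z w))"
proof (intro conjI allI impI)
  fix scl :: "real \<Rightarrow> 'h::banach \<Rightarrow> 'h" and ip D A B T \<tau> DL L S \<phi> \<mu> K\<^sub>d K z0 and d :: "real \<Rightarrow> real"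
  assume sys: "feedback_system scl ip D A B T \<tau> DL L S \<phi> \<mu>"
    and d: "set_borel_measurable lebesgue {0..} d" "K\<^sub>d > 0" "\<forall>t\<ge>0. norm (d t) \<le> K\<^sub>d"
    and K: "K > 0" "K / norm (control_adj B \<phi>) > K\<^sub>d"
  interpret feedback_system scl ip D A B T \<tau> DL L S \<phi> \<mu> by (rule sys)
  show "\<exists>z. SM_mild_solution scl ip D A B DL L S \<phi> \<mu> K d z0 z"
    using sliding_mode_solution[OF d(1,2) _ K] d(3) by blast
next
  fix scl :: "complex \<Rightarrow> 'g::banach \<Rightarrow> 'g" and ip D A B T \<tau> DL L S \<phi> \<mu> K\<^sub>d K z0 and d :: "real \<Rightarrow> complex"
  assume sys: "feedback_system scl ip D A B T \<tau> DL L S \<phi> \<mu>"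
    and d: "set_borel_measurable lebesgue {0..} d" "K\<^sub>d > 0" "\<forall>t\<ge>0. norm (d t) \<le> K\<^sub>d"
    and K: "K > 0" "K / norm (control_adj B \<phi>) > K\<^sub>d"
  interpret feedback_system scl ip D A B T \<tau> DL L S \<phi> \<mu> by (rule sys)
  show "\<exists>z. SM_mild_solution scl ip D A B DL L S \<phi> \<mu> K d z0 z"
    using sliding_mode_solution[OF d(1,2) _ K] d(3) by blast
next
  fix scl :: "real \<Rightarrow> 'h::banach \<Rightarrow> 'h" and ip D A B T \<tau> DL L S \<phi> \<mu> d C \<alpha> \<beta> z0 w0
  assume sys: "feedback_system scl ip D A B T \<tau> DL L S \<phi> \<mu>"
    and d: "\<exists>M. M-lipschitz_on {0..} d"
    and ae: "AE t in lebesgue. t \<ge> 0 \<longrightarrow> d differentiable (at t) \<and> \<bar>deriv d t\<bar> \<le> C"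
    and \<beta>: "\<beta> > 0" "\<beta> > \<bar>control_adj B \<phi>\<bar> * C"
  obtain M where M: "M-lipschitz_on {0..} d" using d by blast
  show "\<exists>z w. ST_mild_solution scl ip D A B DL L S \<phi> \<mu> \<alpha> \<beta> d z0 w0 z w"
    by (rule super_twisting_solution[OF sys M ae \<beta>])
qed

end
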